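(* Let $f:\mathbb{P}^1\to\mathbb{P}^1$ be a quadratic rational map whose conjugacy class $\langle f\rangle$ lies in $\mathrm{Per}_4(0)^*$. Let $A$ be the set of the four points of the superattracting $4$-cycle of $f$, and let $B:=A\cup\mathrm{cv}(f)$, where $\mathrm{cv}(f)$ is the set of critical values of $f$. Then the deformation space $\mathrm{Def}_B^A(f)$ has infinitely many connected components.
   Context: $\mathbb{P}^1$ is the Riemann sphere. $\mathrm{Per}_4(0)$ is the set of Möbius-conjugacy classes of quadratic rational maps having a critical point that is periodic of exact period $4$; $\mathrm{Per}_4(0)^*\subseteq\mathrm{Per}_4(0)$ is the subset of classes for which this superattracting $4$-cycle contains only one critical point of $f$. Teichmüller and moduli spaces: for a finite set $X\subseteq\mathbb{P}^1$ with $|X|\ge 3$, the Teichmüller space $\mathcal{T}_X$ is the set of orientation-preserving homeomorphisms $\phi:\mathbb{P}^1\to\mathbb{P}^1$ modulo the relation $\phi_1\sim\phi_2$ iff there is a Möbius transformation $\nu$ with $\nu\circ\phi_1=\phi_2$ on $X$ and $\nu\circ\phi_1$ isotopic to $\phi_2$ relative to $X$; it is a complex manifold of dimension $|X|-3$. For an admissible rational map $f:(\mathbb{P}^1,A)\to(\mathbb{P}^1,B)$ (i.e. $A,B$ finite with at least $3$ points each, $B$ contains the critical values of $f$, and $f(A)\subseteq B$), the pullback map $\sigma_f:\mathcal{T}_B\to\mathcal{T}_A$ sends $[\phi]$ to $[\psi]$, where $\psi$ is an orientation-preserving homeomorphism such that $\phi\circ f\circ\psi^{-1}$ is a rational map (such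 $\psi$ exists and $[\psi]$ is well defined). If $A\subseteq B$, the forgetful map $\sigma_A^B:\mathcal{T}_B\to\mathcal{T}_A$ sends the class of $\phi$ in $\mathcal{T}_B$ to its class in $\mathcal{T}_A$. The deformation space is $\mathrm{Def}_B^A(f):=\{\tau\in\mathcal{T}_B:\ \sigma_f(\tau)=\sigma_A^B(\tau)\}$. *)

theory Defs
  imports "HOL-Analysis.Analysis" "HOL-Computational_Algebra.Polynomial"
begin

text \<open>The Riemann sphere is modelled as complex option, None being the point at infinity.
  Its topology is the chordal one, obtained from the inverse stereographic embedding into
  the unit sphere of complex x real (= R^3).\<close>

definition sph_emb :: "complex option \<Rightarrow> complex \<times> real" where
  "sph_emb w = (case w of None \<Rightarrow> (0, 1)
     | Some z \<Rightarrow> (of_real (2 / (1 + (cmod z)\<^sup>2)) * z, ((cmod z)\<^sup>2 - 1) / ((cmod z)\<^sup>2 + 1)))"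

definition chordal :: "complex option \<Rightarrow> complex option \<Rightarrow> real" where
  "chordal x y = dist (sph_emb x) (sph_emb y)"

definition P1 :: "complex option topology" where
  "P1 = Metric_space.mtopology UNIV chordal"

definition rat_map :: "complex poly \<Rightarrow> complex poly \<Rightarrow> complex option \<Rightarrow> complex option" where
  "rat_map p q w = (case w of
      Some z \<Rightarrow> (if poly q z = 0 then None else Some (poly p z / poly q z))
    | None \<Rightarrow> (if degree p > degree q then None
               else if degree p = degree q then Some (lead_coeff p / lead_coeff q)
               else Some 0))"

definition rational_map_deg :: "nat \<Rightarrow> (complex option \<Rightarrow> complex option) \<Rightarrow> bool" where
  "rational_map_deg d g \<longleftrightarrow> (\<exists>p q. coprime p q \<and> q \<noteq> 0 \<and> max (degree p) (degree q) = d
        \<and> g = rat_map p q)"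

definition rational_map :: "(complex option \<Rightarrow> complex option) \<Rightarrow> bool" where
  "rational_map g \<longleftrightarrow> (\<exists>d\<ge>1. rational_map_deg d g)"

definition mobius :: "(complex option \<Rightarrow> complex option) \<Rightarrow> bool" where
  "mobius \<nu> \<longleftrightarrow> rational_map_deg 1 \<nu>"

definition loc :: "complex option \<Rightarrow> complex \<Rightarrow> complex option" where
  "loc c w = (case c of Some a \<Rightarrow> Some (a + w) | None \<Rightarrow> (if w = 0 then None else Some (1 / w)))"

definition chart :: "complex option \<Rightarrow> complex option \<Rightarrow> complex" where
  "chart a x = (case a of
      Some b \<Rightarrow> (case x of Some y \<Rightarrow> y - b | None \<Rightarrow> 0)
    | None \<Rightarrow> (case x of Some y \<Rightarrow> inverse y | None \<Rightarrow> 0))"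

definition critical_point :: "(complex option \<Rightarrow> complex option) \<Rightarrow> complex option \<Rightarrow> bool" where
  "critical_point f c \<longleftrightarrow> ((\<lambda>w. chart (f c) (f (loc c w))) has_field_derivative 0) (at 0)"

definition critical_values :: "(complex option \<Rightarrow> complex option) \<Rightarrow> complex option set" where
  "critical_values f = f ` {c. critical_point f c}"

text \<open>Orientation-preserving homeomorphisms of the sphere: homeomorphisms homotopic
  to the identity (equivalently, of degree 1).\<close>
definition homeo_plus :: "(complex option \<Rightarrow> complex option) set" where
  "homeo_plus = {\<phi>. homeomorphic_map P1 P1 \<phi> \<and> homotopic_with (\<lambda>_. True) P1 P1 \<phi> id}"

definition isotopic_rel :: "complex option set \<Rightarrow> (complex option \<Rightarrow> complex option)
      \<Rightarrow> (complex option \<Rightarrow> complex option) \<Rightarrow> bool" where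
  "isotopic_rel X \<phi>1 \<phi>2 \<longleftrightarrow>
     homotopic_with (\<lambda>h. homeomorphic_map P1 P1 h \<and> (\<forall>x\<in>X. h x = \<phi>2 x)) P1 P1 \<phi>1 \<phi>2"

definition teich_equiv :: "complex option set \<Rightarrow> (complex option \<Rightarrow> complex option)
      \<Rightarrow> (complex option \<Rightarrow> complex option) \<Rightarrow> bool" where
  "teich_equiv X \<phi>1 \<phi>2 \<longleftrightarrow>
     (\<exists>\<nu>. mobius \<nu> \<and> (\<forall>x\<in>X. \<nu> (\<phi>1 x) = \<phi>2 x) \<and> isotopic_rel X (\<nu> \<circ> \<phi>1) \<phi>2)"

definition teich_class :: "complex option set \<Rightarrow> (complex option \<Rightarrow> complex option)
      \<Rightarrow> (complex option \<Rightarrow> complex option) set" where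
  "teich_class X \<phi> = {\<psi>\<in>homeo_plus. teich_equiv X \<phi> \<psi>}"

definition teich :: "complex option set \<Rightarrow> (complex option \<Rightarrow> complex option) set set" where
  "teich X = teich_class X ` homeo_plus"

text \<open>Topology: quotient of the compact-open (= uniform, w.r.t. the chordal metric)
  topology on the orientation-preserving homeomorphisms.\<close>
definition sup_dist :: "(complex option \<Rightarrow> complex option) \<Rightarrow> (complex option \<Rightarrow> complex option) \<Rightarrow> real" where
  "sup_dist \<phi> \<psi> = (SUP x. chordal (\<phi> x) (\<psi> x))"

definition homeo_top :: "(complex option \<Rightarrow> complex option) topology" where
  "homeo_top = Metric_space.mtopology homeo_plus sup_dist"

definition quotient_top :: "'a topology \<Rightarrow> ('a \<Rightarrow> 'b) \<Rightarrow> 'b topology" where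
  "quotient_top H q = topology (\<lambda>U. U \<subseteq> q ` topspace H \<and> openin H {x \<in> topspace H. q x \<in> U})"

definition teich_top :: "complex option set \<Rightarrow> (complex option \<Rightarrow> complex option) set topology" where
  "teich_top X = quotient_top homeo_top (teich_class X)"

text \<open>Deformation space: classes [phi] in T_B with sigma_f [phi] = sigma_A^B [phi], i.e. some
  psi with phi o f o psi^-1 rational satisfies [psi]_A = [phi]_A.\<close>
definition Def_space :: "complex option set \<Rightarrow> complex option set \<Rightarrow> (complex option \<Rightarrow> complex option)
      \<Rightarrow> (complex option \<Rightarrow> complex option) set set" where
  "Def_space B A f = {\<tau> \<in> teich B. \<exists>\<phi>\<in>\<tau>. \<exists>\<psi>\<in>homeo_plus.
       rational_map (\<phi> \<circ> f \<circ> inv \<psi>) \<and> teich_class A \<psi> = teich_class A \<phi>}"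

end

theory Submission
  imports Defs "HOL-Computational_Algebra.Fundamental_Theorem_Algebra"
begin

text \<open>Teichmueller space of \<open>B\<close> covers an open subset of the pairs \<open>(x, x')\<close>, where \<open>x\<close> and \<open>x'\<close> are the
  cross ratios on \<open>A\<close> of \<open>\<phi>\<close> and of its pullback \<open>\<psi>\<close>, and the deformation space lies over the diagonal.
  The value \<open>x' = 1 - x\<close> is never taken. With \<open>s\<^sup>2 = (1 - x) / x\<close> and \<open>s'\<^sup>2 = (1 - x') / x'\<close>, this removed
  curve contains the locus \<open>s s' = -1\<close>, which is disjoint from the branch \<open>s = s'\<close> of the diagonal, since
  \<open>1 + s\<^sup>2 = 1 / x\<close> has no zero. Hence \<open>log (1 + s s') + log x\<close> is locally constant on the part of the
  deformation space where \<open>s s' = (1 - x) / x\<close>. Pushing the free critical value around the removed curve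
  changes it by a multiple of \<open>2 \<pi> i\<close>, while \<open>x\<close> stays fixed and \<open>x'\<close> runs through a null-homotopic
  loop, so that one remains in the deformation space.

  Below, \<open>s s'\<close> is \<open>QQ\<close>, and the branches \<open>LL\<close> and \<open>KK\<close> of the two logarithms are fixed by lifting
  paths in the marked sphere, so that no universal cover is constructed.\<close>

section \<open>The Riemann sphere\<close>

text \<open>Let \<theta>1, \<theta>2, \<theta>3 be the coordinates of \<open>a1\<close>,
  \<open>a2\<close>, \<open>a3\<close> under the pullback, with \<open>a0\<close> at infinity and
  the other critical point at 0; their squares are coordinates of \<open>a2\<close>,
  \<open>a3\<close>, \<open>a0\<close> under \<phi>. Then (1 - x) / x is (\<theta>1^2 - \<theta>2^2)
  / (\<theta>2^2 - \<theta>3^2), (1 - x') / x' is (\<theta>3 - \<theta>2) / (\<theta>2 - \<theta>1),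
  and the product collapses to (\<theta>1 + \<theta>2) / (\<theta>2 + \<theta>3). It is 1 iff x' = 1
  - x, iff \<theta>1 = \<theta>3, which would merge two points of the cycle: hence the removed
  curve. The obstacle is that the \<theta>s belong to a pullback, while a component invariant must
  be a continuous function of \<phi> up to isotopy. So ratios of the \<theta>s are read off from
  \<phi> alone, as square roots of cross ratios continued along fixed paths. Conversely, fixing x
  confines the \<theta>s to a conic. Its rational parametrisation by x' turns a loop of x' into a
  loop of configurations symmetric under sign, and an odd homeomorphism following it descends
  through squaring, giving \<phi> and \<psi> together. The homotopy contracting the loop of x' may
  cross 1 - x, since \<psi> alone excludes only 0, 1 and infinity.\<close>

definition proj :: "complex \<Rightarrow> complex \<Rightarrow> complex option" where
  "proj a b = (if b = 0 then None else Some (a / b))"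

definition hx :: "complex option \<Rightarrow> complex" where
  "hx p = (case p of None \<Rightarrow> 1 | Some z \<Rightarrow> z)"

definition hy :: "complex option \<Rightarrow> complex" where
  "hy p = (case p of None \<Rightarrow> 0 | Some z \<Rightarrow> 1)"

lemma hx_simps [simp]: "hx None = 1" "hx (Some z) = z"
  and hy_simps [simp]: "hy None = 0" "hy (Some z) = 1"
  by (auto simp: hx_def hy_def)

lemma proj_hx_hy [simp]: "proj (hx p) (hy p) = p"
  by (cases p) (auto simp: proj_def)

lemma proj_0 [simp]: "proj a 0 = None" and proj_1 [simp]: "proj a 1 = Some a"
  by (auto simp: proj_def)

lemma hx_hy_nonzero: "hx p \<noteq> 0 \<or> hy p \<noteq> 0"
  by (cases p) auto

lemma proj_eq_iff:
  assumes "a \<noteq> 0 \<or> b \<noteq> 0" "c \<noteq> 0 \<or> d \<noteq> 0"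
  shows "proj a b = proj c d \<longleftrightarrow> a * d = b * c"
  using assms by (auto simp: proj_def field_simps)

text \<open>Both components have degree 0 in the pair, so any representative may be used, and the
  common denominator vanishes only at the excluded pair (0, 0). In this form infinity needs no
  separate treatment.\<close>

lemma sph_emb_proj:
  assumes "a \<noteq> 0 \<or> b \<noteq> 0"
  shows "sph_emb (proj a b) =
    (2 * a * cnj b / of_real ((cmod a)\<^sup>2 + (cmod b)\<^sup>2),
     ((cmod a)\<^sup>2 - (cmod b)\<^sup>2) / ((cmod a)\<^sup>2 + (cmod b)\<^sup>2))"
proof (cases "b = 0")
  case True
  then show ?thesis using assms by (simp add: sph_emb_def proj_def)
next
  case False
  have pos: "(cmod a)\<^sup>2 + (cmod b)\<^sup>2 > 0"
    using False by (simp add: add_nonneg_pos)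
  have c: "a / b = a * cnj b / of_real ((cmod b)\<^sup>2)"
    using False by (simp add: complex_norm_square del: of_real_power)
  have "of_real (2 / (1 + (cmod (a/b))\<^sup>2)) * (a / b) = 2 * a * cnj b / of_real ((cmod a)\<^sup>2 + (cmod b)\<^sup>2)"
  proof -
    have "2 / (1 + (cmod (a/b))\<^sup>2) = 2 * (cmod b)\<^sup>2 / ((cmod a)\<^sup>2 + (cmod b)\<^sup>2)"
      using False pos by (simp add: norm_divide field_simps power_divide)
    then have "of_real (2 / (1 + (cmod (a/b))\<^sup>2)) * (a / b)
       = (of_real (2 * (cmod b)\<^sup>2 / ((cmod a)\<^sup>2 + (cmod b)\<^sup>2)) :: complex) * (a * cnj b / of_real ((cmod b)\<^sup>2))"
      using c by simp
    also have "\<dots> = 2 * a * cnj b / of_real ((cmod a)\<^sup>2 + (cmod b)\<^sup>2)"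
    proof -
      have "of_real ((cmod b)\<^sup>2) \<noteq> (0::complex)" using False by simp
      then show ?thesis
        by (simp only: of_real_divide of_real_mult of_real_numeral) (simp add: field_simps)
    qed
    finally show ?thesis .
  qed
  moreover have "((cmod (a/b))\<^sup>2 - 1) / ((cmod (a/b))\<^sup>2 + 1) = ((cmod a)\<^sup>2 - (cmod b)\<^sup>2) / ((cmod a)\<^sup>2 + (cmod b)\<^sup>2)"
  proof -
    have "(cmod (a/b))\<^sup>2 = (cmod a)\<^sup>2 / (cmod b)\<^sup>2" by (simp add: norm_divide power_divide)
    moreover have "(cmod b)\<^sup>2 > 0" using False by simp
    ultimately have ab: "(cmod (a/b))\<^sup>2 * (cmod b)\<^sup>2 = (cmod a)\<^sup>2" "(cmod b)\<^sup>2 \<noteq> 0" by auto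
    have "((cmod (a/b))\<^sup>2 - 1) / ((cmod (a/b))\<^sup>2 + 1)
       = (((cmod (a/b))\<^sup>2 - 1) * (cmod b)\<^sup>2) / (((cmod (a/b))\<^sup>2 + 1) * (cmod b)\<^sup>2)"
      by (rule mult_divide_mult_cancel_right[symmetric]) (rule ab)
    then show ?thesis unfolding left_diff_distrib distrib_right ab(1) by simp
  qed
  ultimately show ?thesis
    using False by (simp add: sph_emb_def proj_def)
qed

text \<open>Stereographic projection from either pole, in homogeneous coordinates. Each pair is
  continuous in the embedded point and degenerates at one pole only, so the two together yield local
  continuous representatives.\<close>

lemma proj_sph_emb:
  fixes p
  defines "e \<equiv> sph_emb p"
  shows "p \<noteq> None \<longleftrightarrow> snd e < 1" "p \<noteq> Some 0 \<longleftrightarrow> snd e > -1"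
    "snd e < 1 \<Longrightarrow> p = proj (fst e) (of_real (1 - snd e))"
    "snd e > -1 \<Longrightarrow> p = proj (of_real (1 + snd e)) (cnj (fst e))"
proof -
  have "(p \<noteq> None \<longleftrightarrow> snd e < 1) \<and> (p \<noteq> Some 0 \<longleftrightarrow> snd e > -1) \<and>
    (snd e < 1 \<longrightarrow> p = proj (fst e) (of_real (1 - snd e))) \<and>
    (snd e > -1 \<longrightarrow> p = proj (of_real (1 + snd e)) (cnj (fst e)))"
  proof (cases p)
    case None
    then show ?thesis by (simp add: e_def sph_emb_def)
  next
    case (Some z)
    define r where "r = (cmod z)\<^sup>2"
    have r: "r \<ge> 0" "1 + r > 0" by (auto simp: r_def intro: add_pos_nonneg)
    have zz: "z * cnj z = of_real r" by (simp add: r_def complex_norm_square del: of_real_power)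
    have e1: "fst e = of_real (2 / (1 + r)) * z" and e2: "snd e = (r - 1) / (r + 1)"
      by (simp_all add: e_def Some sph_emb_def r_def)
    have f1: "1 - snd e = 2 / (1 + r)" and f2: "1 + snd e = 2 * r / (1 + r)"
      using r by (simp_all add: e2 field_simps)
    have r0: "r = 0 \<longleftrightarrow> z = 0" by (simp add: r_def)
    have a: "snd e < 1" using f1 r by (smt (verit) divide_pos_pos)
    have b: "p \<noteq> Some 0 \<longleftrightarrow> snd e > -1"
    proof -
      have "snd e > -1 \<longleftrightarrow> 2 * r / (1 + r) > 0" using f2 by linarith
      also have "\<dots> \<longleftrightarrow> r > 0" using r by (simp add: zero_less_divide_iff)
      finally show ?thesis using r0 r Some by auto
    qed
    have c: "p = proj (fst e) (of_real (1 - snd e))"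
    proof -
      have "of_real (2 / (1 + r)) \<noteq> (0::complex)" using r by (simp add: of_real_eq_0_iff del: of_real_divide)
      then show ?thesis unfolding f1 e1 Some by (simp add: proj_def del: of_real_divide)
    qed
    have d: "p = proj (of_real (1 + snd e)) (cnj (fst e))" if "snd e > -1"
    proof -
      have z: "z \<noteq> 0" using that b Some by auto
      have nz: "of_real (2 / (1 + r)) \<noteq> (0::complex)" using r by (simp add: of_real_eq_0_iff del: of_real_divide)
      have "of_real (1 + snd e) = of_real (2 / (1+r)) * (z * cnj z)"
        unfolding f2 zz by simp
      moreover have "cnj (fst e) = of_real (2/(1+r)) * cnj z" unfolding e1 by simp
      ultimately show ?thesis using z nz Some by (simp add: proj_def del: of_real_divide)
    qed
    have "p \<noteq> None" using Some by simp
    then show ?thesis using a b c d by blast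
  qed
  then show "p \<noteq> None \<longleftrightarrow> snd e < 1" "p \<noteq> Some 0 \<longleftrightarrow> snd e > -1"
    "snd e < 1 \<Longrightarrow> p = proj (fst e) (of_real (1 - snd e))"
    "snd e > -1 \<Longrightarrow> p = proj (of_real (1 + snd e)) (cnj (fst e))" by blast+
qed

lemma inj_sph_emb: "inj sph_emb"
proof (rule injI)
  fix p q assume "sph_emb p = sph_emb q"
  then show "p = q"
    using proj_sph_emb[of p] proj_sph_emb[of q] by (metis option.distinct(1))
qed

lemma Metric_space_chordal: "Metric_space UNIV chordal"
  by unfold_locales
    (auto simp: chordal_def dist_commute dist_triangle inj_eq[OF inj_sph_emb])

interpretation chordal: Metric_space UNIV chordal
  rewrites "chordal.mtopology = P1"
  using Metric_space_chordal by (auto simp: P1_def)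

lemma topspace_P1 [simp]: "topspace P1 = UNIV"
  using chordal.topspace_mtopology by simp

lemma continuous_map_P1_iff:
  "continuous_map Y P1 u \<longleftrightarrow> continuous_map Y euclidean (\<lambda>y. sph_emb (u y))"
proof -
  have "continuous_map Y P1 u \<longleftrightarrow>
     (\<forall>x \<in> topspace Y. \<forall>\<epsilon>>0. \<exists>U. openin Y U \<and> x \<in> U \<and> (\<forall>y\<in>U. u y \<in> chordal.mball (u x) \<epsilon>))"
    using chordal.continuous_map_to_metric[of Y u] by simp
  also have "\<dots> \<longleftrightarrow> (\<forall>x \<in> topspace Y. \<forall>\<epsilon>>0. \<exists>U. openin Y U \<and> x \<in> U \<and> 
      (\<forall>y\<in>U. sph_emb (u y) \<in> Met_TC.mball (sph_emb (u x)) \<epsilon>))"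
    by (simp add: chordal_def)
  also have "\<dots> \<longleftrightarrow> continuous_map Y euclidean (\<lambda>y. sph_emb (u y))"
    using Met_TC.continuous_map_to_metric[of Y "\<lambda>y. sph_emb (u y)"] by simp
  finally show ?thesis .
qed

lemma continuous_map_proj:
  assumes "continuous_map Y euclidean a" "continuous_map Y euclidean b"
    and "\<And>y. y \<in> topspace Y \<Longrightarrow> a y \<noteq> 0 \<or> b y \<noteq> 0"
  shows "continuous_map Y P1 (\<lambda>y. proj (a y) (b y))"
proof -
  have nz: "(cmod (a y))\<^sup>2 + (cmod (b y))\<^sup>2 \<noteq> 0" if "y \<in> topspace Y" for y
    using assms(3)[OF that] by (simp add: sum_power2_eq_zero_iff)
  let ?S = "{p::complex \<times> complex. p \<noteq> 0}"
  have ab: "continuous_map Y (top_of_set ?S) (\<lambda>y. (a y, b y))"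
  proof -
    have "continuous_map Y euclidean (\<lambda>y. (a y, b y))"
      using assms(1,2) by (auto simp: continuous_map_atin intro!: tendsto_intros)
    then show ?thesis using assms(3) by (auto simp: continuous_map_in_subtopology zero_prod_def)
  qed
  have c: "continuous_on ?S (\<lambda>p. (2 * fst p * cnj (snd p) / of_real ((cmod (fst p))\<^sup>2 + (cmod (snd p))\<^sup>2),
     ((cmod (fst p))\<^sup>2 - (cmod (snd p))\<^sup>2) / ((cmod (fst p))\<^sup>2 + (cmod (snd p))\<^sup>2)))"
    by (intro continuous_intros) (auto simp: prod_eq_iff sum_power2_eq_zero_iff simp del: of_real_add of_real_power)
  have "continuous_map Y euclidean ((\<lambda>p. (2 * fst p * cnj (snd p) / of_real ((cmod (fst p))\<^sup>2 + (cmod (snd p))\<^sup>2),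
     ((cmod (fst p))\<^sup>2 - (cmod (snd p))\<^sup>2) / ((cmod (fst p))\<^sup>2 + (cmod (snd p))\<^sup>2))) \<circ> (\<lambda>y. (a y, b y)))"
    by (rule continuous_map_compose[OF ab]) (use c in simp)
  then show ?thesis
    unfolding continuous_map_P1_iff
    by (rule continuous_map_eq) (use assms(3) in \<open>auto simp: sph_emb_proj\<close>)
qed

text \<open>A continuous representative in C^2 minus 0 exists only locally, because the projection
  to the sphere has no global section. Continuity of cross ratios and of Moebius maps is checked
  through these representatives.\<close>

lemma continuous_map_P1_local_rep:
  assumes u: "continuous_map Y P1 u" and y0: "y0 \<in> topspace Y"
  obtains U a b where "openin Y U" "y0 \<in> U" "continuous_map (subtopology Y U) euclidean a"
    "continuous_map (subtopology Y U) euclidean b"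
    "\<And>y. y \<in> U \<Longrightarrow> a y \<noteq> 0 \<or> b y \<noteq> (0::complex)" "\<And>y. y \<in> U \<Longrightarrow> u y = proj (a y) (b y)"
proof -
  define e where "e y = sph_emb (u y)" for y
  have e: "continuous_map Y euclidean e" using u by (simp add: continuous_map_P1_iff e_def[abs_def])
  have e1: "continuous_map Y euclidean (\<lambda>y. fst (e y))" and e2: "continuous_map Y euclidean (\<lambda>y. snd (e y))"
    using continuous_map_compose[OF e, of euclidean fst] continuous_map_compose[OF e, of euclidean snd]
    by (auto simp: o_def continuous_on_fst continuous_on_snd continuous_on_id)
  have e2r: "continuous_map Y euclidean (\<lambda>y. complex_of_real (g (snd (e y))))" if "continuous_on UNIV g" for g
    using continuous_map_compose[OF e2, of euclidean "\<lambda>t. complex_of_real (g t)"] that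
    by (auto simp: o_def intro!: continuous_intros)
  have e1c: "continuous_map Y euclidean (\<lambda>y. cnj (fst (e y)))"
    using continuous_map_compose[OF e1, of euclidean cnj] by (auto simp: o_def intro!: continuous_intros)
  show ?thesis
  proof (cases "u y0 = None")
    case False
    define U where "U = {y \<in> topspace Y. snd (e y) \<in> {..<1}}"
    show ?thesis
    proof (rule that[of U "\<lambda>y. fst (e y)" "\<lambda>y. of_real (1 - snd (e y))"])
      show "openin Y U" unfolding U_def by (rule openin_continuous_map_preimage[OF e2]) simp
      show "y0 \<in> U" using False y0 proj_sph_emb(1)[of "u y0"] by (auto simp: U_def e_def)
      show "continuous_map (subtopology Y U) euclidean (\<lambda>y. fst (e y))"
        by (rule continuous_map_from_subtopology[OF e1])
      show "continuous_map (subtopology Y U) euclidean (\<lambda>y. complex_of_real (1 - snd (e y)))"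
        by (rule continuous_map_from_subtopology[OF e2r]) (intro continuous_intros)
      fix y assume "y \<in> U"
      then have y: "snd (e y) < 1" by (simp add: U_def)
      then show "fst (e y) \<noteq> 0 \<or> complex_of_real (1 - snd (e y)) \<noteq> 0"
        by (metis diff_gt_0_iff_gt less_numeral_extra(3) of_real_eq_0_iff)
      show "u y = proj (fst (e y)) (complex_of_real (1 - snd (e y)))"
        using proj_sph_emb(3)[of "u y"] y by (simp add: e_def)
    qed
  next
    case True
    define U where "U = {y \<in> topspace Y. snd (e y) \<in> {-1<..}}"
    show ?thesis
    proof (rule that[of U "\<lambda>y. of_real (1 + snd (e y))" "\<lambda>y. cnj (fst (e y))"])
      show "openin Y U" unfolding U_def by (rule openin_continuous_map_preimage[OF e2]) simp
      show "y0 \<in> U" using True y0 proj_sph_emb(2)[of "u y0"] by (auto simp: U_def e_def)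
      show "continuous_map (subtopology Y U) euclidean (\<lambda>y. cnj (fst (e y)))"
        by (rule continuous_map_from_subtopology[OF e1c])
      show "continuous_map (subtopology Y U) euclidean (\<lambda>y. complex_of_real (1 + snd (e y)))"
        by (rule continuous_map_from_subtopology[OF e2r]) (intro continuous_intros)
      fix y assume "y \<in> U"
      then have y: "snd (e y) > -1" by (simp add: U_def)
      then have "1 + snd (e y) \<noteq> 0" by linarith
      then show "complex_of_real (1 + snd (e y)) \<noteq> 0 \<or> cnj (fst (e y)) \<noteq> 0"
        using of_real_eq_0_iff by blast
      show "u y = proj (complex_of_real (1 + snd (e y))) (cnj (fst (e y)))"
        using proj_sph_emb(4)[of "u y"] y by (simp add: e_def)
    qed
  qed
qed

lemma compact_space_P1: "compact_space P1"
proof -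
  let ?S = "sphere (0::complex \<times> complex) 1"
  have c: "continuous_map (top_of_set ?S) P1 (\<lambda>p. proj (fst p) (snd p))"
    by (rule continuous_map_proj) (auto intro!: continuous_intros simp: prod_eq_iff)
  have "compactin P1 ((\<lambda>p. proj (fst p) (snd p)) ` ?S)"
    by (rule image_compactin[OF _ c]) (simp add: compactin_subtopology)
  moreover have "(\<lambda>p. proj (fst p) (snd p)) ` ?S = UNIV"
  proof -
    have "p \<in> (\<lambda>p. proj (fst p) (snd p)) ` ?S" for p
    proof -
      define v where "v = (hx p, hy p)"
      have v: "v \<noteq> 0" using hx_hy_nonzero[of p] by (auto simp: v_def zero_prod_def)
      let ?w = "v /\<^sub>R norm v"
      have "?w \<in> ?S" using v by simp
      moreover have "proj (fst ?w) (snd ?w) = p"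
      proof -
        have "norm v \<noteq> 0" using v by simp
        then show ?thesis by (cases p) (auto simp: v_def proj_def scaleR_conv_of_real)
      qed
      ultimately show ?thesis by blast
    qed
    then show ?thesis by blast
  qed
  ultimately show ?thesis by (simp add: compact_space_def)
qed

lemma Hausdorff_space_P1: "Hausdorff_space P1"
  using chordal.Hausdorff_space_mtopology by simp

lemma homeomorphic_map_P1_iff:
  "homeomorphic_map P1 P1 h \<longleftrightarrow> continuous_map P1 P1 h \<and> bij h"
proof
  assume "homeomorphic_map P1 P1 h"
  then show "continuous_map P1 P1 h \<and> bij h"
    by (auto simp: homeomorphic_eq_everything_map bij_def)
next
  assume "continuous_map P1 P1 h \<and> bij h"
  then show "homeomorphic_map P1 P1 h"
    by (intro continuous_imp_homeomorphic_map)
      (auto simp: compact_space_P1 Hausdorff_space_P1 bij_def)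
qed

lemma continuous_map_locally:
  assumes "\<And>x. x \<in> topspace X \<Longrightarrow> \<exists>U. openin X U \<and> x \<in> U \<and> continuous_map (subtopology X U) Y g"
  shows "continuous_map X Y g"
proof -
  obtain U where U: "\<And>x. x \<in> topspace X \<Longrightarrow> openin X (U x) \<and> x \<in> U x \<and> continuous_map (subtopology X (U x)) Y g"
    using assms by metis
  show ?thesis
    by (rule pasting_lemma[of "topspace X" X U Y "\<lambda>_. g"]) (use U in auto)
qed

subsection \<open>Cross ratios\<close>

text \<open>The 2x2 determinant of the homogeneous coordinates of the two points; cross ratios are
  quotients of such brackets.\<close>

definition br :: "complex option \<Rightarrow> complex option \<Rightarrow> complex" where
  "br p q = hx p * hy q - hx q * hy p"

lemma br_eq_0_iff: "br p q = 0 \<longleftrightarrow> p = q"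
  by (cases p; cases q) (auto simp: br_def)

text \<open>The value at \<open>p\<close> of the Moebius coordinate sending \<open>u\<close> to 0, \<open>q\<close> to 1 and \<open>a\<close> to infinity.\<close>
definition CR :: "complex option \<Rightarrow> complex option \<Rightarrow> complex option \<Rightarrow> complex option \<Rightarrow> complex" where
  "CR p q u a = br p u * br q a / (br q u * br p a)"

lemma proj_scale:
  assumes "a \<noteq> 0 \<or> b \<noteq> 0"
  obtains k where "k \<noteq> 0" "a = k * hx (proj a b)" "b = k * hy (proj a b)"
proof (cases "b = 0")
  case True
  then show ?thesis using assms that[of a] by simp
next
  case False
  then show ?thesis using that[of b] by (simp add: proj_def)
qed

text \<open>Each pair enters numerator and denominator to the same degree, so the scaling factors of
  the representatives cancel.\<close>

lemma CR_proj:
  assumes "a1 \<noteq> 0 \<or> b1 \<noteq> 0" "a2 \<noteq> 0 \<or> b2 \<noteq> 0" "a3 \<noteq> 0 \<or> b3 \<noteq> 0" "a4 \<noteq> 0 \<or> b4 \<noteq> 0"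
  shows "CR (proj a1 b1) (proj a2 b2) (proj a3 b3) (proj a4 b4)
    = (a1 * b3 - a3 * b1) * (a2 * b4 - a4 * b2) / ((a2 * b3 - a3 * b2) * (a1 * b4 - a4 * b1))"
proof -
  obtain k1 where k1: "k1 \<noteq> 0" "a1 = k1 * hx (proj a1 b1)" "b1 = k1 * hy (proj a1 b1)"
    using proj_scale[OF assms(1)] by blast
  obtain k2 where k2: "k2 \<noteq> 0" "a2 = k2 * hx (proj a2 b2)" "b2 = k2 * hy (proj a2 b2)"
    using proj_scale[OF assms(2)] by blast
  obtain k3 where k3: "k3 \<noteq> 0" "a3 = k3 * hx (proj a3 b3)" "b3 = k3 * hy (proj a3 b3)"
    using proj_scale[OF assms(3)] by blast
  obtain k4 where k4: "k4 \<noteq> 0" "a4 = k4 * hx (proj a4 b4)" "b4 = k4 * hy (proj a4 b4)"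
    using proj_scale[OF assms(4)] by blast
  have e13: "a1 * b3 - a3 * b1 = k1 * k3 * br (proj a1 b1) (proj a3 b3)"
    unfolding br_def using k1(2,3) k3(2,3) by (metis (no_types, lifting) mult.assoc mult.commute right_diff_distrib)
  have e24: "a2 * b4 - a4 * b2 = k2 * k4 * br (proj a2 b2) (proj a4 b4)"
    unfolding br_def using k2(2,3) k4(2,3) by (metis (no_types, lifting) mult.assoc mult.commute right_diff_distrib)
  have e23: "a2 * b3 - a3 * b2 = k2 * k3 * br (proj a2 b2) (proj a3 b3)"
    unfolding br_def using k2(2,3) k3(2,3) by (metis (no_types, lifting) mult.assoc mult.commute right_diff_distrib)
  have e14: "a1 * b4 - a4 * b1 = k1 * k4 * br (proj a1 b1) (proj a4 b4)"
    unfolding br_def using k1(2,3) k4(2,3) by (metis (no_types, lifting) mult.assoc mult.commute right_diff_distrib)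
  have "k1 * k3 * B13 * (k2 * k4 * B24) / (k2 * k3 * B23 * (k1 * k4 * B14)) = B13 * B24 / (B23 * B14)" for B13 B24 B23 B14
  proof -
    have "k1 * k3 * B13 * (k2 * k4 * B24) / (k2 * k3 * B23 * (k1 * k4 * B14)) =
      ((k1 * k2 * k3 * k4) * (B13 * B24)) / ((k1 * k2 * k3 * k4) * (B23 * B14))"
      by (simp add: mult_ac)
    also have "\<dots> = B13 * B24 / (B23 * B14)" 
      by (rule mult_divide_mult_cancel_left) (use k1 k2 k3 k4 in simp)
    finally show ?thesis .
  qed
  then show ?thesis unfolding CR_def e13 e24 e23 e14 by simp
qed

lemma continuous_map_CR:
  assumes "continuous_map Y P1 u1" "continuous_map Y P1 u2" "continuous_map Y P1 u3" "continuous_map Y P1 u4"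
    and ne: "\<And>y. y \<in> topspace Y \<Longrightarrow> u2 y \<noteq> u3 y" "\<And>y. y \<in> topspace Y \<Longrightarrow> u1 y \<noteq> u4 y"
  shows "continuous_map Y euclidean (\<lambda>y. CR (u1 y) (u2 y) (u3 y) (u4 y))"
proof -
  have "\<exists>U. openin Y U \<and> y0 \<in> U \<and> continuous_map (subtopology Y U) euclidean (\<lambda>y. CR (u1 y) (u2 y) (u3 y) (u4 y))"
    if y0: "y0 \<in> topspace Y" for y0
  proof -
    obtain U1 a1 b1 where 1: "openin Y U1" "y0 \<in> U1" "continuous_map (subtopology Y U1) euclidean a1"
      "continuous_map (subtopology Y U1) euclidean b1"
      "\<And>y. y \<in> U1 \<Longrightarrow> a1 y \<noteq> 0 \<or> b1 y \<noteq> (0::complex)" "\<And>y. y \<in> U1 \<Longrightarrow> u1 y = proj (a1 y) (b1 y)"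
      using continuous_map_P1_local_rep[OF assms(1) y0] by blast
    obtain U2 a2 b2 where 2: "openin Y U2" "y0 \<in> U2" "continuous_map (subtopology Y U2) euclidean a2"
      "continuous_map (subtopology Y U2) euclidean b2"
      "\<And>y. y \<in> U2 \<Longrightarrow> a2 y \<noteq> 0 \<or> b2 y \<noteq> (0::complex)" "\<And>y. y \<in> U2 \<Longrightarrow> u2 y = proj (a2 y) (b2 y)"
      using continuous_map_P1_local_rep[OF assms(2) y0] by blast
    obtain U3 a3 b3 where 3: "openin Y U3" "y0 \<in> U3" "continuous_map (subtopology Y U3) euclidean a3"
      "continuous_map (subtopology Y U3) euclidean b3"
      "\<And>y. y \<in> U3 \<Longrightarrow> a3 y \<noteq> 0 \<or> b3 y \<noteq> (0::complex)" "\<And>y. y \<in> U3 \<Longrightarrow> u3 y = proj (a3 y) (b3 y)"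
      using continuous_map_P1_local_rep[OF assms(3) y0] by blast
    obtain U4 a4 b4 where 4: "openin Y U4" "y0 \<in> U4" "continuous_map (subtopology Y U4) euclidean a4"
      "continuous_map (subtopology Y U4) euclidean b4"
      "\<And>y. y \<in> U4 \<Longrightarrow> a4 y \<noteq> 0 \<or> b4 y \<noteq> (0::complex)" "\<And>y. y \<in> U4 \<Longrightarrow> u4 y = proj (a4 y) (b4 y)"
      using continuous_map_P1_local_rep[OF assms(4) y0] by blast
    define U where "U = U1 \<inter> U2 \<inter> U3 \<inter> U4"
    have oU: "openin Y U" and yU: "y0 \<in> U" using 1 2 3 4 by (auto simp: U_def)
    have sub: "continuous_map (subtopology Y U) euclidean g" if "continuous_map (subtopology Y V) euclidean g" "U \<subseteq> V"
      for g :: "'a \<Rightarrow> complex" and V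
      by (metis continuous_map_from_subtopology inf.absorb_iff2 subtopology_subtopology that)
    have c: "continuous_map (subtopology Y U) euclidean a1" "continuous_map (subtopology Y U) euclidean b1"
      "continuous_map (subtopology Y U) euclidean a2" "continuous_map (subtopology Y U) euclidean b2"
      "continuous_map (subtopology Y U) euclidean a3" "continuous_map (subtopology Y U) euclidean b3"
      "continuous_map (subtopology Y U) euclidean a4" "continuous_map (subtopology Y U) euclidean b4"
      by (rule sub[OF 1(3)] sub[OF 1(4)] sub[OF 2(3)] sub[OF 2(4)] sub[OF 3(3)] sub[OF 3(4)] sub[OF 4(3)] sub[OF 4(4)],
          (auto simp: U_def)[1])+
    have m: "continuous_map (subtopology Y U) euclidean (\<lambda>y. f y * g y - h y * k y)"
      if "continuous_map (subtopology Y U) euclidean f" "continuous_map (subtopology Y U) euclidean g"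
        "continuous_map (subtopology Y U) euclidean h" "continuous_map (subtopology Y U) euclidean k"
      for f g h k :: "'a \<Rightarrow> complex"
      using that by (auto simp: continuous_map_atin intro!: tendsto_intros)
    have cr: "CR (u1 y) (u2 y) (u3 y) (u4 y) = (a1 y * b3 y - a3 y * b1 y) * (a2 y * b4 y - a4 y * b2 y) / 
        ((a2 y * b3 y - a3 y * b2 y) * (a1 y * b4 y - a4 y * b1 y))" if "y \<in> U" for y
      using that 1(5,6) 2(5,6) 3(5,6) 4(5,6) by (simp add: U_def CR_proj)
    have nz: "(a2 y * b3 y - a3 y * b2 y) * (a1 y * b4 y - a4 y * b1 y) \<noteq> 0" if "y \<in> U" for y
    proof -
      have "y \<in> topspace Y" using that oU openin_subset by blast
      then have "proj (a2 y) (b2 y) \<noteq> proj (a3 y) (b3 y)" "proj (a1 y) (b1 y) \<noteq> proj (a4 y) (b4 y)"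
        using ne[of y] that 1(6) 2(6) 3(6) 4(6) by (auto simp: U_def)
      then have "a2 y * b3 y \<noteq> b2 y * a3 y" "a1 y * b4 y \<noteq> b1 y * a4 y"
        using that 1(5) 2(5) 3(5) 4(5) by (auto simp: U_def proj_eq_iff)
      then show ?thesis by (simp add: mult.commute)
    qed
    have d: "continuous_map (subtopology Y U) euclidean (\<lambda>y. f1 y * f2 y / (f3 y * f4 y))"
      if "continuous_map (subtopology Y U) euclidean f1" "continuous_map (subtopology Y U) euclidean f2"
        "continuous_map (subtopology Y U) euclidean f3" "continuous_map (subtopology Y U) euclidean f4"
        "\<And>y. y \<in> U \<Longrightarrow> f3 y * f4 y \<noteq> 0"
      for f1 f2 f3 f4 :: "'a \<Rightarrow> complex"
      using that by (auto simp: continuous_map_atin intro!: tendsto_intros)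
    have "continuous_map (subtopology Y U) euclidean (\<lambda>y. CR (u1 y) (u2 y) (u3 y) (u4 y))"
      by (rule continuous_map_eq[OF d[OF m[OF c(1) c(6) c(5) c(2)] m[OF c(3) c(8) c(7) c(4)] m[OF c(3) c(6) c(5) c(4)]
        m[OF c(1) c(8) c(7) c(2)] nz]]) (auto simp: cr)
    then show ?thesis using oU yU by blast
  qed
  then show ?thesis by (rule continuous_map_locally)
qed

section \<open>Continuous logarithms of paths\<close>

lemma continuous_map_complex_algebra:
  fixes f g :: "'a \<Rightarrow> complex"
  assumes "continuous_map X euclidean f" "continuous_map X euclidean g"
  shows "continuous_map X euclidean (\<lambda>x. f x + g x)" "continuous_map X euclidean (\<lambda>x. f x - g x)"
    "continuous_map X euclidean (\<lambda>x. f x * g x)"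
    "(\<And>x. x \<in> topspace X \<Longrightarrow> g x \<noteq> 0) \<Longrightarrow> continuous_map X euclidean (\<lambda>x. f x / g x)"
  using assms unfolding continuous_map_atin limitin_canonical_iff
  by (blast intro: tendsto_add tendsto_diff tendsto_mult tendsto_divide)+

lemma continuous_map_exp:
  fixes f :: "'a \<Rightarrow> complex"
  assumes "continuous_map X euclidean f"
  shows "continuous_map X euclidean (\<lambda>x. exp (f x))"
  using assms unfolding continuous_map_atin limitin_canonical_iff by (blast intro: tendsto_exp)

text \<open>Two values of \<open>d\<close> on \<open>S\<close> differ by a multiple of 2 \<pi> i, so
  the range is discrete with gaps at least 2 \<pi>.\<close>

lemma constant_if_exp_constant:
  fixes d :: "'a::topological_space \<Rightarrow> complex"
  assumes S: "connected S" and d: "continuous_on S d" and e: "\<And>x. x \<in> S \<Longrightarrow> exp (d x) = c"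
    and "x \<in> S" "y \<in> S"
  shows "d x = d y"
proof -
  have "d constant_on S"
  proof (rule continuous_discrete_range_constant[OF S d])
    fix x assume x: "x \<in> S"
    show "\<exists>e>0. \<forall>y. y \<in> S \<and> d y \<noteq> d x \<longrightarrow> e \<le> norm (d y - d x)"
    proof (intro exI[of _ "2 * pi"] conjI allI impI)
      fix y assume y: "y \<in> S \<and> d y \<noteq> d x"
      then have "exp (d y) = exp (d x)" using e x by simp
      then obtain n :: int where n: "d y = d x + of_int (2 * n) * pi * \<i>" using exp_eq by blast
      then have "n \<noteq> 0" using y by auto
      then have "\<bar>real_of_int n\<bar> \<ge> 1" by linarith
      then show "2 * pi \<le> norm (d y - d x)"
        using n by (simp add: norm_mult)
    qed simp
  qed
  then show ?thesis using assms unfolding constant_on_def by metis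
qed

text \<open>The quotient of the two roots is continuous with values 1 and -1, hence
  constant.\<close>

lemma continuous_sqrt_unique:
  fixes u w :: "'a::topological_space \<Rightarrow> complex"
  assumes S: "connected S" and u: "continuous_on S u" and w: "continuous_on S w"
    and e: "\<And>x. x \<in> S \<Longrightarrow> (u x)\<^sup>2 = (w x)\<^sup>2" and nz: "\<And>x. x \<in> S \<Longrightarrow> w x \<noteq> 0"
    and "x0 \<in> S" "u x0 = w x0" "x \<in> S"
  shows "u x = w x"
proof -
  let ?d = "\<lambda>x. u x / w x"
  have "?d constant_on S"
  proof (rule continuous_discrete_range_constant[OF S])
    show "continuous_on S ?d" using u w nz by (intro continuous_intros) auto
    fix x assume x: "x \<in> S"
    have pm: "?d y = 1 \<or> ?d y = -1" if "y \<in> S" for y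
      using e[OF that] nz[OF that] by (simp add: power2_eq_iff) (metis divide_self divide_minus_left)
    show "\<exists>e>0. \<forall>y. y \<in> S \<and> ?d y \<noteq> ?d x \<longrightarrow> e \<le> norm (?d y - ?d x)"
    proof (intro exI[of _ 1] conjI allI impI)
      fix y assume y: "y \<in> S \<and> ?d y \<noteq> ?d x"
      show "1 \<le> norm (?d y - ?d x)" using pm[of x] pm[of y] x y by auto
    qed simp
  qed
  then have "?d x = ?d x0" using assms unfolding constant_on_def by metis
  then show ?thesis using assms by (simp add: field_simps)
qed

text \<open>The value 0 at time 0 singles out one branch when \<open>g 0 = 1\<close>. By
  \<open>lg_unique\<close> the choice can then be computed from any explicit continuous
  logarithm.\<close>

definition lg :: "(real \<Rightarrow> complex) \<Rightarrow> real \<Rightarrow> complex" where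
  "lg g = (SOME l. continuous_on {0..1} l \<and> l 0 = 0 \<and> (\<forall>t\<in>{0..1}. exp (l t) = g t))"

lemma
  assumes "continuous_on {0..1} g" "\<And>t. t \<in> {0..1} \<Longrightarrow> g t \<noteq> 0" "g 0 = 1"
  shows continuous_on_lg: "continuous_on {0..1} (lg g)"
    and lg_0: "lg g 0 = 0"
    and exp_lg: "t \<in> {0..1} \<Longrightarrow> exp (lg g t) = g t"
proof -
  have "contractible {0..1::real}" by (simp add: convex_imp_contractible)
  then obtain h where h: "continuous_on {0..1} h" "\<And>t. t \<in> {0..1} \<Longrightarrow> g t = exp (h t)"
    using continuous_logarithm_on_contractible assms(1,2) by blast
  let ?l = "\<lambda>t. h t - h 0"
  have "exp (h 0) = 1" using h(2)[of 0] assms(3) by simp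
  then have "continuous_on {0..1} ?l \<and> ?l 0 = 0 \<and> (\<forall>t\<in>{0..1}. exp (?l t) = g t)"
    using h by (auto simp: exp_diff intro!: continuous_intros)
  then have "\<exists>l. continuous_on {0..1} l \<and> l 0 = 0 \<and> (\<forall>t\<in>{0..1}. exp (l t) = g t)"
    by blast
  then have "continuous_on {0..1} (lg g) \<and> lg g 0 = 0 \<and> (\<forall>t\<in>{0..1}. exp (lg g t) = g t)"
    unfolding lg_def by (rule someI_ex)
  then show "continuous_on {0..1} (lg g)" "lg g 0 = 0" "t \<in> {0..1} \<Longrightarrow> exp (lg g t) = g t" by auto
qed

lemma lg_unique:
  assumes l: "continuous_on {0..1} l" "l 0 = 0" "\<And>t. t \<in> {0..1} \<Longrightarrow> exp (l t) = g t"
    and "t \<in> {0..1}"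
  shows "lg g t = l t"
proof -
  have "continuous_on {0..1} (\<lambda>t. exp (l t))" using l by (intro continuous_intros)
  then have g: "continuous_on {0..1} g" using l(3) by (rule continuous_on_eq)
  have g1: "g t \<noteq> 0" if "t \<in> {0..1}" for t using l(3)[OF that] exp_not_eq_zero[of "l t"] by metis
  have g0: "g 0 = 1" using l(2) l(3)[of 0] by simp
  note lg = continuous_on_lg[OF g g1 g0] lg_0[OF g g1 g0] exp_lg[OF g g1 g0]
  have "lg g t - l t = lg g 0 - l 0"
    by (rule constant_if_exp_constant[of "{0..1}" "\<lambda>t. lg g t - l t" 1])
      (use lg l \<open>t \<in> {0..1}\<close> g1 in \<open>auto simp: exp_diff intro!: continuous_intros\<close>)
  then show ?thesis using lg(2) l(2) by simp
qed

abbreviation I01 :: "real topology" where "I01 \<equiv> top_of_set {0..1}"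

lemma continuous_map_of_pairs:
  assumes "continuous_map (prod_topology X Y) Z (\<lambda>(x, y). g x y)"
    and "continuous_map W X a" "continuous_map W Y b"
  shows "continuous_map W Z (\<lambda>w. g (a w) (b w))"
proof -
  have "continuous_map W (prod_topology X Y) (\<lambda>w. (a w, b w))"
    using assms(2,3) by (rule continuous_map_pairedI)
  from continuous_map_compose[OF this assms(1)] show ?thesis by (simp add: o_def)
qed

text \<open>Near a fixed \<open>x0\<close> the quotient of \<open>g x\<close> by \<open>g x0\<close>
  is close to 1 on the whole interval, by the tube lemma. The principal logarithm of this quotient
  corrects \<open>lg (g x0)\<close> to a logarithm of \<open>g x\<close>, which uniqueness
  identifies with \<open>lg (g x)\<close>.\<close>

lemma continuous_map_lg:
  assumes g: "continuous_map (prod_topology X I01) euclidean (\<lambda>(x, t). g x t)"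
    and nz: "\<And>x t. x \<in> topspace X \<Longrightarrow> t \<in> {0..1} \<Longrightarrow> g x t \<noteq> 0"
    and g0: "\<And>x. x \<in> topspace X \<Longrightarrow> g x 0 = 1"
  shows "continuous_map (prod_topology X I01) euclidean (\<lambda>(x, t). lg (g x) t)"
proof (rule continuous_map_locally)
  fix p assume p: "p \<in> topspace (prod_topology X I01)"
  then obtain x0 t0 where p_eq: "p = (x0, t0)" and x0: "x0 \<in> topspace X" and t0: "t0 \<in> {0..1}" by auto
  let ?P = "prod_topology X I01"
  have gx: "continuous_on {0..1} (g x)" if "x \<in> topspace X" for x
    using continuous_map_of_pairs[OF g, of I01 "\<lambda>_. x" "\<lambda>t. t"] that by simp
  have r: "continuous_map ?P euclidean (\<lambda>w. g (fst w) (snd w) / g x0 (snd w))"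
  proof -
    have 1: "continuous_map ?P euclidean (\<lambda>w. g (fst w) (snd w))"
      using g by (simp add: case_prod_unfold)
    have 2: "continuous_map ?P euclidean (\<lambda>w. g x0 (snd w))"
      by (rule continuous_map_of_pairs[OF g]) (auto simp: x0 continuous_map_snd)
    show ?thesis by (rule continuous_map_complex_algebra[OF 1 2]) (use nz x0 in auto)
  qed
  define W where "W = {w \<in> topspace ?P. g (fst w) (snd w) / g x0 (snd w) \<in> ball 1 1}"
  have W: "openin ?P W" unfolding W_def by (rule openin_continuous_map_preimage[OF r]) simp
  have "{x0} \<times> {0..1} \<subseteq> W" using nz x0 by (auto simp: W_def)
  moreover have "compactin I01 {0..1}" by (simp add: compactin_subtopology)
  ultimately have "\<exists>U V. openin X U \<and> openin I01 V \<and> x0 \<in> U \<and> {0..1} \<subseteq> V \<and> U \<times> V \<subseteq> W"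
    by (intro tube_lemma_right[OF W _ x0])
  then obtain U V where UV: "openin X U" "openin I01 V" "x0 \<in> U" "{0..1} \<subseteq> V" "U \<times> V \<subseteq> W"
    by metis
  have UX: "U \<subseteq> topspace X" using UV openin_subset by blast
  let ?h = "\<lambda>w. lg (g x0) (snd w) + Ln (g (fst w) (snd w) / g x0 (snd w))"
  have slit: "g x t / g x0 t \<notin> \<real>\<^sub>\<le>\<^sub>0" if "x \<in> U" "t \<in> {0..1}" for x t
  proof -
    have "g x t / g x0 t \<in> ball 1 1" using that UV(4,5) by (force simp: W_def)
    then have "Re (g x t / g x0 t) > 0"
      using complex_Re_le_cmod[of "1 - g x t / g x0 t"] by (simp add: dist_norm)
    then show ?thesis by (auto simp: complex_nonpos_Reals_iff)
  qed
  have eq: "lg (g x) t = lg (g x0) t + Ln (g x t / g x0 t)" if "x \<in> U" "t \<in> {0..1}" for x t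
  proof (rule lg_unique[OF _ _ _ that(2)])
    have x: "x \<in> topspace X" using that UX by auto
    note lg = continuous_on_lg[OF gx[OF x0] nz[OF x0] g0[OF x0]] lg_0[OF gx[OF x0] nz[OF x0] g0[OF x0]]
      exp_lg[OF gx[OF x0] nz[OF x0] g0[OF x0]]
    show "continuous_on {0..1} (\<lambda>t. lg (g x0) t + Ln (g x t / g x0 t))"
      by (intro continuous_intros lg(1) gx x x0) (use nz x0 slit that in auto)
    show "lg (g x0) 0 + Ln (g x 0 / g x0 0) = 0" using lg(2) g0[OF x] g0[OF x0] by simp
    fix t assume t: "t \<in> {0..1::real}"
    show "exp (lg (g x0) t + Ln (g x t / g x0 t)) = g x t"
      using t lg(3)[of t] nz[OF x t] nz[OF x0 t] by (simp add: exp_add)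
  qed
  have "continuous_map (subtopology ?P (U \<times> {0..1})) euclidean (\<lambda>(x, t). lg (g x) t)"
  proof (rule continuous_map_eq[of _ _ ?h])
    have 1: "continuous_map (subtopology ?P (U \<times> {0..1})) euclidean (\<lambda>w. lg (g x0) (snd w))"
    proof (rule continuous_map_from_subtopology)
      have "continuous_map I01 euclidean (lg (g x0))"
        using continuous_on_lg[OF gx[OF x0] nz[OF x0] g0[OF x0]] by simp
      from continuous_map_compose[OF continuous_map_snd this]
      show "continuous_map ?P euclidean (\<lambda>w. lg (g x0) (snd w))" by (simp add: o_def)
    qed
    have 2: "continuous_map (subtopology ?P (U \<times> {0..1})) euclidean (\<lambda>w. Ln (g (fst w) (snd w) / g x0 (snd w)))"
    proof -
      have 1: "continuous_map (subtopology ?P (U \<times> {0..1})) (top_of_set (- \<real>\<^sub>\<le>\<^sub>0)) (\<lambda>w. g (fst w) (snd w) / g x0 (snd w))"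
        using slit by (auto simp: continuous_map_in_subtopology intro!: continuous_map_from_subtopology[OF r])
      have "continuous_on (- \<real>\<^sub>\<le>\<^sub>0) (\<lambda>z. Ln z)" by (intro continuous_intros) auto
      then have "continuous_map (top_of_set (- \<real>\<^sub>\<le>\<^sub>0)) euclidean Ln" by simp
      from continuous_map_compose[OF 1 this] show ?thesis by (simp add: o_def)
    qed
    show "continuous_map (subtopology ?P (U \<times> {0..1})) euclidean ?h"
      by (rule continuous_map_complex_algebra[OF 1 2])
  qed (use eq UX in auto)
  moreover have "openin ?P (U \<times> {0..1})" using UV by (auto simp: openin_prod_Times_iff)
  ultimately show "\<exists>U. openin ?P U \<and> p \<in> U \<and> continuous_map (subtopology ?P U) euclidean (\<lambda>(x, t). lg (g x) t)"
    using p_eq UV t0 by blast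
qed

section \<open>Moebius transformations and families of homeomorphisms\<close>

definition mob :: "complex \<Rightarrow> complex \<Rightarrow> complex \<Rightarrow> complex \<Rightarrow> complex option \<Rightarrow> complex option" where
  "mob a b c d p = proj (a * hx p + b * hy p) (c * hx p + d * hy p)"

lemma lin_nonzero:
  fixes a b c d x y :: complex
  assumes "a * d - b * c \<noteq> 0" "x \<noteq> 0 \<or> y \<noteq> 0"
  shows "a * x + b * y \<noteq> 0 \<or> c * x + d * y \<noteq> 0"
proof (rule ccontr)
  assume "\<not> ?thesis"
  then have e: "a * x + b * y = 0" "c * x + d * y = 0" by auto
  have "(a * d - b * c) * x = d * (a * x + b * y) - b * (c * x + d * y)" by algebra
  moreover have "(a * d - b * c) * y = a * (c * x + d * y) - c * (a * x + b * y)" by algebra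
  ultimately show False using assms e by simp
qed

lemma proj_mult: "k \<noteq> 0 \<Longrightarrow> proj (k * a) (k * b) = proj a b"
  by (simp add: proj_def)

lemma mob_proj:
  assumes "x \<noteq> 0 \<or> y \<noteq> 0"
  shows "mob a b c d (proj x y) = proj (a * x + b * y) (c * x + d * y)"
proof -
  obtain k where k: "k \<noteq> 0" "x = k * hx (proj x y)" "y = k * hy (proj x y)"
    using proj_scale[OF assms] by blast
  have "a * x + b * y = k * (a * hx (proj x y) + b * hy (proj x y))"
    "c * x + d * y = k * (c * hx (proj x y) + d * hy (proj x y))"
    using k(2,3) by (metis distrib_left mult.left_commute)+
  then show ?thesis using k(1) by (simp add: mob_def proj_mult)
qed

lemma mob_mob:
  assumes "a * d - b * c \<noteq> 0"
  shows "mob a' b' c' d' (mob a b c d p) = mob (a' * a + b' * c) (a' * b + b' * d) (c' * a + d' * c) (c' * b + d' * d) p"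
  unfolding mob_def[of a] using lin_nonzero[OF assms hx_hy_nonzero]
  by (subst mob_proj) (auto simp: mob_def algebra_simps)

lemma mob_id: "a \<noteq> 0 \<Longrightarrow> mob a 0 0 a p = p"
  by (cases p) (auto simp: mob_def proj_def)

lemma mob_inverse:
  assumes "a * d - b * c \<noteq> 0"
  shows "mob d (-b) (-c) a (mob a b c d p) = p" "mob a b c d (mob d (-b) (-c) a p) = p"
proof -
  have "d * a - b * c \<noteq> 0" using assms by (simp add: mult.commute)
  then show "mob d (-b) (-c) a (mob a b c d p) = p"
    using mob_id[of "d * a - b * c" p] assms by (simp add: mob_mob algebra_simps)
  show "mob a b c d (mob d (-b) (-c) a p) = p"
    using mob_id[of "d * a - b * c" p] assms by (subst mob_mob) (simp_all add: algebra_simps)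
qed

lemma bij_mob:
  assumes "a * d - b * c \<noteq> 0"
  shows "bij (mob a b c d)"
  by (rule bij_betw_byWitness[where f' = "mob d (-b) (-c) a"]) (use mob_inverse[OF assms] in auto)

text \<open>On representatives the map multiplies each of the four brackets by the determinant,
  twice above and twice below the fraction bar.\<close>

lemma CR_mob:
  assumes "a * d - b * c \<noteq> 0"
  shows "CR (mob a b c d p) (mob a b c d q) (mob a b c d u) (mob a b c d w) = CR p q u w"
proof -
  define D where "D = a * d - b * c"
  have D: "D \<noteq> 0" using assms by (simp add: D_def)
  have e: "(a * x + b * y) * (c * x' + d * y') - (a * x' + b * y') * (c * x + d * y) = D * (x * y' - x' * y)" for x y x' y'
    unfolding D_def by algebra
  have cancel: "D * A * (D * B) / (D * C * (D * E)) = A * B / (C * E)" for A B C E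
    using D by simp
  show ?thesis
    unfolding mob_def
    by (subst CR_proj) (use lin_nonzero[OF assms hx_hy_nonzero] in \<open>simp_all only: e cancel\<close>, simp_all add: CR_def br_def)
qed

lemma continuous_map_mob:
  assumes c: "continuous_map X euclidean a" "continuous_map X euclidean b" "continuous_map X euclidean c"
      "continuous_map X euclidean d" and u: "continuous_map X P1 u"
    and nz: "\<And>x. x \<in> topspace X \<Longrightarrow> a x * d x - b x * c x \<noteq> 0"
  shows "continuous_map X P1 (\<lambda>x. mob (a x) (b x) (c x) (d x) (u x))"
proof (rule continuous_map_locally)
  fix x0 assume x0: "x0 \<in> topspace X"
  obtain U r s where U: "openin X U" "x0 \<in> U" "continuous_map (subtopology X U) euclidean r"
    "continuous_map (subtopology X U) euclidean s"
    "\<And>y. y \<in> U \<Longrightarrow> r y \<noteq> 0 \<or> s y \<noteq> (0::complex)" "\<And>y. y \<in> U \<Longrightarrow> u y = proj (r y) (s y)"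
    using continuous_map_P1_local_rep[OF u x0] by blast
  have "continuous_map (subtopology X U) P1 (\<lambda>x. proj (a x * r x + b x * s x) (c x * r x + d x * s x))"
  proof (rule continuous_map_proj)
    show "continuous_map (subtopology X U) euclidean (\<lambda>x. a x * r x + b x * s x)"
      "continuous_map (subtopology X U) euclidean (\<lambda>x. c x * r x + d x * s x)"
      by (intro continuous_map_complex_algebra U continuous_map_from_subtopology c)+
    fix y assume "y \<in> topspace (subtopology X U)"
    then show "a y * r y + b y * s y \<noteq> 0 \<or> c y * r y + d y * s y \<noteq> 0"
      by (intro lin_nonzero nz U) auto
  qed
  then have "continuous_map (subtopology X U) P1 (\<lambda>x. mob (a x) (b x) (c x) (d x) (u x))"
    by (rule continuous_map_eq) (use U in \<open>auto simp: mob_proj\<close>)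
  then show "\<exists>U. openin X U \<and> x0 \<in> U \<and> continuous_map (subtopology X U) P1 (\<lambda>x. mob (a x) (b x) (c x) (d x) (u x))"
    using U by blast
qed

text \<open>Continuity is required jointly in parameter and point. The parameter space is the unit
  interval for isotopies, a single point for one map, and \<open>homeo_top\<close> for the
  tautological family; one continuity proof for the invariants serves all three.\<close>

definition fam :: "'a topology \<Rightarrow> ('a \<Rightarrow> complex option \<Rightarrow> complex option) \<Rightarrow> bool" where
  "fam X \<Phi> \<longleftrightarrow> continuous_map (prod_topology X P1) P1 (\<lambda>(x, p). \<Phi> x p) \<and> (\<forall>x \<in> topspace X. bij (\<Phi> x))"

lemma fam_homeomorphic_map:
  assumes "fam X \<Phi>" "x \<in> topspace X"
  shows "homeomorphic_map P1 P1 (\<Phi> x)"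
proof -
  have "continuous_map P1 P1 (\<lambda>p. \<Phi> x p)"
    using assms by (intro continuous_map_of_pairs[of X P1 P1 \<Phi> P1 "\<lambda>_. x" "\<lambda>p. p"])
      (auto simp: fam_def)
  then show ?thesis using assms by (simp add: homeomorphic_map_P1_iff fam_def)
qed

lemma fam_compose:
  assumes "fam X \<Phi>" "fam X \<Psi>"
  shows "fam X (\<lambda>x. \<Phi> x \<circ> \<Psi> x)"
proof -
  have "continuous_map (prod_topology X P1) P1 (\<lambda>w. \<Phi> (fst w) (\<Psi> (fst w) (snd w)))"
    by (rule continuous_map_of_pairs[of X P1 P1 \<Phi>])
      (use assms in \<open>auto simp: fam_def continuous_map_fst case_prod_unfold\<close>)
  then show ?thesis using assms by (auto simp: fam_def case_prod_unfold o_def bij_comp[unfolded o_def])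
qed

lemma fam_mob:
  assumes "continuous_map X euclidean a" "continuous_map X euclidean b" "continuous_map X euclidean c"
      "continuous_map X euclidean d" and "\<And>x. x \<in> topspace X \<Longrightarrow> a x * d x - b x * c x \<noteq> 0"
  shows "fam X (\<lambda>x. mob (a x) (b x) (c x) (d x))"
proof -
  have f: "continuous_map (prod_topology X P1) euclidean (\<lambda>w. g (fst w))" 
    if "continuous_map X euclidean g" for g :: "'a \<Rightarrow> complex"
    using continuous_map_compose[OF continuous_map_fst that] by (simp add: o_def)
  have "continuous_map (prod_topology X P1) P1 (\<lambda>w. mob (a (fst w)) (b (fst w)) (c (fst w)) (d (fst w)) (snd w))"
    by (intro continuous_map_mob f assms continuous_map_snd) (use assms in auto)
  then show ?thesis using assms(5) bij_mob by (auto simp: fam_def case_prod_unfold)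
qed

lemma fam_const:
  assumes "homeomorphic_map P1 P1 h"
  shows "fam X (\<lambda>_. h)"
proof -
  have "continuous_map (prod_topology X P1) P1 (\<lambda>w. h (snd w))"
    using continuous_map_compose[OF continuous_map_snd, of P1 P1 h] assms
    by (simp add: homeomorphic_map_P1_iff o_def)
  then show ?thesis using assms by (auto simp: fam_def homeomorphic_map_P1_iff case_prod_unfold)
qed

lemma fam_reparam:
  assumes "fam X \<Phi>" "continuous_map Y X g"
  shows "fam Y (\<lambda>y. \<Phi> (g y))"
proof -
  have "continuous_map (prod_topology Y P1) P1 (\<lambda>w. \<Phi> (g (fst w)) (snd w))"
    using assms continuous_map_compose[OF continuous_map_fst assms(2)]
    by (intro continuous_map_of_pairs[of X P1 P1 \<Phi>]) (auto simp: fam_def o_def continuous_map_snd)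
  moreover have "bij (\<Phi> (g y))" if "y \<in> topspace Y" for y
  proof -
    have "g y \<in> topspace X" using that assms(2) by (auto simp: continuous_map_def Pi_iff)
    then show ?thesis using assms(1) by (simp add: fam_def)
  qed
  ultimately show ?thesis by (simp add: fam_def case_prod_unfold)
qed

lemma homeomorphic_map_mob: "a * d - b * c \<noteq> 0 \<Longrightarrow> homeomorphic_map P1 P1 (mob a b c d)"
  using fam_homeomorphic_map[OF fam_mob, of "discrete_topology {()}"] by fastforce

lemma mobius_imp_mob:
  assumes "mobius \<nu>"
  obtains a b c d where "a * d - b * c \<noteq> 0" "\<nu> = mob a b c d"
proof -
  obtain p q where pq: "coprime p q" "q \<noteq> 0" "max (degree p) (degree q) = 1" "\<nu> = rat_map p q"
    using assms by (auto simp: mobius_def rational_map_deg_def)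
  have "\<exists>a b. p = [:b, a:]" if "degree p \<le> 1" for p :: "complex poly"
  proof -
    obtain b p' where 1: "p = pCons b p'" by (cases p)
    then have "degree p' = 0" using that by (cases "p' = 0") auto
    then obtain a where "p' = [:a:]" by (rule degree_eq_zeroE)
    then show ?thesis using 1 by blast
  qed
  from this[of p] this[of q] obtain a b c d where p: "p = [:b, a:]" and q: "q = [:d, c:]"
    using pq(3) by (auto simp: max_def split: if_splits)
  have deg: "a \<noteq> 0 \<or> c \<noteq> 0" using pq(3) p q by (auto simp: max_def split: if_splits)
  \<comment> \<open>A vanishing determinant makes \<open>p\<close> zero or \<open>q\<close> a
    multiple of \<open>p\<close>, against coprimality and degree 1.\<close>
  have det: "a * d - b * c \<noteq> 0"
  proof
    assume 0: "a * d - b * c = 0"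
    show False
    proof (cases "a = 0")
      case True
      then have "c \<noteq> 0" "b = 0" using deg 0 by auto
      then have "is_unit q" using pq(1) p True by simp
      then show False using \<open>c \<noteq> 0\<close> q is_unit_iff_degree[OF pq(2)] by simp
    next
      case False
      then have "q = smult (c / a) p" using 0 p q by (simp add: field_simps)
      then have "p dvd q" by (simp add: dvd_smult)
      then have "is_unit p" by (rule coprime_common_divisor[OF pq(1) dvd_refl])
      then show False using False p is_unit_iff_degree[of p] by auto
    qed
  qed
  have "rat_map p q w = mob a b c d w" for w
  proof (cases w)
    case None
    then show ?thesis using deg p q by (auto simp: rat_map_def mob_def proj_def)
  next
    case (Some z)
    then show ?thesis by (auto simp: rat_map_def mob_def proj_def p q algebra_simps)
  qed
  then show ?thesis using that[OF det] pq(4) by blast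
qed

section \<open>Square roots along paths, and identities between cross ratios\<close>

definition sq :: "(real \<Rightarrow> complex) \<Rightarrow> real \<Rightarrow> complex" where
  "sq g t = exp (lg g t / 2)"

lemma
  assumes "continuous_on {0..1} g" "\<And>t. t \<in> {0..1} \<Longrightarrow> g t \<noteq> 0" "g 0 = 1"
  shows continuous_on_sq: "continuous_on {0..1} (sq g)"
    and sq_0: "sq g 0 = 1"
    and sq_power2: "t \<in> {0..1} \<Longrightarrow> (sq g t)\<^sup>2 = g t"
  using continuous_on_lg[OF assms] lg_0[OF assms] exp_lg[OF assms, of t]
  by (auto simp: sq_def[abs_def] exp_double[symmetric] intro!: continuous_intros)

lemma sq_nonzero [simp]: "sq g t \<noteq> 0"
  by (simp add: sq_def)

lemma sq_unique:
  assumes u: "continuous_on {0..1} u" "u 0 = 1" "\<And>t. t \<in> {0..1} \<Longrightarrow> (u t)\<^sup>2 = g t"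
    "\<And>t. t \<in> {0..1} \<Longrightarrow> u t \<noteq> 0" and t: "t \<in> {0..1}"
  shows "sq g t = u t"
proof -
  have "continuous_on {0..1} (\<lambda>t. (u t)\<^sup>2)" using u by (intro continuous_intros)
  then have g: "continuous_on {0..1} g" using u(3) by (rule continuous_on_eq)
  have g1: "g t \<noteq> 0" if "t \<in> {0..1}" for t using u(3,4)[OF that] by (metis power_not_zero)
  have g0: "g 0 = 1" using u(2) u(3)[of 0] by simp
  show ?thesis
  proof (rule continuous_sqrt_unique[of "{0..1}" "sq g" u 0])
    show "sq g 0 = u 0" using sq_0[OF g g1 g0] u(2) by simp
    show "(sq g x)\<^sup>2 = (u x)\<^sup>2" if "x \<in> {0..1}" for x
      using sq_power2[OF g g1 g0 that] u(3)[OF that] by simp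
  qed (use u t continuous_on_sq[OF g g1 g0] in auto)
qed

lemma continuous_map_sq:
  assumes "continuous_map (prod_topology X I01) euclidean (\<lambda>(x, t). g x t)"
    and "\<And>x t. x \<in> topspace X \<Longrightarrow> t \<in> {0..1} \<Longrightarrow> g x t \<noteq> 0"
    and "\<And>x. x \<in> topspace X \<Longrightarrow> g x 0 = 1"
  shows "continuous_map (prod_topology X I01) euclidean (\<lambda>(x, t). sq (g x) t)"
proof -
  have 1: "continuous_map (prod_topology X I01) euclidean (\<lambda>w. lg (g (fst w)) (snd w))"
    using continuous_map_lg[OF assms] by (simp add: case_prod_unfold)
  have 2: "continuous_map (prod_topology X I01) euclidean (\<lambda>w. 2 :: complex)" by simp
  have "continuous_map (prod_topology X I01) euclidean (\<lambda>w. exp (lg (g (fst w)) (snd w) / 2))"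
    by (rule continuous_map_exp[OF continuous_map_complex_algebra(4)[OF 1 2]]) simp
  then show ?thesis by (simp add: sq_def case_prod_unfold)
qed

lemma continuous_map_at_time:
  assumes "continuous_map (prod_topology X I01) Y (\<lambda>(x, t). g x t)" "t \<in> {0..1}"
  shows "continuous_map X Y (\<lambda>x. g x t)"
  by (rule continuous_map_of_pairs[OF assms(1)]) (use assms(2) in auto)

lemma continuous_map_at_parameter:
  assumes "continuous_map (prod_topology X I01) euclidean (\<lambda>(x, t). g x t)" "x \<in> topspace X"
  shows "continuous_on {0..1} (g x)"
  using continuous_map_of_pairs[OF assms(1), of I01 "\<lambda>_. x" "\<lambda>t. t"] assms(2) by simp

text \<open>The three-term relation between the 2x2 minors of a 2x4 matrix. It makes a cross ratio
  minus 1, and differences of cross ratios with common pole, into multiples of a single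
  bracket.\<close>

lemma Pluecker: "br p u * br q a - br q u * br p a = br p q * br u a"
  by (simp add: br_def algebra_simps)

lemma CR_eq_1: "CR p q u a = 1 \<Longrightarrow> u \<noteq> a \<Longrightarrow> p = q"
  using Pluecker[of p u q a] by (auto simp: CR_def br_eq_0_iff divide_eq_1_iff)

lemma CR_self: "q \<noteq> u \<Longrightarrow> q \<noteq> a \<Longrightarrow> CR q q u a = 1"
  by (simp add: CR_def br_eq_0_iff)

lemma CR_eq_0: "CR p q u a = 0 \<Longrightarrow> p \<noteq> u \<Longrightarrow> q \<noteq> u \<Longrightarrow> p \<noteq> a \<Longrightarrow> q \<noteq> a \<Longrightarrow> False"
  by (simp add: CR_def br_eq_0_iff)

lemma CR_mult: "q \<noteq> u \<Longrightarrow> q \<noteq> a \<Longrightarrow> CR p q u a * CR q r u a = CR p r u a"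
  by (simp add: CR_def br_eq_0_iff)

section \<open>Invariants of marked homeomorphisms\<close>

text \<open>In the coordinate with \<open>v\<close> at 0 and \<open>a1\<close> at infinity,
  \<gamma>1 and \<gamma>2 avoid the two branch values, so a square root can be continued along them.
  That \<gamma>2 avoids \<open>a3\<close> keeps \<open>rr\<close> away from 0; that it leaves
  \<open>a0\<close> for good keeps the next square root away from -1. The path \<gamma>3 avoids the
  zero and the pole of the cross ratio whose logarithm is \<open>KK\<close>.\<close>

locale marked_paths =
  fixes a0 a1 a2 a3 v :: "complex option" and \<gamma>1 \<gamma>2 \<gamma>3 :: "real \<Rightarrow> complex option"
  assumes path1: "continuous_map I01 P1 \<gamma>1" "\<gamma>1 0 = a3" "\<gamma>1 1 = a0"
    and path2: "continuous_map I01 P1 \<gamma>2" "\<gamma>2 0 = a0" "\<gamma>2 1 = a2"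
    and path3: "continuous_map I01 P1 \<gamma>3" "\<gamma>3 0 = a2" "\<gamma>3 1 = a3"
    and distinct: "distinct [a0, a1, a2, a3, v]"
    and avoid1: "t \<in> {0..1} \<Longrightarrow> \<gamma>1 t \<notin> {v, a1}"
    and avoid2: "t \<in> {0..1} \<Longrightarrow> \<gamma>2 t \<notin> {v, a1, a3}" "t \<in> {0<..1} \<Longrightarrow> \<gamma>2 t \<noteq> a0"
    and avoid3: "t \<in> {0..1} \<Longrightarrow> \<gamma>3 t \<notin> {a0, a1}"
begin

text \<open>All three functions are normalised to be 1 at time 0, by putting the starting point of
  the path in the second place of the cross ratio; this selects the branches of \<open>sq\<close>
  and \<open>lg\<close>.\<close>

definition "g1 \<phi> t = CR (\<phi> (\<gamma>1 t)) (\<phi> a3) (\<phi> v) (\<phi> a1)"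
definition "g2 \<phi> t = CR (\<phi> (\<gamma>2 t)) (\<phi> a0) (\<phi> v) (\<phi> a1)"
definition "g3 \<phi> t = CR (\<phi> (\<gamma>3 t)) (\<phi> a2) (\<phi> a0) (\<phi> a1)"
definition "\<rho> \<phi> = sq (g1 \<phi>) 1"
text \<open>With \<theta> a square root of the coordinate that has \<open>v\<close> at 0 and
  \<open>a1\<close> at infinity, \<rho> is \<theta>(a0) / \<theta>(a3), and \<open>rr\<close> is
  (\<theta>(\<gamma>2 t) + \<theta>(a3)) / (\<theta>(a0) + \<theta>(a3)). At time 1 this is the
  product of (1 - x) / x and (1 - x') / x', so that \<open>QQ\<close> is a root of it.\<close>

definition "rr \<phi> t = (sq (g2 \<phi>) t * \<rho> \<phi> + 1) / (\<rho> \<phi> + 1)"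
definition "QQ \<phi> = sq (rr \<phi>) 1"
text \<open>The root starts at 1, so dividing 1 plus the root by 2 makes the path start at 1, as
  \<open>lg\<close> requires.\<close>

definition "LL \<phi> = lg (\<lambda>t. (1 + sq (rr \<phi>) t) / 2) 1"
definition "KK \<phi> = lg (g3 \<phi>) 1"

lemma fam_CR:
  assumes f: "fam X \<Phi>" and \<gamma>: "continuous_map I01 P1 \<gamma>"
    and ne: "q \<noteq> u" "\<And>t. t \<in> {0..1} \<Longrightarrow> \<gamma> t \<noteq> a"
  shows "continuous_map (prod_topology X I01) euclidean (\<lambda>(x, t). CR (\<Phi> x (\<gamma> t)) (\<Phi> x q) (\<Phi> x u) (\<Phi> x a))"
proof -
  let ?P = "prod_topology X I01"
  have c: "continuous_map (prod_topology X P1) P1 (\<lambda>(x, p). \<Phi> x p)" using f by (simp add: fam_def)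
  have 1: "continuous_map ?P P1 (\<lambda>w. \<Phi> (fst w) (\<gamma> (snd w)))"
    using continuous_map_compose[OF continuous_map_snd \<gamma>]
    by (intro continuous_map_of_pairs[OF c]) (auto simp: continuous_map_fst o_def)
  have 2: "continuous_map ?P P1 (\<lambda>w. \<Phi> (fst w) p)" for p
    by (intro continuous_map_of_pairs[OF c]) (auto simp: continuous_map_fst)
  have inj: "\<Phi> x p = \<Phi> x q \<longleftrightarrow> p = q" if "x \<in> topspace X" for x p q
    using f that by (auto simp: fam_def bij_def inj_eq)
  have "continuous_map ?P euclidean (\<lambda>w. CR (\<Phi> (fst w) (\<gamma> (snd w))) (\<Phi> (fst w) q) (\<Phi> (fst w) u) (\<Phi> (fst w) a))"
    by (intro continuous_map_CR 1 2) (use ne inj in auto)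
  then show ?thesis by (simp add: case_prod_unfold)
qed

context
  fixes X :: "'a topology" and \<Phi> :: "'a \<Rightarrow> complex option \<Rightarrow> complex option"
  assumes f: "fam X \<Phi>"
begin

lemma inj_fam: "x \<in> topspace X \<Longrightarrow> \<Phi> x p = \<Phi> x q \<longleftrightarrow> p = q"
  using f by (auto simp: fam_def bij_def inj_eq)

lemma continuous_g:
  "continuous_map (prod_topology X I01) euclidean (\<lambda>(x, t). g1 (\<Phi> x) t)"
  "continuous_map (prod_topology X I01) euclidean (\<lambda>(x, t). g2 (\<Phi> x) t)"
  "continuous_map (prod_topology X I01) euclidean (\<lambda>(x, t). g3 (\<Phi> x) t)"
  unfolding g1_def g2_def g3_def
  by (rule fam_CR[OF f]; use path1 path2 path3 avoid1 avoid2 avoid3 distinct in auto)+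

lemma g_start:
  assumes "x \<in> topspace X"
  shows "g1 (\<Phi> x) 0 = 1" "g2 (\<Phi> x) 0 = 1" "g3 (\<Phi> x) 0 = 1"
  unfolding g1_def g2_def g3_def path1 path2 path3
  by (rule CR_self; use inj_fam[OF assms] distinct in auto)+

lemma g_nonzero:
  assumes "x \<in> topspace X" "t \<in> {0..1}"
  shows "g1 (\<Phi> x) t \<noteq> 0" "g2 (\<Phi> x) t \<noteq> 0" "g3 (\<Phi> x) t \<noteq> 0"
  unfolding g1_def g2_def g3_def
  by (rule notI, drule CR_eq_0; use inj_fam[OF assms(1)] distinct avoid1[OF assms(2)] avoid2(1)[OF assms(2)] avoid3[OF assms(2)] in auto)+

lemmas continuous_sq_g = continuous_map_sq[OF continuous_g(1) g_nonzero(1) g_start(1)]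
  continuous_map_sq[OF continuous_g(2) g_nonzero(2) g_start(2)]

lemma sq_g_power2:
  assumes x: "x \<in> topspace X" and t: "t \<in> {0..1}"
  shows "(sq (g1 (\<Phi> x)) t)\<^sup>2 = g1 (\<Phi> x) t" "(sq (g2 (\<Phi> x)) t)\<^sup>2 = g2 (\<Phi> x) t"
  using sq_power2[OF continuous_map_at_parameter[OF continuous_g(1) x] g_nonzero(1)[OF x] g_start(1)[OF x] t]
    sq_power2[OF continuous_map_at_parameter[OF continuous_g(2) x] g_nonzero(2)[OF x] g_start(2)[OF x] t] by simp_all

lemma sq_g_start:
  assumes x: "x \<in> topspace X"
  shows "sq (g1 (\<Phi> x)) 0 = 1" "sq (g2 (\<Phi> x)) 0 = 1"
  using sq_0[OF continuous_map_at_parameter[OF continuous_g(1) x] g_nonzero(1)[OF x] g_start(1)[OF x]]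
    sq_0[OF continuous_map_at_parameter[OF continuous_g(2) x] g_nonzero(2)[OF x] g_start(2)[OF x]] by simp_all

lemma \<rho>_power2:
  assumes x: "x \<in> topspace X"
  shows "(\<rho> (\<Phi> x))\<^sup>2 = CR (\<Phi> x a0) (\<Phi> x a3) (\<Phi> x v) (\<Phi> x a1)"
  using sq_g_power2(1)[OF x, of 1] by (simp add: \<rho>_def g1_def path1)

lemma \<rho>_nonzero: "\<rho> (\<Phi> x) \<noteq> 0"
  by (simp add: \<rho>_def)

lemma \<rho>_plus_1:
  assumes x: "x \<in> topspace X"
  shows "\<rho> (\<Phi> x) + 1 \<noteq> 0"
proof
  assume "\<rho> (\<Phi> x) + 1 = 0"
  then have "\<rho> (\<Phi> x) = -1" by (simp add: eq_neg_iff_add_eq_0)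
  then have "CR (\<Phi> x a0) (\<Phi> x a3) (\<Phi> x v) (\<Phi> x a1) = 1" using \<rho>_power2[OF x] by simp
  then have "\<Phi> x a0 = \<Phi> x a3" by (rule CR_eq_1) (use inj_fam[OF x] distinct in auto)
  then show False using inj_fam[OF x] distinct by auto
qed

text \<open>A zero would make two square roots opposite, hence their squares equal, and \<gamma>2
  would meet \<open>a3\<close>.\<close>

lemma rr_nonzero:
  assumes x: "x \<in> topspace X" and t: "t \<in> {0..1}"
  shows "rr (\<Phi> x) t \<noteq> 0"
proof
  assume "rr (\<Phi> x) t = 0"
  then have "sq (g2 (\<Phi> x)) t * \<rho> (\<Phi> x) = -1"
    using \<rho>_plus_1[OF x] by (simp add: rr_def eq_neg_iff_add_eq_0)
  then have "(sq (g2 (\<Phi> x)) t)\<^sup>2 * (\<rho> (\<Phi> x))\<^sup>2 = 1" by (simp flip: power_mult_distrib)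
  then have "CR (\<Phi> x (\<gamma>2 t)) (\<Phi> x a0) (\<Phi> x v) (\<Phi> x a1) * CR (\<Phi> x a0) (\<Phi> x a3) (\<Phi> x v) (\<Phi> x a1) = 1"
    using sq_g_power2(2)[OF x t] \<rho>_power2[OF x] by (simp add: g2_def)
  then have "CR (\<Phi> x (\<gamma>2 t)) (\<Phi> x a3) (\<Phi> x v) (\<Phi> x a1) = 1"
    by (subst (asm) CR_mult) (use inj_fam[OF x] distinct in auto)
  then have "\<Phi> x (\<gamma>2 t) = \<Phi> x a3" by (rule CR_eq_1) (use inj_fam[OF x] distinct in auto)
  then show False using inj_fam[OF x] avoid2(1)[OF t] by auto
qed

lemma rr_start: "x \<in> topspace X \<Longrightarrow> rr (\<Phi> x) 0 = 1"
  using \<rho>_plus_1 sq_g_start by (simp add: rr_def)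

lemma continuous_\<rho>: "continuous_map X euclidean (\<lambda>x. \<rho> (\<Phi> x))"
  unfolding \<rho>_def by (rule continuous_map_at_time[OF continuous_sq_g(1)]) auto

lemma continuous_rr: "continuous_map (prod_topology X I01) euclidean (\<lambda>(x, t). rr (\<Phi> x) t)"
proof -
  let ?P = "prod_topology X I01"
  have 1: "continuous_map ?P euclidean (\<lambda>w. \<rho> (\<Phi> (fst w)))"
    using continuous_map_compose[OF continuous_map_fst continuous_\<rho>] by (simp add: o_def)
  have 2: "continuous_map ?P euclidean (\<lambda>w. sq (g2 (\<Phi> (fst w))) (snd w))"
    using continuous_sq_g(2) by (simp add: case_prod_unfold)
  have 3: "continuous_map ?P euclidean (\<lambda>w. 1 :: complex)" by simp
  have "continuous_map ?P euclidean (\<lambda>w. (sq (g2 (\<Phi> (fst w))) (snd w) * \<rho> (\<Phi> (fst w)) + 1) / (\<rho> (\<Phi> (fst w)) + 1))"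
    by (intro continuous_map_complex_algebra 1 2 3) (use \<rho>_plus_1 in auto)
  then show ?thesis by (simp add: rr_def case_prod_unfold)
qed

lemmas continuous_sq_rr = continuous_map_sq[OF continuous_rr rr_nonzero rr_start]

lemma sq_rr_start: "x \<in> topspace X \<Longrightarrow> sq (rr (\<Phi> x)) 0 = 1"
  using sq_0[OF continuous_map_at_parameter[OF continuous_rr] rr_nonzero rr_start] by blast

lemma sq_rr_power2: 
  assumes x: "x \<in> topspace X" and t: "t \<in> {0..1}"
  shows "(sq (rr (\<Phi> x)) t)\<^sup>2 = rr (\<Phi> x) t"
  using sq_power2[OF continuous_map_at_parameter[OF continuous_rr x] rr_nonzero[OF x] rr_start[OF x] t] by simp

text \<open>The value -1 would give \<open>rr = 1\<close>, so \<gamma>2 would be at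
  \<open>a0\<close>. That happens only at time 0, where the root is +1. This is the point at which
  the removed curve enters: it allows a logarithm of 1 + \<open>QQ\<close>.\<close>

lemma sq_rr_ne_minus_1:
  assumes x: "x \<in> topspace X" and t: "t \<in> {0..1}"
  shows "(1 + sq (rr (\<Phi> x)) t) / 2 \<noteq> 0"
proof
  assume "(1 + sq (rr (\<Phi> x)) t) / 2 = 0"
  then have m: "sq (rr (\<Phi> x)) t = -1" by (simp add: eq_neg_iff_add_eq_0 add.commute)
  then have "rr (\<Phi> x) t = 1" using sq_rr_power2[OF x t] by simp
  then have "sq (g2 (\<Phi> x)) t = 1" using \<rho>_plus_1[OF x] \<rho>_nonzero by (simp add: rr_def)
  then have "CR (\<Phi> x (\<gamma>2 t)) (\<Phi> x a0) (\<Phi> x v) (\<Phi> x a1) = 1" using sq_g_power2(2)[OF x t] by (simp add: g2_def)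
  then have "\<Phi> x (\<gamma>2 t) = \<Phi> x a0" by (rule CR_eq_1) (use inj_fam[OF x] distinct in auto)
  then have "\<gamma>2 t = a0" using inj_fam[OF x] by auto
  then have "t = 0" using avoid2(2)[of t] t by (cases "t = 0") auto
  then show False using m sq_rr_start[OF x] by simp
qed

lemma continuous_half: "continuous_map (prod_topology X I01) euclidean (\<lambda>(x, t). (1 + sq (rr (\<Phi> x)) t) / 2)"
proof -
  have 1: "continuous_map (prod_topology X I01) euclidean (\<lambda>w. sq (rr (\<Phi> (fst w))) (snd w))"
    using continuous_sq_rr by (simp add: case_prod_unfold)
  have 2: "continuous_map (prod_topology X I01) euclidean (\<lambda>w. c :: complex)" for c by simp
  have "continuous_map (prod_topology X I01) euclidean (\<lambda>w. (1 + sq (rr (\<Phi> (fst w))) (snd w)) / 2)"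
    by (intro continuous_map_complex_algebra 1 2) auto
  then show ?thesis by (simp add: case_prod_unfold)
qed

lemma half_start: "x \<in> topspace X \<Longrightarrow> (1 + sq (rr (\<Phi> x)) 0) / 2 = 1"
  using sq_rr_start by simp

lemma continuous_invariants:
  "continuous_map X euclidean (\<lambda>x. QQ (\<Phi> x))"
  "continuous_map X euclidean (\<lambda>x. LL (\<Phi> x))"
  "continuous_map X euclidean (\<lambda>x. KK (\<Phi> x))"
  unfolding QQ_def LL_def KK_def
  by (rule continuous_map_at_time[OF continuous_sq_rr]
      continuous_map_at_time[OF continuous_map_lg[OF continuous_half sq_rr_ne_minus_1 half_start]]
      continuous_map_at_time[OF continuous_map_lg[OF continuous_g(3) g_nonzero(3) g_start(3)]]; simp)+

lemma exp_invariants: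
  assumes x: "x \<in> topspace X"
  shows "exp (LL (\<Phi> x)) = (1 + QQ (\<Phi> x)) / 2"
    "exp (KK (\<Phi> x)) = CR (\<Phi> x a3) (\<Phi> x a2) (\<Phi> x a0) (\<Phi> x a1)"
    "(QQ (\<Phi> x))\<^sup>2 = (sq (g2 (\<Phi> x)) 1 * \<rho> (\<Phi> x) + 1) / (\<rho> (\<Phi> x) + 1)"
proof -
  show "exp (LL (\<Phi> x)) = (1 + QQ (\<Phi> x)) / 2" unfolding LL_def QQ_def
    by (rule exp_lg[OF continuous_map_at_parameter[OF continuous_half x] sq_rr_ne_minus_1[OF x] half_start[OF x], of 1]) auto
  have "exp (KK (\<Phi> x)) = g3 (\<Phi> x) 1" unfolding KK_def
    by (rule exp_lg[OF continuous_map_at_parameter[OF continuous_g(3) x] g_nonzero(3)[OF x] g_start(3)[OF x], of 1]) auto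
  then show "exp (KK (\<Phi> x)) = CR (\<Phi> x a3) (\<Phi> x a2) (\<Phi> x a0) (\<Phi> x a1)" by (simp add: g3_def path3)
  have "(QQ (\<Phi> x))\<^sup>2 = rr (\<Phi> x) 1" unfolding QQ_def by (rule sq_rr_power2[OF x]) simp
  then show "(QQ (\<Phi> x))\<^sup>2 = (sq (g2 (\<Phi> x)) 1 * \<rho> (\<Phi> x) + 1) / (\<rho> (\<Phi> x) + 1)" by (simp add: rr_def)
qed

end

text \<open>The cross ratios of the marked points do not move during the isotopy. So \<rho>, the
  final value of \<open>sq (g2 _)\<close> and \<open>QQ\<close> are in turn continuous square roots
  of constants, and \<open>LL\<close>, \<open>KK\<close> are continuous logarithms of
  constants.\<close>

lemma invariants_isotopy:
  assumes f: "fam I01 H" and c: "\<And>t p. t \<in> {0..1} \<Longrightarrow> p \<in> {a0, a1, a2, a3, v} \<Longrightarrow> H t p = H 1 p"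
  shows "QQ (H 0) = QQ (H 1)" "LL (H 0) = LL (H 1)" "KK (H 0) = KK (H 1)"
proof -
  have S: "connected {0..1::real}" by simp
  have const: "F t = F 1" if "t \<in> {0..1}" "continuous_map I01 euclidean F"
    "\<And>t. t \<in> {0..1} \<Longrightarrow> F t \<noteq> 0" "\<And>t. t \<in> {0..1} \<Longrightarrow> (F t)\<^sup>2 = (F 1)\<^sup>2" for t and F :: "real \<Rightarrow> complex"
  proof (rule continuous_sqrt_unique[OF S, of F "\<lambda>_. F 1" 1])
    show "continuous_on {0..1} F" using that(2) by simp
    show "F 1 \<noteq> 0" by (rule that(3)) simp
    show "(F x)\<^sup>2 = (F 1)\<^sup>2" if "x \<in> {0..1}" for x by (rule \<open>\<And>t. t \<in> {0..1} \<Longrightarrow> (F t)\<^sup>2 = (F 1)\<^sup>2\<close>[OF that])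
    show "t \<in> {0..1}" by (rule that(1))
  qed auto
  have c': "H t a0 = H 1 a0" "H t a1 = H 1 a1" "H t a2 = H 1 a2" "H t a3 = H 1 a3" "H t v = H 1 v"
    if "t \<in> {0..1}" for t by (rule c[OF that], simp)+
  have r: "\<rho> (H t) = \<rho> (H 1)" if "t \<in> {0..1}" for t
  proof (rule const[OF that])
    fix s assume s: "s \<in> {0..1::real}"
    show "(\<rho> (H s))\<^sup>2 = (\<rho> (H 1))\<^sup>2"
      using \<rho>_power2[OF f, of s] \<rho>_power2[OF f, of 1] s by (simp only: c'[OF s]) simp
  qed (use continuous_\<rho>[OF f] \<rho>_nonzero[OF f] in auto)
  have s: "sq (g2 (H t)) 1 = sq (g2 (H 1)) 1" if "t \<in> {0..1}" for t
  proof (rule const[OF that])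
    fix s assume s: "s \<in> {0..1::real}"
    show "(sq (g2 (H s)) 1)\<^sup>2 = (sq (g2 (H 1)) 1)\<^sup>2"
      using sq_g_power2(2)[OF f, of s 1] sq_g_power2(2)[OF f, of 1 1] s by (simp only: g2_def path2 c'[OF s]) simp
  qed (use continuous_map_at_time[OF continuous_sq_g(2)[OF f], of 1] in auto)
  have q: "QQ (H t) = QQ (H 1)" if "t \<in> {0..1}" for t
  proof (rule const[OF that])
    fix u assume u: "u \<in> {0..1::real}"
    show "(QQ (H u))\<^sup>2 = (QQ (H 1))\<^sup>2"
      using exp_invariants(3)[OF f, of u] exp_invariants(3)[OF f, of 1] u by (simp only: r[OF u] s[OF u]) simp
  qed (use continuous_invariants(1)[OF f] in \<open>auto simp: QQ_def\<close>)
  show "QQ (H 0) = QQ (H 1)" using q[of 0] by simp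
  show "LL (H 0) = LL (H 1)"
  proof (rule constant_if_exp_constant[OF S, of "\<lambda>t. LL (H t)" "(1 + QQ (H 1)) / 2"])
    fix u assume u: "u \<in> {0..1::real}"
    show "exp (LL (H u)) = (1 + QQ (H 1)) / 2"
      using exp_invariants(1)[OF f, of u] u by (simp only: q[OF u]) simp
  qed (use continuous_invariants(2)[OF f] in auto)
  show "KK (H 0) = KK (H 1)"
  proof (rule constant_if_exp_constant[OF S, of "\<lambda>t. KK (H t)" "CR (H 1 a3) (H 1 a2) (H 1 a0) (H 1 a1)"])
    fix u assume u: "u \<in> {0..1::real}"
    show "exp (KK (H u)) = CR (H 1 a3) (H 1 a2) (H 1 a0) (H 1 a1)"
      using exp_invariants(2)[OF f, of u] u by (simp only: c'[OF u]) simp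
  qed (use continuous_invariants(3)[OF f] in auto)
qed

lemma invariants_mobius:
  assumes "mobius \<nu>"
  shows "QQ (\<nu> \<circ> \<phi>) = QQ \<phi>" "LL (\<nu> \<circ> \<phi>) = LL \<phi>" "KK (\<nu> \<circ> \<phi>) = KK \<phi>"
proof -
  obtain a b c d where n: "a * d - b * c \<noteq> 0" "\<nu> = mob a b c d" by (rule mobius_imp_mob[OF assms])
  have "g1 (\<nu> \<circ> \<phi>) = g1 \<phi>" "g2 (\<nu> \<circ> \<phi>) = g2 \<phi>" "g3 (\<nu> \<circ> \<phi>) = g3 \<phi>"
    by (auto simp: fun_eq_iff g1_def g2_def g3_def n(2) CR_mob[OF n(1)])
  then show "QQ (\<nu> \<circ> \<phi>) = QQ \<phi>" "LL (\<nu> \<circ> \<phi>) = LL \<phi>" "KK (\<nu> \<circ> \<phi>) = KK \<phi>"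
    by (simp_all add: QQ_def LL_def KK_def rr_def[abs_def] \<rho>_def)
qed

end

lemma isotopic_rel_iff:
  "isotopic_rel X \<phi>1 \<phi>2 \<longleftrightarrow>
    (\<exists>H. fam I01 H \<and> H 0 = \<phi>1 \<and> H 1 = \<phi>2 \<and> (\<forall>t\<in>{0..1}. \<forall>x\<in>X. H t x = \<phi>2 x))"
proof
  assume "isotopic_rel X \<phi>1 \<phi>2"
  then obtain h where h: "continuous_map (prod_topology I01 P1) P1 h" "\<forall>x. h (0, x) = \<phi>1 x" "\<forall>x. h (1, x) = \<phi>2 x"
    "\<forall>t\<in>{0..1}. homeomorphic_map P1 P1 (\<lambda>x. h (t, x)) \<and> (\<forall>x\<in>X. h (t, x) = \<phi>2 x)"
    unfolding isotopic_rel_def homotopic_with_def by auto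
  then show "\<exists>H. fam I01 H \<and> H 0 = \<phi>1 \<and> H 1 = \<phi>2 \<and> (\<forall>t\<in>{0..1}. \<forall>x\<in>X. H t x = \<phi>2 x)"
    by (intro exI[of _ "\<lambda>t x. h (t, x)"]) (auto simp: fam_def homeomorphic_map_P1_iff)
next
  assume "\<exists>H. fam I01 H \<and> H 0 = \<phi>1 \<and> H 1 = \<phi>2 \<and> (\<forall>t\<in>{0..1}. \<forall>x\<in>X. H t x = \<phi>2 x)"
  then obtain H where H: "fam I01 H" "H 0 = \<phi>1" "H 1 = \<phi>2" "\<forall>t\<in>{0..1}. \<forall>x\<in>X. H t x = \<phi>2 x" by blast
  have h: "homeomorphic_map P1 P1 (H t)" if "t \<in> {0..1}" for t
    by (rule fam_homeomorphic_map[OF H(1)]) (use that in simp)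
  show "isotopic_rel X \<phi>1 \<phi>2"
    unfolding isotopic_rel_def homotopic_with_def
    by (rule exI[of _ "\<lambda>(t, x). H t x"]) (use H h in \<open>auto simp: fam_def\<close>)
qed

lemma (in marked_paths) invariants_teich_equiv:
  assumes e: "teich_equiv B \<phi>1 \<phi>2" and B: "{a0, a1, a2, a3, v} \<subseteq> B"
  shows "QQ \<phi>1 = QQ \<phi>2 \<and> LL \<phi>1 = LL \<phi>2 \<and> KK \<phi>1 = KK \<phi>2"
proof -
  obtain \<nu> where n: "mobius \<nu>" and i: "isotopic_rel B (\<nu> \<circ> \<phi>1) \<phi>2" using e by (auto simp: teich_equiv_def)
  obtain H where H: "fam I01 H" "H 0 = \<nu> \<circ> \<phi>1" "H 1 = \<phi>2" "\<And>t x. t \<in> {0..1} \<Longrightarrow> x \<in> B \<Longrightarrow> H t x = \<phi>2 x"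
    using i unfolding isotopic_rel_iff by blast
  have "QQ (H 0) = QQ (H 1)" "LL (H 0) = LL (H 1)" "KK (H 0) = KK (H 1)"
    by (rule invariants_isotopy[OF H(1)]; use H B in auto)+
  then show ?thesis using invariants_mobius[OF n] H(2,3) by simp
qed

section \<open>The topology of Teichmueller space\<close>

text \<open>The embedding has values in the unit sphere. The bound makes the supremum in
  \<open>sup_dist\<close> a genuine one.\<close>

lemma chordal_le_2: "chordal p q \<le> 2"
proof -
  have n: "norm (sph_emb p) \<le> 1" for p
  proof -
    have nz: "hx p \<noteq> 0 \<or> hy p \<noteq> 0" by (rule hx_hy_nonzero)
    define A where "A = (cmod (hx p))\<^sup>2"
    define B where "B = (cmod (hy p))\<^sup>2"
    have AB: "A \<ge> 0" "B \<ge> 0" "A + B > 0"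
      using nz by (auto simp: A_def B_def intro: add_pos_nonneg add_nonneg_pos)
    have "sph_emb p = (2 * hx p * cnj (hy p) / of_real (A + B), (A - B) / (A + B))"
      using sph_emb_proj[OF nz] by (simp add: A_def B_def)
    then have "(norm (sph_emb p))\<^sup>2 = (cmod (2 * hx p * cnj (hy p) / of_real (A + B)))\<^sup>2 + ((A - B) / (A + B))\<^sup>2"
      by (simp add: norm_Pair power_divide)
    also have "(cmod (2 * hx p * cnj (hy p) / of_real (A + B)))\<^sup>2 = 4 * A * B / (A + B)\<^sup>2"
      using AB by (simp add: norm_mult norm_divide power_divide power_mult_distrib A_def B_def del: of_real_add)
    also have "4 * A * B / (A + B)\<^sup>2 + ((A - B) / (A + B))\<^sup>2 = (4 * A * B + (A - B)\<^sup>2) / (A + B)\<^sup>2"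
      by (simp add: power_divide add_divide_distrib)
    also have "4 * A * B + (A - B)\<^sup>2 = (A + B)\<^sup>2" by (simp add: power2_eq_square algebra_simps)
    also have "(A + B)\<^sup>2 / (A + B)\<^sup>2 = 1" using AB by simp
    finally show ?thesis by (auto simp: power2_eq_1_iff)
  qed
  have "chordal p q \<le> norm (sph_emb p) + norm (sph_emb q)"
    unfolding chordal_def by (simp add: dist_norm norm_triangle_ineq4)
  then show ?thesis using n[of p] n[of q] by linarith
qed

lemma bdd_above_chordal: "bdd_above (range (\<lambda>x. chordal (\<phi> x) (\<psi> x)))"
  using chordal_le_2 by (auto simp: bdd_above_def)

lemma chordal_le_sup_dist: "chordal (\<phi> x) (\<psi> x) \<le> sup_dist \<phi> \<psi>"
  unfolding sup_dist_def by (rule cSUP_upper[OF _ bdd_above_chordal]) simp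

lemma Metric_space_sup_dist: "Metric_space homeo_plus sup_dist"
proof
  show nn: "0 \<le> sup_dist \<phi> \<psi>" for \<phi> \<psi>
    using chordal_le_sup_dist[of \<phi> None \<psi>] chordal.nonneg order_trans by blast
  show "sup_dist \<phi> \<psi> = sup_dist \<psi> \<phi>" for \<phi> \<psi>
    by (simp add: sup_dist_def chordal.commute)
  show "(sup_dist \<phi> \<psi> = 0) = (\<phi> = \<psi>)" for \<phi> \<psi>
  proof
    assume 0: "sup_dist \<phi> \<psi> = 0"
    have "chordal (\<phi> x) (\<psi> x) = 0" for x
      using chordal_le_sup_dist[of \<phi> x \<psi>] 0 chordal.nonneg[of "\<phi> x" "\<psi> x"] by linarith
    then show "\<phi> = \<psi>" by (auto simp: fun_eq_iff)
  qed (simp add: sup_dist_def)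
  show "sup_dist \<phi> \<omega> \<le> sup_dist \<phi> \<psi> + sup_dist \<psi> \<omega>" for \<phi> \<psi> \<omega>
    unfolding sup_dist_def[of \<phi> \<omega>]
  proof (rule cSUP_least)
    fix x
    have "chordal (\<phi> x) (\<omega> x) \<le> chordal (\<phi> x) (\<psi> x) + chordal (\<psi> x) (\<omega> x)"
      by (rule chordal.triangle) auto
    then show "chordal (\<phi> x) (\<omega> x) \<le> sup_dist \<phi> \<psi> + sup_dist \<psi> \<omega>"
      using chordal_le_sup_dist[of \<phi> x \<psi>] chordal_le_sup_dist[of \<psi> x \<omega>] by linarith
  qed simp
qed

interpretation homeo: Metric_space homeo_plus sup_dist
  rewrites "homeo.mtopology = homeo_top"
  using Metric_space_sup_dist by (auto simp: homeo_top_def)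

lemma topspace_homeo_top [simp]: "topspace homeo_top = homeo_plus"
  using homeo.topspace_mtopology by simp

text \<open>Evaluation is jointly continuous for the uniform metric: one half of \<epsilon> is spent
  on the continuity of \<phi>, the other on the distance between the maps. The invariants are
  thereby continuous on all homeomorphisms at once.\<close>

lemma fam_homeo_top: "fam homeo_top (\<lambda>\<phi>. \<phi>)"
proof -
  have h: "homeomorphic_map P1 P1 \<phi>" if "\<phi> \<in> homeo_plus" for \<phi>
    using that by (simp add: homeo_plus_def)
  have "continuous_map (prod_topology homeo_top P1) P1 (\<lambda>(\<phi>, p). \<phi> p)"
    unfolding chordal.continuous_map_to_metric
  proof (intro ballI allI impI)
    fix w and \<epsilon> :: real assume w: "w \<in> topspace (prod_topology homeo_top P1)" and e: "\<epsilon> > 0"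
    obtain \<phi> p where w_eq: "w = (\<phi>, p)" by force
    have \<phi>: "\<phi> \<in> homeo_plus" using w w_eq by auto
    have c: "continuous_map P1 P1 \<phi>" using h[OF \<phi>] by (simp add: homeomorphic_map_P1_iff)
    define V where "V = {q \<in> topspace P1. \<phi> q \<in> chordal.mball (\<phi> p) (\<epsilon>/2)}"
    have V: "openin P1 V" unfolding V_def
      by (rule openin_continuous_map_preimage[OF c]) (rule chordal.openin_mball)
    let ?U = "homeo.mball \<phi> (\<epsilon>/2) \<times> V"
    have "openin (prod_topology homeo_top P1) ?U"
      using V homeo.openin_mball by (auto simp: openin_prod_Times_iff)
    moreover have "w \<in> ?U" using \<phi> e w_eq by (auto simp: V_def)
    moreover have "(case y of (\<phi>, p) \<Rightarrow> \<phi> p) \<in> chordal.mball (case w of (\<phi>, p) \<Rightarrow> \<phi> p) \<epsilon>" if "y \<in> ?U" for y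
    proof -
      obtain \<psi> q where y: "y = (\<psi>, q)" by force
      have "chordal (\<phi> p) (\<psi> q) \<le> chordal (\<phi> p) (\<phi> q) + chordal (\<phi> q) (\<psi> q)"
        by (rule chordal.triangle) auto
      also have "\<dots> < \<epsilon>"
        using chordal_le_sup_dist[of \<phi> q \<psi>] that by (auto simp: y V_def)
      finally show ?thesis by (simp add: w_eq y)
    qed
    ultimately show "\<exists>U. openin (prod_topology homeo_top P1) U \<and> w \<in> U \<and>
      (\<forall>y\<in>U. (case y of (\<phi>, p) \<Rightarrow> \<phi> p) \<in> chordal.mball (case w of (\<phi>, p) \<Rightarrow> \<phi> p) \<epsilon>)" by blast
  qed
  then show ?thesis using h by (auto simp: fam_def homeomorphic_map_P1_iff)
qed

lemma openin_quotient_top: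
  "openin (quotient_top H q) U \<longleftrightarrow> U \<subseteq> q ` topspace H \<and> openin H {x \<in> topspace H. q x \<in> U}"
proof -
  have "istopology (\<lambda>U. U \<subseteq> q ` topspace H \<and> openin H {x \<in> topspace H. q x \<in> U})"
    unfolding istopology_def
  proof (intro conjI allI impI)
    fix S T assume a: "S \<subseteq> q ` topspace H \<and> openin H {x \<in> topspace H. q x \<in> S}"
      "T \<subseteq> q ` topspace H \<and> openin H {x \<in> topspace H. q x \<in> T}"
    have "{x \<in> topspace H. q x \<in> S \<inter> T} = {x \<in> topspace H. q x \<in> S} \<inter> {x \<in> topspace H. q x \<in> T}" by auto
    then show "openin H {x \<in> topspace H. q x \<in> S \<inter> T}" using a by auto
    show "S \<inter> T \<subseteq> q ` topspace H" using a by auto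
  next
    fix K assume a: "\<forall>S\<in>K. S \<subseteq> q ` topspace H \<and> openin H {x \<in> topspace H. q x \<in> S}"
    have "{x \<in> topspace H. q x \<in> \<Union>K} = (\<Union>S\<in>K. {x \<in> topspace H. q x \<in> S})" by auto
    then show "openin H {x \<in> topspace H. q x \<in> \<Union>K}" using a by auto
    show "\<Union>K \<subseteq> q ` topspace H" using a by auto
  qed
  then show ?thesis by (simp add: quotient_top_def)
qed

lemma topspace_teich_top [simp]: "topspace (teich_top B) = teich B"
proof
  show "topspace (teich_top B) \<subseteq> teich B"
    by (metis openin_quotient_top openin_topspace teich_def teich_top_def topspace_homeo_top)
  have "{x \<in> homeo_plus. teich_class B x \<in> teich_class B ` homeo_plus} = homeo_plus" by auto
  then have "openin (teich_top B) (teich B)"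
    by (simp add: teich_top_def openin_quotient_top teich_def homeo.open_in_mspace)
  then show "teich B \<subseteq> topspace (teich_top B)" by (rule openin_subset)
qed

lemma continuous_map_teich_top:
  assumes F: "continuous_map homeo_top Z F" and G: "\<And>\<phi>. \<phi> \<in> homeo_plus \<Longrightarrow> F \<phi> = G (teich_class B \<phi>)"
  shows "continuous_map (teich_top B) Z G"
  unfolding continuous_map
proof (intro conjI allI impI)
  show "G ` topspace (teich_top B) \<subseteq> topspace Z"
    using F G by (auto simp: teich_def continuous_map_def Pi_iff)
  fix U assume U: "openin Z U"
  have "{x \<in> topspace homeo_top. F x \<in> U} = {\<phi> \<in> homeo_plus. teich_class B \<phi> \<in> {x \<in> teich B. G x \<in> U}}"
    using G by (auto simp: teich_def)
  then have "openin homeo_top {\<phi> \<in> homeo_plus. teich_class B \<phi> \<in> {x \<in> teich B. G x \<in> U}}"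
    using openin_continuous_map_preimage[OF F U] by simp
  then show "openin (teich_top B) {x \<in> topspace (teich_top B). G x \<in> U}"
    unfolding topspace_teich_top by (auto simp: teich_top_def openin_quotient_top teich_def)
qed

lemma mobius_id: "mobius id"
proof -
  have "rat_map [:0, 1:] 1 w = id w" for w
    by (cases w) (auto simp: rat_map_def)
  then have "rat_map [:0, 1:] 1 = id" by blast
  then show ?thesis
    unfolding mobius_def rational_map_deg_def by (intro exI[of _ "[:0, 1:]"] exI[of _ 1]) simp
qed

lemma teich_class_self:
  assumes "\<phi> \<in> homeo_plus"
  shows "\<phi> \<in> teich_class X \<phi>"
proof -
  have "isotopic_rel X (id \<circ> \<phi>) \<phi>"
    unfolding isotopic_rel_iff
    by (rule exI[of _ "\<lambda>_. \<phi>"]) (use assms in \<open>auto simp: homeo_plus_def intro: fam_const\<close>)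
  then have "teich_equiv X \<phi> \<phi>"
    unfolding teich_equiv_def using mobius_id by (intro exI[of _ id]) auto
  then show ?thesis using assms by (simp add: teich_class_def)
qed

lemma connected_power2_eq_1:
  fixes S :: "complex set"
  assumes "connected S" "\<And>z. z \<in> S \<Longrightarrow> z\<^sup>2 = 1" "1 \<in> S" "z \<in> S"
  shows "z = 1"
  by (rule continuous_sqrt_unique[OF assms(1), of "\<lambda>z. z" "\<lambda>_. 1" 1]) (use assms in auto)

text \<open>On the part of the deformation space where \<open>QQ = (1 - x) / x\<close>, the number \<open>exp (LL + KK)\<close> equals \<open>1/2\<close>,
  so that the branch of the logarithm \<open>LL + KK\<close> is an invariant of the connected component.\<close>

lemma (in marked_paths) infinite_components:
  fixes f
  assumes B: "{a0, a1, a2, a3, v} \<subseteq> B"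
    and Q: "\<And>\<phi> \<psi>. \<phi> \<in> homeo_plus \<Longrightarrow> \<psi> \<in> homeo_plus \<Longrightarrow> rational_map (\<phi> \<circ> f \<circ> inv \<psi>) \<Longrightarrow>
        teich_class A \<psi> = teich_class A \<phi> \<Longrightarrow> (QQ \<phi> * exp (KK \<phi>) / (1 - exp (KK \<phi>)))\<^sup>2 = 1"
    and ex: "\<And>n::nat. \<exists>\<phi>\<in>homeo_plus. teich_class B \<phi> \<in> Def_space B A f \<and>
        QQ \<phi> * exp (KK \<phi>) / (1 - exp (KK \<phi>)) = 1 \<and> LL \<phi> + KK \<phi> = c0 + 2 * of_nat n * pi * \<i>"
  shows "infinite (connected_components_of (subtopology (teich_top B) (Def_space B A f)))"
proof -
  \<comment> \<open>On the deformation space \<open>F1\<close> is 1 or -1 and records which of the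
    two roots (1 - x) / x and its negative \<open>QQ\<close> is.\<close>
  define F1 where "F1 \<phi> = QQ \<phi> * exp (KK \<phi>) / (1 - exp (KK \<phi>))" for \<phi>
  define F2 where "F2 \<phi> = LL \<phi> + KK \<phi>" for \<phi>
  \<comment> \<open>\<open>F1\<close> and \<open>F2\<close> are constant on Teichmueller classes, so
    an arbitrary representative serves to define them there.\<close>
  define rep where "rep \<tau> = (SOME \<phi>. \<phi> \<in> homeo_plus \<and> \<tau> = teich_class B \<phi>)" for \<tau>
  define D where "D = Def_space B A f"
  have inv: "QQ \<phi> = QQ \<psi> \<and> LL \<phi> = LL \<psi> \<and> KK \<phi> = KK \<psi>" if "\<psi> \<in> teich_class B \<phi>" for \<phi> \<psi>
    using invariants_teich_equiv[OF _ B] that by (simp add: teich_class_def)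
  have rep: "rep \<tau> \<in> homeo_plus \<and> \<tau> = teich_class B (rep \<tau>)" if "\<tau> \<in> teich B" for \<tau>
  proof -
    have "\<exists>\<phi>. \<phi> \<in> homeo_plus \<and> \<tau> = teich_class B \<phi>" using that by (auto simp: teich_def)
    then show ?thesis unfolding rep_def by (rule someI_ex)
  qed
  have rep_inv: "F1 (rep \<tau>) = F1 \<phi> \<and> F2 (rep \<tau>) = F2 \<phi>" if "\<phi> \<in> \<tau>" "\<tau> \<in> teich B" for \<tau> \<phi>
    using inv[of \<phi> "rep \<tau>"] rep[OF that(2)] that(1) by (simp add: F1_def F2_def)
  have self: "F1 (rep (teich_class B \<phi>)) = F1 \<phi> \<and> F2 (rep (teich_class B \<phi>)) = F2 \<phi>" if "\<phi> \<in> homeo_plus" for \<phi>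
    by (rule rep_inv) (use that teich_class_self in \<open>auto simp: teich_def\<close>)
  have x1: "exp (KK \<phi>) \<noteq> 1" if "\<phi> \<in> homeo_plus" for \<phi>
  proof
    assume 1: "exp (KK \<phi>) = 1"
    have e: "exp (KK \<phi>) = CR (\<phi> a3) (\<phi> a2) (\<phi> a0) (\<phi> a1)"
      using exp_invariants(2)[OF fam_homeo_top] that by simp
    have i: "\<phi> p = \<phi> q \<longleftrightarrow> p = q" for p q using inj_fam[OF fam_homeo_top] that by simp
    have "\<phi> a3 = \<phi> a2" by (rule CR_eq_1[of _ _ "\<phi> a0" "\<phi> a1"]) (use 1 e i distinct in auto)
    then show False using i distinct by auto
  qed
  have cont: "continuous_map homeo_top euclidean F1" "continuous_map homeo_top euclidean F2"
  proof -
    note c = continuous_invariants[OF fam_homeo_top]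
    have 1: "continuous_map homeo_top euclidean (\<lambda>_. 1 :: complex)" by simp
    show "continuous_map homeo_top euclidean F1" unfolding F1_def
      by (intro continuous_map_complex_algebra continuous_map_exp c 1) (use x1 in auto)
    show "continuous_map homeo_top euclidean F2" unfolding F2_def
      by (intro continuous_map_complex_algebra c)
  qed
  let ?T = "subtopology (teich_top B) D"
  have contT: "continuous_map ?T euclidean (\<lambda>\<tau>. F1 (rep \<tau>))" "continuous_map ?T euclidean (\<lambda>\<tau>. F2 (rep \<tau>))"
    by (intro continuous_map_from_subtopology continuous_map_teich_top[OF cont(1)] continuous_map_teich_top[OF cont(2)];
      use self in simp)+
  have DB: "D \<subseteq> teich B" by (auto simp: D_def Def_space_def)
  \<comment> \<open>Membership is witnessed by some \<phi> in the class, not by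
    \<open>rep \<tau>\<close>; \<open>rep_inv\<close> carries the value over.\<close>
  have F1D: "(F1 (rep \<tau>))\<^sup>2 = 1" if \<tau>: "\<tau> \<in> D" for \<tau>
  proof -
    obtain \<phi> \<psi> where 1: "\<phi> \<in> \<tau>" "\<psi> \<in> homeo_plus" "rational_map (\<phi> \<circ> f \<circ> inv \<psi>)" "teich_class A \<psi> = teich_class A \<phi>"
      using \<tau> by (auto simp: D_def Def_space_def)
    have "\<phi> \<in> homeo_plus" using 1(1) \<tau> DB by (auto simp: teich_def teich_class_def)
    then have "(F1 \<phi>)\<^sup>2 = 1" unfolding F1_def by (rule Q[OF _ 1(2-4)])
    then show ?thesis using rep_inv[OF 1(1)] \<tau> DB by auto
  qed
  have F2D: "exp (F2 (rep \<tau>)) = 1 / 2" if \<tau>: "\<tau> \<in> D" "F1 (rep \<tau>) = 1" for \<tau>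
  proof -
    have h: "rep \<tau> \<in> homeo_plus" using rep \<tau> DB by auto
    have "QQ (rep \<tau>) * exp (KK (rep \<tau>)) = 1 - exp (KK (rep \<tau>))"
      using \<tau>(2) x1[OF h] by (simp add: F1_def divide_eq_1_iff)
    then have 1: "(1 + QQ (rep \<tau>)) * exp (KK (rep \<tau>)) = 1" by (simp add: algebra_simps)
    have 2: "exp (LL (rep \<tau>)) = (1 + QQ (rep \<tau>)) / 2"
      by (rule exp_invariants(1)[OF fam_homeo_top]) (use h in simp)
    show ?thesis unfolding F2_def exp_add 2 times_divide_eq_left 1 ..
  qed
  have "\<exists>\<tau>. \<tau> \<in> D \<and> F1 (rep \<tau>) = 1 \<and> F2 (rep \<tau>) = c0 + 2 * of_nat n * pi * \<i>" for n
  proof -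
    obtain \<phi> where "\<phi> \<in> homeo_plus" "teich_class B \<phi> \<in> D" "F1 \<phi> = 1" "F2 \<phi> = c0 + 2 * of_nat n * pi * \<i>"
      using ex[of n] unfolding F1_def F2_def D_def by blast
    then show ?thesis using self[of \<phi>] by (intro exI[of _ "teich_class B \<phi>"]) simp
  qed
  then obtain \<tau> where \<tau>: "\<And>n. \<tau> n \<in> D" "\<And>n. F1 (rep (\<tau> n)) = 1" "\<And>n. F2 (rep (\<tau> n)) = c0 + 2 * of_nat n * pi * \<i>"
    by metis
  define C where "C n = connected_component_of_set ?T (\<tau> n)" for n
  have topT: "topspace ?T = D" using DB by auto
  have "inj C"
  proof (rule injI)
    fix m n assume mn: "C m = C n"
    have mem: "\<tau> k \<in> C k" for k unfolding C_def
      using \<tau>(1) topT by (simp add: connected_component_of_refl)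
    have con: "connectedin ?T (C n)" unfolding C_def by (rule connectedin_connected_component_of)
    have sub: "C n \<subseteq> D" unfolding C_def using connected_component_of_subset_topspace[of ?T] topT by metis
    have c1: "connected ((\<lambda>\<tau>. F1 (rep \<tau>)) ` C n)" "connected ((\<lambda>\<tau>. F2 (rep \<tau>)) ` C n)"
      using connectedin_continuous_map_image[OF contT(1) con] connectedin_continuous_map_image[OF contT(2) con]
      by simp_all
    \<comment> \<open>A component cannot change the sign of \<open>F1\<close>, so all of
      \<open>C n\<close> lies on the branch where \<open>exp (F2 _)\<close> is 1/2, and there
      \<open>F2\<close> has a discrete range.\<close>
    have F1: "F1 (rep \<sigma>) = 1" if "\<sigma> \<in> C n" for \<sigma>
    proof (rule connected_power2_eq_1[OF c1(1)])
      show "1 \<in> (\<lambda>\<tau>. F1 (rep \<tau>)) ` C n" using mem[of n] \<tau>(2)[of n] by (metis image_eqI)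
      show "z\<^sup>2 = 1" if "z \<in> (\<lambda>\<tau>. F1 (rep \<tau>)) ` C n" for z using that F1D sub by auto
    qed (use that in auto)
    have "F2 (rep (\<tau> m)) = F2 (rep (\<tau> n))"
      by (rule constant_if_exp_constant[OF c1(2), of "\<lambda>z. z" "1 / 2"]) (use F2D F1 sub mem[of m] mem[of n] mn in auto)
    then show "m = n" using \<tau>(3) by simp
  qed
  then have "infinite (range C)" using finite_imageD by blast
  moreover have "range C \<subseteq> connected_components_of ?T"
    using \<tau>(1) topT by (auto simp: connected_components_of_def C_def)
  ultimately show ?thesis unfolding D_def using finite_subset by blast
qed

section \<open>Homeomorphisms moving finitely many points\<close>

text \<open>A cone-shaped bump of radius \<delta> and height 1 around each \<open>p i\<close>
  carries the displacement of that point; the map is the identity plus a Lipschitz function of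
  compact support when \<open>I\<close> is finite.\<close>

definition push :: "'i set \<Rightarrow> real \<Rightarrow> ('i \<Rightarrow> complex) \<Rightarrow> ('i \<Rightarrow> complex) \<Rightarrow> complex \<Rightarrow> complex" where
  "push I \<delta> p p' z = z + (\<Sum>i\<in>I. of_real (max 0 (1 - cmod (z - p i) / \<delta>)) * (p' i - p i))"

text \<open>A preimage of \<open>w\<close> is a fixed point of z \<mapsto> w - g z, supplied by the
  Banach fixed point theorem.\<close>

lemma bij_id_plus_contraction:
  fixes g :: "complex \<Rightarrow> complex"
  assumes k: "0 \<le> k" "k < 1" and g: "\<And>z w. cmod (g z - g w) \<le> k * cmod (z - w)"
  shows "bij (\<lambda>z. z + g z)"
proof (rule bijI)
  show "inj (\<lambda>z. z + g z)"
  proof (rule injI)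
    fix z w assume "z + g z = w + g w"
    then have "z - w = g w - g z" by (simp add: algebra_simps)
    then have "cmod (z - w) \<le> k * cmod (z - w)" using g[of w z] by (metis norm_minus_commute)
    then have "(1 - k) * cmod (z - w) \<le> 0" by (simp add: algebra_simps)
    then show "z = w" using k by (simp add: mult_le_0_iff)
  qed
  show "surj (\<lambda>z. z + g z)"
    unfolding surj_def
  proof
    fix w
    have "\<exists>!z. w - g z = z"
      by (rule banach_fix_type[OF k]) (use g in \<open>auto simp: dist_norm norm_minus_commute\<close>)
    then obtain z where "w - g z = z" by auto
    then show "\<exists>z. w = z + g z" by (metis diff_add_cancel)
  qed
qed

text \<open>Each bump has Lipschitz constant 1/\<delta>, so the perturbation has constant at most
  the total displacement divided by \<delta>.\<close>

lemma bij_push: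
  assumes "finite I" and d: "\<delta> > 0" and close: "(\<Sum>i\<in>I. cmod (p' i - p i)) < \<delta>"
  shows "bij (push I \<delta> p p')"
proof -
  define g where "g z = (\<Sum>i\<in>I. of_real (max 0 (1 - cmod (z - p i) / \<delta>)) * (p' i - p i))" for z
  define k where "k = (\<Sum>i\<in>I. cmod (p' i - p i)) / \<delta>"
  have k: "0 \<le> k" "k < 1" using d close by (auto simp: k_def sum_nonneg)
  have "cmod (g z - g w) \<le> k * cmod (z - w)" for z w
  proof -
    have b: "\<bar>max 0 (1 - cmod (z - p i) / \<delta>) - max 0 (1 - cmod (w - p i) / \<delta>)\<bar> \<le> cmod (z - w) / \<delta>" for i
    proof -
      have "\<bar>cmod (z - p i) - cmod (w - p i)\<bar> \<le> cmod (z - w)"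
        using norm_triangle_ineq3[of "z - p i" "w - p i"] by simp
      then have "\<bar>cmod (z - p i) / \<delta> - cmod (w - p i) / \<delta>\<bar> \<le> cmod (z - w) / \<delta>"
        using d by (simp add: diff_divide_distrib[symmetric] divide_right_mono)
      then show ?thesis by linarith
    qed
    have "g z - g w = (\<Sum>i\<in>I. of_real (max 0 (1 - cmod (z - p i) / \<delta>) - max 0 (1 - cmod (w - p i) / \<delta>)) * (p' i - p i))"
      by (simp add: g_def sum_subtractf[symmetric] left_diff_distrib)
    also have "cmod \<dots> \<le> (\<Sum>i\<in>I. cmod (z - w) / \<delta> * cmod (p' i - p i))"
    proof (rule sum_norm_le)
      fix i assume "i \<in> I"
      show "cmod (of_real (max 0 (1 - cmod (z - p i) / \<delta>) - max 0 (1 - cmod (w - p i) / \<delta>)) * (p' i - p i))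
        \<le> cmod (z - w) / \<delta> * cmod (p' i - p i)"
        unfolding norm_mult norm_of_real by (rule mult_right_mono[OF b]) simp
    qed
    also have "\<dots> = k * cmod (z - w)" by (simp add: k_def sum_distrib_left sum_divide_distrib mult.commute)
    finally show ?thesis .
  qed
  from bij_id_plus_contraction[OF k this] show ?thesis by (simp add: push_def[abs_def] g_def)
qed

lemma push_at:
  assumes "finite I" "\<delta> > 0" "i \<in> I" and sep: "\<And>j. j \<in> I \<Longrightarrow> j \<noteq> i \<Longrightarrow> \<delta> \<le> cmod (p i - p j)"
  shows "push I \<delta> p p' (p i) = p' i"
proof -
  have "(\<Sum>j\<in>I. of_real (max 0 (1 - cmod (p i - p j) / \<delta>)) * (p' j - p j)) = (\<Sum>j\<in>I. if j = i then p' i - p i else 0)"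
    by (rule sum.cong) (use sep assms(2) in \<open>force simp: max_def\<close>)+
  then show ?thesis using assms(1,3) by (simp add: push_def)
qed

lemma push_far:
  assumes "\<delta> > 0" "\<And>i. i \<in> I \<Longrightarrow> \<delta> \<le> cmod (z - p i)"
  shows "push I \<delta> p p' z = z"
proof -
  have "(\<Sum>j\<in>I. of_real (max 0 (1 - cmod (z - p j) / \<delta>)) * (p' j - p j)) = 0"
    by (rule sum.neutral) (use assms in \<open>force simp: max_def\<close>)
  then show ?thesis by (simp add: push_def)
qed

lemma push_same: "(\<And>i. i \<in> I \<Longrightarrow> p' i = p i) \<Longrightarrow> push I \<delta> p p' z = z"
  by (simp add: push_def)

text \<open>Negation permutes the centres together with their displacements, so the sum is only
  reindexed, with a change of sign.\<close>

lemma push_odd: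
  assumes m: "bij_betw m I I" and p: "\<And>i. i \<in> I \<Longrightarrow> p (m i) = - p i" "\<And>i. i \<in> I \<Longrightarrow> p' (m i) = - p' i"
  shows "push I \<delta> p p' (- z) = - push I \<delta> p p' z"
proof -
  have "(\<Sum>i\<in>I. of_real (max 0 (1 - cmod (- z - p i) / \<delta>)) * (p' i - p i))
     = (\<Sum>i\<in>I. of_real (max 0 (1 - cmod (- z - p (m i)) / \<delta>)) * (p' (m i) - p (m i)))"
    by (rule sum.reindex_bij_betw[OF m, symmetric])
  also have "\<dots> = (\<Sum>i\<in>I. - (of_real (max 0 (1 - cmod (z - p i) / \<delta>)) * (p' i - p i)))"
  proof (rule sum.cong[OF refl])
    fix i assume i: "i \<in> I"
    have "cmod (- z - p (m i)) = cmod (z - p i)" using p(1)[OF i] by (simp add: norm_minus_commute)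
    then show "of_real (max 0 (1 - cmod (- z - p (m i)) / \<delta>)) * (p' (m i) - p (m i))
      = - (of_real (max 0 (1 - cmod (z - p i) / \<delta>)) * (p' i - p i))"
      using p[OF i] by (simp add: algebra_simps)
  qed
  finally show ?thesis by (simp add: push_def sum_negf)
qed

lemma continuous_on_push:
  assumes "\<And>i. i \<in> I \<Longrightarrow> continuous_on S (\<lambda>s. p s i)" "\<And>i. i \<in> I \<Longrightarrow> continuous_on S (\<lambda>s. p' s i)"
    and "continuous_on S \<zeta>" "\<delta> > 0"
  shows "continuous_on S (\<lambda>s. push I \<delta> (p s) (p' s) (\<zeta> s))"
  unfolding push_def using assms by (intro continuous_intros) auto

text \<open>A long motion is cut into pushes short enough to be bijective. The number of factors is
  a separate argument, so that it can stay fixed while the configurations vary with a parameter;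
  this keeps the composite continuous.\<close>

fun chain :: "'i set \<Rightarrow> real \<Rightarrow> (nat \<Rightarrow> 'i \<Rightarrow> complex) \<Rightarrow> nat \<Rightarrow> complex \<Rightarrow> complex" where
  "chain I \<delta> a 0 z = z"
| "chain I \<delta> a (Suc n) z = push I \<delta> (a n) (a (Suc n)) (chain I \<delta> a n z)"

lemma bij_chain:
  assumes "finite I" "\<delta> > 0" "\<And>j. j < n \<Longrightarrow> (\<Sum>i\<in>I. cmod (a (Suc j) i - a j i)) < \<delta>"
  shows "bij (chain I \<delta> a n)"
  using assms(3)
proof (induction n)
  case 0
  then show ?case by (simp add: bij_def inj_def surj_def)
next
  case (Suc n)
  have "bij (push I \<delta> (a n) (a (Suc n)) \<circ> chain I \<delta> a n)"
    by (rule bij_comp) (use Suc bij_push[OF assms(1,2)] in auto)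
  then show ?case by (simp add: comp_def)
qed

lemma chain_at:
  assumes "finite I" "\<delta> > 0" "i \<in> I"
    and "\<And>j i'. j < n \<Longrightarrow> i' \<in> I \<Longrightarrow> i' \<noteq> i \<Longrightarrow> \<delta> \<le> cmod (a j i - a j i')"
  shows "chain I \<delta> a n (a 0 i) = a n i"
  using assms(4) by (induction n) (auto simp: push_at[OF assms(1-3)])

lemma chain_far:
  assumes "\<delta> > 0" "\<And>j i. j < n \<Longrightarrow> i \<in> I \<Longrightarrow> cmod (a j i) \<le> R" "cmod z \<ge> R + \<delta>"
  shows "chain I \<delta> a n z = z"
  using assms(2)
proof (induction n)
  case (Suc n)
  have "\<delta> \<le> cmod (z - a n i)" if "i \<in> I" for i
    using Suc.prems[of n i] that assms(3) norm_triangle_ineq2[of z "a n i"] by auto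
  then show ?case using Suc assms(1) by (simp add: push_far)
qed simp

lemma chain_same: "(\<And>j i. j < n \<Longrightarrow> i \<in> I \<Longrightarrow> a (Suc j) i = a j i) \<Longrightarrow> chain I \<delta> a n z = z"
  by (induction n) (auto simp: push_same)

lemma chain_odd:
  assumes "bij_betw m I I" "\<And>j i. j \<le> n \<Longrightarrow> i \<in> I \<Longrightarrow> a j (m i) = - a j i"
  shows "chain I \<delta> a n (- z) = - chain I \<delta> a n z"
  using assms(2) by (induction n) (auto simp: push_odd[OF assms(1)])

lemma continuous_on_chain:
  assumes "\<And>j i. j \<le> n \<Longrightarrow> i \<in> I \<Longrightarrow> continuous_on S (\<lambda>s. a s j i)" "continuous_on S \<zeta>" "\<delta> > 0"
  shows "continuous_on S (\<lambda>s. chain I \<delta> (a s) n (\<zeta> s))"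
  using assms(1)
proof (induction n)
  case (Suc n)
  then show ?case by (auto intro!: continuous_on_push assms(3))
qed (use assms(2) in auto)

subsection \<open>Extension to the sphere\<close>

lemma continuous_map_Some:
  "continuous_map Y euclidean g \<Longrightarrow> continuous_map Y P1 (\<lambda>y. Some (g y))"
  using continuous_map_proj[of Y g "\<lambda>_. 1"] by simp

lemma continuous_map_hx:
  assumes "continuous_map Y P1 u" "\<And>y. y \<in> topspace Y \<Longrightarrow> u y \<noteq> None"
  shows "continuous_map Y euclidean (\<lambda>y. hx (u y))"
proof (rule continuous_map_eq[of _ _ "\<lambda>y. CR (u y) (Some 1) (Some 0) None"])
  show "continuous_map Y euclidean (\<lambda>y. CR (u y) (Some 1) (Some 0) None)"
    by (rule continuous_map_CR) (use assms in auto)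
  show "CR (u y) (Some 1) (Some 0) None = hx (u y)" if "y \<in> topspace Y" for y
    using assms(2)[OF that] by (auto simp: CR_def br_def)
qed

lemma bij_map_option:
  assumes "bij g" shows "bij (map_option g)"
proof (rule bijI)
  show "inj (map_option g)" using assms by (simp add: bij_def option.inj_map)
  have "p \<in> range (map_option g)" for p
  proof (cases p)
    case None then show ?thesis by (metis option.simps(8) rangeI)
  next
    case (Some z)
    then show ?thesis using assms by (metis bij_pointE option.simps(9) rangeI)
  qed
  then show "surj (map_option g)" by blast
qed

text \<open>Continuity at infinity is automatic, since outside a fixed ball every member is the
  identity; the two open sets of the proof are the finite plane and the complement of that
  ball.\<close>

lemma fam_map_option:
  fixes G :: "'a::topological_space \<Rightarrow> complex \<Rightarrow> complex"
  assumes cont: "continuous_on (X \<times> UNIV) (\<lambda>(x, z). G x z)" and bij: "\<And>x. x \<in> X \<Longrightarrow> bij (G x)"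
    and far: "\<And>x z. x \<in> X \<Longrightarrow> R \<le> cmod z \<Longrightarrow> G x z = z"
  shows "fam (top_of_set X) (\<lambda>x. map_option (G x))"
proof -
  let ?P = "prod_topology (top_of_set X) P1"
  let ?g = "\<lambda>(x, p). map_option (G x) p"
  have closed: "closedin P1 (Some ` cball 0 R)"
  proof (rule compactin_imp_closedin[OF Hausdorff_space_P1])
    have "continuous_map (top_of_set (cball 0 R)) P1 Some"
      by (rule continuous_map_Some) simp
    moreover have "compactin (top_of_set (cball (0::complex) R)) (cball 0 R)" by (simp add: compactin_subtopology)
    ultimately show "compactin P1 (Some ` cball 0 R)" using image_compactin by blast
  qed
  have "closedin P1 {None}" using Hausdorff_imp_t1_space[OF Hausdorff_space_P1] by (simp add: closedin_t1_singleton)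
  then have "openin P1 (- {None})" by (simp add: closedin_def Compl_eq_Diff_UNIV)
  then have o1: "openin ?P (X \<times> (- {None}))"
    by (auto simp: openin_prod_Times_iff)
  have "openin P1 (- (Some ` cball 0 R))" using closed by (simp add: closedin_def Compl_eq_Diff_UNIV)
  then have o2: "openin ?P (X \<times> (- (Some ` cball 0 R)))"
    by (auto simp: openin_prod_Times_iff)
  have c1: "continuous_map (subtopology ?P (X \<times> (- {None}))) P1 ?g"
  proof -
    let ?S = "subtopology ?P (X \<times> (- {None}))"
    have 1: "continuous_map ?S euclidean (\<lambda>w. hx (snd w))"
      by (rule continuous_map_hx) (auto intro: continuous_map_from_subtopology continuous_map_snd)
    have 2: "continuous_map ?S (top_of_set X) fst"
      by (intro continuous_map_from_subtopology continuous_map_fst)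
    have 3: "continuous_map ?S (prod_topology (top_of_set X) euclidean) (\<lambda>w. (fst w, hx (snd w)))"
      by (rule continuous_map_pairedI) (use 1 2 in auto)
    have 4: "prod_topology (top_of_set X) (euclidean :: complex topology) = top_of_set (X \<times> UNIV)"
      by (metis prod_topology_subtopology_eu subtopology_UNIV)
    have 5: "continuous_map (prod_topology (top_of_set X) euclidean) euclidean (\<lambda>(x, z). G x z)"
      unfolding 4 using cont by simp
    have "continuous_map ?S P1 (\<lambda>w. Some (G (fst w) (hx (snd w))))"
      using continuous_map_compose[OF 3 5] by (intro continuous_map_Some) (simp add: o_def)
    moreover have "Some (G (fst w) (hx (snd w))) = ?g w" if "w \<in> topspace ?S" for w
      using that by (cases w; cases "snd w") auto
    ultimately show ?thesis by (rule continuous_map_eq)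
  qed
  have c2: "continuous_map (subtopology ?P (X \<times> (- (Some ` cball 0 R)))) P1 ?g"
  proof (rule continuous_map_eq[of _ _ snd])
    show "continuous_map (subtopology ?P (X \<times> (- (Some ` cball 0 R)))) P1 snd"
      by (intro continuous_map_from_subtopology continuous_map_snd)
    fix w assume "w \<in> topspace (subtopology ?P (X \<times> (- (Some ` cball 0 R))))"
    then show "snd w = ?g w" using far by (cases "snd w") (auto simp: image_iff)
  qed
  have "continuous_map ?P P1 ?g"
  proof (rule continuous_map_locally)
    fix w assume "w \<in> topspace ?P"
    then show "\<exists>U. openin ?P U \<and> w \<in> U \<and> continuous_map (subtopology ?P U) P1 ?g"
      using o1 o2 c1 c2 by (cases "snd w = None") (fastforce simp: mem_Times_iff image_iff)+
  qed
  then show ?thesis using bij by (auto simp: fam_def bij_map_option)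
qed

section \<open>Homeomorphisms following a moving finite configuration\<close>

lemma configuration_mesh:
  fixes p :: "'x::metric_space \<Rightarrow> 'i \<Rightarrow> complex"
  assumes I: "finite I" and K: "compact K" and cont: "\<And>i. i \<in> I \<Longrightarrow> continuous_on K (\<lambda>x. p x i)"
    and dist: "\<And>x i j. x \<in> K \<Longrightarrow> i \<in> I \<Longrightarrow> j \<in> I \<Longrightarrow> i \<noteq> j \<Longrightarrow> p x i \<noteq> p x j"
  obtains \<delta> R \<eta> where "\<delta> > 0" "\<eta> > 0"
    "\<And>x i j. x \<in> K \<Longrightarrow> i \<in> I \<Longrightarrow> j \<in> I \<Longrightarrow> i \<noteq> j \<Longrightarrow> \<delta> \<le> cmod (p x i - p x j)"
    "\<And>x i. x \<in> K \<Longrightarrow> i \<in> I \<Longrightarrow> cmod (p x i) \<le> R"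
    "\<And>x y. x \<in> K \<Longrightarrow> y \<in> K \<Longrightarrow> dist y x < \<eta> \<Longrightarrow> (\<Sum>i\<in>I. cmod (p y i - p x i)) < \<delta>"
proof -
  have "\<exists>d>0. \<forall>x\<in>K. d \<le> cmod (p x i - p x j)" if ij: "i \<in> I" "j \<in> I" "i \<noteq> j" for i j
  proof (cases "K = {}")
    case False
    have "continuous_on K (\<lambda>x. cmod (p x i - p x j))" using cont ij by (intro continuous_intros) auto
    from continuous_attains_inf[OF K False this] obtain x0 where x0: "x0 \<in> K"
      "\<And>x. x \<in> K \<Longrightarrow> cmod (p x0 i - p x0 j) \<le> cmod (p x i - p x j)" by blast
    then show ?thesis using dist[OF x0(1) ij] by (intro exI[of _ "cmod (p x0 i - p x0 j)"]) auto
  qed (auto intro: exI[of _ 1])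
  then obtain d where d: "\<And>i j. i \<in> I \<Longrightarrow> j \<in> I \<Longrightarrow> i \<noteq> j \<Longrightarrow> d i j > 0 \<and> (\<forall>x\<in>K. d i j \<le> cmod (p x i - p x j))"
    by metis
  \<comment> \<open>The extra element 1 keeps the minimum meaningful when \<open>I\<close> has fewer
    than two elements.\<close>
  define \<delta> where "\<delta> = Min (insert 1 ((\<lambda>(i, j). d i j) ` {(i, j). i \<in> I \<and> j \<in> I \<and> i \<noteq> j}))"
  have fin: "finite (insert 1 ((\<lambda>(i, j). d i j) ` {(i, j). i \<in> I \<and> j \<in> I \<and> i \<noteq> j}))"
    by (intro finite.insertI finite_imageI finite_subset[OF _ finite_cartesian_product[OF I I]]) auto
  have \<delta>: "\<delta> > 0" unfolding \<delta>_def by (subst Min_gr_iff[OF fin]) (use d in auto)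
  have sep: "\<delta> \<le> cmod (p x i - p x j)" if "x \<in> K" "i \<in> I" "j \<in> I" "i \<noteq> j" for x i j
  proof -
    have "\<delta> \<le> d i j" unfolding \<delta>_def by (rule Min_le[OF fin]) (use that in auto)
    then show ?thesis using d[OF that(2-4)] that(1) by force
  qed
  have "\<exists>R. \<forall>x\<in>K. cmod (p x i) \<le> R" if "i \<in> I" for i
    using compact_imp_bounded[OF compact_continuous_image[OF cont[OF that] K]] by (auto simp: bounded_iff)
  then obtain r where r: "\<And>i x. i \<in> I \<Longrightarrow> x \<in> K \<Longrightarrow> cmod (p x i) \<le> r i" by metis
  have R: "cmod (p x i) \<le> Max (insert 0 (r ` I))" if "x \<in> K" "i \<in> I" for x i
    by (rule order_trans[OF r[OF that(2,1)] Max_ge]) (use I that in auto)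
  \<comment> \<open>\<open>S\<close> vanishes on the diagonal, so its uniform continuity bounds the
    total displacement between nearby parameters by \<delta>.\<close>
  define S where "S w = (\<Sum>i\<in>I. cmod (p (snd w) i - p (fst w) i))" for w
  have "continuous_on (K \<times> K) S" unfolding S_def
    by (intro continuous_intros continuous_on_compose2[OF cont]) auto
  then have "uniformly_continuous_on (K \<times> K) S"
    by (rule compact_uniformly_continuous) (use K in \<open>simp add: compact_Times\<close>)
  then obtain \<eta> where \<eta>: "\<eta> > 0" "\<And>w w'. w \<in> K \<times> K \<Longrightarrow> w' \<in> K \<times> K \<Longrightarrow> dist w' w < \<eta> \<Longrightarrow> dist (S w') (S w) < \<delta>"
    by (rule uniformly_continuous_onE[OF _ \<delta>]) blast
  have small: "(\<Sum>i\<in>I. cmod (p y i - p x i)) < \<delta>" if "x \<in> K" "y \<in> K" "dist y x < \<eta>" for x y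
  proof -
    have "dist (S (x, y)) (S (x, x)) < \<delta>" by (rule \<eta>(2)) (use that in \<open>auto simp: dist_Pair_Pair\<close>)
    then show ?thesis by (simp add: S_def dist_real_def)
  qed
  from \<delta> \<eta>(1) sep R small show ?thesis by (rule that)
qed

lemma unit_interval_mesh:
  assumes "\<eta> > (0::real)"
  obtains u :: "nat \<Rightarrow> real" and n where "u 0 = 0" "u n = 1" "\<And>j. j \<le> n \<Longrightarrow> u j \<in> {0..1}"
    "\<And>j. j < n \<Longrightarrow> \<bar>u (Suc j) - u j\<bar> < \<eta>"
proof -
  obtain n :: nat where n: "inverse (of_nat (Suc n)) < \<eta>" using reals_Archimedean[OF assms] by blast
  define u where "u j = real j / real (Suc n)" for j
  have "u (Suc j) - u j = inverse (of_nat (Suc n))" for j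
    by (simp only: u_def of_nat_Suc add_divide_distrib inverse_eq_divide)
  then have "\<bar>u (Suc j) - u j\<bar> < \<eta>" for j using n by (simp only: abs_of_nonneg) simp
  moreover have "u j \<in> {0..1}" if "j \<le> Suc n" for j
    using that by (auto simp: u_def)
  moreover have "u 0 = 0" "u (Suc n) = 1" by (auto simp: u_def)
  ultimately show ?thesis using that[of u "Suc n"] by blast
qed

text \<open>Isotopy extension for finitely many points. The involution \<open>m\<close> records that
  the configuration is symmetric under sign, and then so is the isotopy; this is what later lets it
  descend through squaring.\<close>

lemma configuration_path_follow:
  fixes p :: "real \<Rightarrow> 'i \<Rightarrow> complex"
  assumes I: "finite I" and cont: "\<And>i. i \<in> I \<Longrightarrow> continuous_on {0..1} (\<lambda>t. p t i)"
    and dist: "\<And>t i j. t \<in> {0..1} \<Longrightarrow> i \<in> I \<Longrightarrow> j \<in> I \<Longrightarrow> i \<noteq> j \<Longrightarrow> p t i \<noteq> p t j"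
    and m: "bij_betw m I I" "\<And>t i. t \<in> {0..1} \<Longrightarrow> i \<in> I \<Longrightarrow> p t (m i) = - p t i"
  obtains G R where "continuous_on ({0..1} \<times> UNIV) (\<lambda>(t, z). G t z)" "\<And>t. t \<in> {0..1} \<Longrightarrow> bij (G t)"
    "\<And>t z. t \<in> {0..1} \<Longrightarrow> R \<le> cmod z \<Longrightarrow> G t z = z" "\<And>z. G 0 z = z"
    "\<And>t i. t \<in> {0..1} \<Longrightarrow> i \<in> I \<Longrightarrow> G t (p 0 i) = p t i" "\<And>t z. t \<in> {0..1} \<Longrightarrow> G t (- z) = - G t z"
proof -
  obtain \<delta> R \<eta> where mesh: "\<delta> > 0" "\<eta> > 0"
    "\<And>t i j. t \<in> {0..1} \<Longrightarrow> i \<in> I \<Longrightarrow> j \<in> I \<Longrightarrow> i \<noteq> j \<Longrightarrow> \<delta> \<le> cmod (p t i - p t j)"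
    "\<And>t i. t \<in> {0..1} \<Longrightarrow> i \<in> I \<Longrightarrow> cmod (p t i) \<le> R"
    "\<And>t s. t \<in> {0..1} \<Longrightarrow> s \<in> {0..1} \<Longrightarrow> dist s t < \<eta> \<Longrightarrow> (\<Sum>i\<in>I. cmod (p s i - p t i)) < \<delta>"
    by (rule configuration_mesh[OF I compact_Icc cont dist]) blast+
  obtain u n where u: "u 0 = 0" "u n = 1" "\<And>j. j \<le> n \<Longrightarrow> u j \<in> {0..1}" "\<And>j. j < n \<Longrightarrow> \<bar>u (Suc j) - u j\<bar> < \<eta>"
    using unit_interval_mesh[OF mesh(2)] by blast
  let ?N = n
  \<comment> \<open>The mesh is rescaled to run from 0 to t, with the same number of steps for every
    t. At t = 0 all pushes are trivial.\<close>
  define a where "a t j = p (t * u j)" for t j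
  have dom: "t * u j \<in> {0..1}" if "t \<in> {0..1}" "j \<le> ?N" for t j
    using that u(3)[OF that(2)] by (auto intro: mult_le_one)
  define G where "G t = chain I \<delta> (a t) ?N" for t
  have step: "(\<Sum>i\<in>I. cmod (a t (Suc j) i - a t j i)) < \<delta>" if "t \<in> {0..1}" "j < ?N" for t j
    unfolding a_def
  proof (rule mesh(5)[OF dom dom])
    have "\<bar>t * u (Suc j) - t * u j\<bar> = t * \<bar>u (Suc j) - u j\<bar>"
      using that by (simp add: right_diff_distrib[symmetric] abs_mult)
    also have "\<dots> \<le> \<bar>u (Suc j) - u j\<bar>" using that by (intro mult_left_le_one_le) auto
    also have "\<dots> < \<eta>" using u(4) that by simp
    finally show "dist (t * u (Suc j)) (t * u j) < \<eta>" by (simp add: dist_real_def)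
  qed (use that in auto)
  show ?thesis
  proof (rule that[of G "R + \<delta>"])
    show "continuous_on ({0..1} \<times> UNIV) (\<lambda>(t, z). G t z)"
      unfolding G_def case_prod_unfold a_def
      by (intro continuous_on_chain mesh(1) continuous_intros continuous_on_compose2[OF cont])
        (use dom in auto)
    show "bij (G t)" if "t \<in> {0..1}" for t
      unfolding G_def by (rule bij_chain[OF I mesh(1)]) (use step that in auto)
    show "G t z = z" if "t \<in> {0..1}" "R + \<delta> \<le> cmod z" for t z
      unfolding G_def by (rule chain_far[OF mesh(1) _ that(2)]) (use mesh(4) dom that in \<open>auto simp: a_def\<close>)
    show "G 0 z = z" for z unfolding G_def by (rule chain_same) (simp add: a_def)
    show "G t (p 0 i) = p t i" if "t \<in> {0..1}" "i \<in> I" for t i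
      using chain_at[OF I mesh(1) that(2), of ?N "a t"] mesh(3) dom[OF that(1)] that(2)
      by (simp add: a_def G_def u)
    show "G t (- z) = - G t z" if "t \<in> {0..1}" for t z
      unfolding G_def by (rule chain_odd[OF m(1)]) (use m(2) dom[OF that] in \<open>auto simp: a_def\<close>)
  qed
qed

text \<open>Let \<open>G (s, t)\<close> push the configuration at (s, t) to the one at (s, 1), which
  is \<open>b\<close>. Then \<open>G (0, t)\<close> composed with \<open>\<Psi> t\<close> fixes
  every \<open>b i\<close>, which joins \<open>\<Psi> 1\<close> to \<open>G (0, 0)\<close>; and
  \<open>G (s, 0)\<close> fixes every \<open>b i\<close> and joins \<open>G (0, 0)\<close> to the
  identity, the loop at s = 1 being constant.\<close>

lemma isotopic_id_if_nullhomotopic: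
  fixes h :: "real \<times> real \<Rightarrow> 'i \<Rightarrow> complex"
  assumes I: "finite I" and cont: "\<And>i. i \<in> I \<Longrightarrow> continuous_on ({0..1} \<times> {0..1}) (\<lambda>w. h w i)"
    and dist: "\<And>w i j. w \<in> {0..1} \<times> {0..1} \<Longrightarrow> i \<in> I \<Longrightarrow> j \<in> I \<Longrightarrow> i \<noteq> j \<Longrightarrow> h w i \<noteq> h w j"
    and null: "\<And>t i. t \<in> {0..1} \<Longrightarrow> i \<in> I \<Longrightarrow> h (1, t) i = b i"
      "\<And>s i. s \<in> {0..1} \<Longrightarrow> i \<in> I \<Longrightarrow> h (s, 0) i = b i" "\<And>s i. s \<in> {0..1} \<Longrightarrow> i \<in> I \<Longrightarrow> h (s, 1) i = b i"
    and \<Psi>: "fam I01 \<Psi>" "\<Psi> 0 = id" "\<And>t i. t \<in> {0..1} \<Longrightarrow> i \<in> I \<Longrightarrow> \<Psi> t (Some (b i)) = Some (h (0, t) i)"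
      "\<And>t. t \<in> {0..1} \<Longrightarrow> \<Psi> t None = None"
  shows "isotopic_rel (insert None ((\<lambda>i. Some (b i)) ` I)) (\<Psi> 1) id"
proof -
  let ?K = "{0..1} \<times> {0..1} :: (real \<times> real) set"
  let ?X = "insert None ((\<lambda>i. Some (b i)) ` I)"
  have K: "compact ?K" by (intro compact_Times compact_Icc)
  obtain \<delta> R \<eta> where mesh: "\<delta> > 0" "\<eta> > 0"
    "\<And>w i j. w \<in> ?K \<Longrightarrow> i \<in> I \<Longrightarrow> j \<in> I \<Longrightarrow> i \<noteq> j \<Longrightarrow> \<delta> \<le> cmod (h w i - h w j)"
    "\<And>w i. w \<in> ?K \<Longrightarrow> i \<in> I \<Longrightarrow> cmod (h w i) \<le> R"
    "\<And>w w'. w \<in> ?K \<Longrightarrow> w' \<in> ?K \<Longrightarrow> dist w' w < \<eta> \<Longrightarrow> (\<Sum>i\<in>I. cmod (h w' i - h w i)) < \<delta>"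
    by (rule configuration_mesh[OF I K cont dist]) blast+
  obtain u n where u: "u 0 = 0" "u n = 1" "\<And>j. j \<le> n \<Longrightarrow> u j \<in> {0..1}" "\<And>j. j < n \<Longrightarrow> \<bar>u (Suc j) - u j\<bar> < \<eta>"
    using unit_interval_mesh[OF mesh(2)] by blast
  let ?N = n
  \<comment> \<open>The mesh now runs from t to 1, again with a number of steps independent of t, so
    that the chain is trivial at t = 1.\<close>
  define c where "c t j = t + (1 - t) * u j" for t j
  have dom: "c t j \<in> {0..1}" if "t \<in> {0..1}" "j \<le> ?N" for t j
  proof -
    have "(1 - t) * u j \<le> (1 - t) * 1" using that u(3)[OF that(2)] by (intro mult_left_mono) auto
    moreover have "0 \<le> (1 - t) * u j" using that u(3)[OF that(2)] by simp
    ultimately show ?thesis using that by (simp add: c_def)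
  qed
  have c_simps: "c t 0 = t" "c t ?N = 1" "c 1 j = 1" for t j by (auto simp: c_def u)
  define a where "a w j = h (fst w, c (snd w) j)" for w :: "real \<times> real" and j :: nat
  define G where "G w = chain I \<delta> (a w) ?N" for w
  have step: "(\<Sum>i\<in>I. cmod (a w (Suc j) i - a w j i)) < \<delta>" if "w \<in> ?K" "j < ?N" for w j
    unfolding a_def
  proof (rule mesh(5))
    define t where "t = snd w"
    have t: "t \<in> {0..1}" using that by (auto simp: t_def)
    have "\<bar>c t (Suc j) - c t j\<bar> = (1 - t) * \<bar>u (Suc j) - u j\<bar>"
      using t by (simp add: c_def right_diff_distrib[symmetric] abs_mult)
    also have "\<dots> \<le> \<bar>u (Suc j) - u j\<bar>" using t by (intro mult_left_le_one_le) auto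
    also have "\<dots> < \<eta>" using u(4) that by simp
    finally show "dist (fst w, c (snd w) (Suc j)) (fst w, c (snd w) j) < \<eta>"
      by (simp add: dist_Pair_Pair dist_real_def t_def[symmetric])
  qed (use that dom in auto)
  have contG: "continuous_on (?K \<times> UNIV) (\<lambda>(w, z). G w z)"
    unfolding G_def case_prod_unfold a_def c_def
    by (intro continuous_on_chain mesh(1) continuous_intros continuous_on_compose2[OF cont])
      (use dom in \<open>auto simp: c_def\<close>)
  have bijG: "bij (G w)" if "w \<in> ?K" for w
    unfolding G_def by (rule bij_chain[OF I mesh(1)]) (use step that in auto)
  have farG: "G w z = z" if "w \<in> ?K" "R + \<delta> \<le> cmod z" for w z
    unfolding G_def by (rule chain_far[OF mesh(1) _ that(2)]) (use mesh(4) dom that in \<open>auto simp: a_def\<close>)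
  have famG: "fam (top_of_set ?K) (\<lambda>w. map_option (G w))"
    by (rule fam_map_option[OF contG bijG farG])
  have atG: "G w (h w i) = h (fst w, 1) i" if "w \<in> ?K" "i \<in> I" for w i
  proof -
    have "G w (a w 0 i) = a w ?N i" unfolding G_def
      by (rule chain_at[OF I mesh(1) that(2)]) (use mesh(3) dom that in \<open>auto simp: a_def\<close>)
    then show ?thesis by (simp add: a_def c_simps)
  qed
  have "G (s, 1) z = z" for s z
    unfolding G_def by (rule chain_same) (simp add: a_def c_simps)
  then have idG1: "G (s, 1) = (\<lambda>z. z)" for s by blast
  have "G (1, 0) z = z" for z
    unfolding G_def by (rule chain_same) (use dom[of 0] null(1) in \<open>auto simp: a_def\<close>)
  then have idG2: "G (1, 0) = (\<lambda>z. z)" by blast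
  have iso1: "isotopic_rel ?X (\<Psi> 1) (map_option (G (0, 0)))"
    unfolding isotopic_rel_iff
  proof (intro exI conjI ballI)
    \<comment> \<open>Time is reversed: at 0 the first factor is trivial and \<open>\<Psi> 1\<close>
      remains, at 1 the second factor is the identity.\<close>
    let ?H = "\<lambda>t. map_option (G (0, 1 - t)) \<circ> \<Psi> (1 - t)"
    show "fam I01 ?H"
      by (intro fam_compose fam_reparam[OF famG] fam_reparam[OF \<Psi>(1)])
        (auto simp: continuous_map_in_subtopology intro!: continuous_intros)
    show "?H 0 = \<Psi> 1" by (simp add: idG1 fun_eq_iff option.map_ident)
    show "?H 1 = map_option (G (0, 0))" using \<Psi>(2) by simp
    fix t x assume t: "t \<in> {0..1::real}" and x: "x \<in> ?X"
    have b: "G (0, u) (h (0, u) i) = b i" if "u \<in> {0..1}" "i \<in> I" for u i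
      using atG[of "(0, u)" i] that null(3)[of 0 i] by simp
    have b0: "G (0, 0) (b i) = b i" if "i \<in> I" for i using b[of 0 i] null(2)[of 0 i] that by simp
    have t': "1 - t \<in> {0..1}" using t by auto
    show "?H t x = map_option (G (0, 0)) x"
    proof (cases x)
      case None
      then show ?thesis using \<Psi>(4)[OF t'] by simp
    next
      case (Some z)
      then obtain i where i: "i \<in> I" "x = Some (b i)" using x by auto
      show ?thesis using \<Psi>(3)[OF t' i(1)] b[OF t' i(1)] b0[OF i(1)] by (simp add: i(2))
    qed
  qed
  have iso2: "isotopic_rel ?X (map_option (G (0, 0))) id"
    unfolding isotopic_rel_iff
  proof (intro exI conjI ballI)
    let ?H = "\<lambda>s. map_option (G (s, 0))"
    show "fam I01 ?H"
      by (intro fam_reparam[OF famG])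
        (auto simp: continuous_map_in_subtopology intro!: continuous_intros)
    show "?H 0 = map_option (G (0, 0))" by simp
    show "?H 1 = id" by (simp add: idG2 fun_eq_iff option.map_ident)
    fix s x assume s: "s \<in> {0..1::real}" and x: "x \<in> ?X"
    have "G (s, 0) (b i) = b i" if "i \<in> I" for i
      using atG[of "(s, 0)" i] that s null(2,3)[of s i] by simp
    then show "?H s x = id x" using x by auto
  qed
  \<comment> \<open>\<open>isotopic_rel\<close> prescribes the values of its second map. The
    isotopies can be concatenated because \<open>G (0, 0)\<close> and the identity agree on the
    marked points.\<close>
  have fixed: "map_option (G (0, 0)) x = x" if "x \<in> ?X" for x
    using that atG[of "(0, 0)"] null(2,3)[of 0] by auto
  have "homotopic_with (\<lambda>h. homeomorphic_map P1 P1 h \<and> (\<forall>x\<in>?X. h x = id x)) P1 P1 (\<Psi> 1) (map_option (G (0, 0)))"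
    by (rule homotopic_with_mono[OF iso1[unfolded isotopic_rel_def]]) (use fixed in auto)
  from homotopic_with_trans[OF this iso2[unfolded isotopic_rel_def]] show ?thesis
    by (simp add: isotopic_rel_def)
qed

section \<open>Rational maps with two totally ramified values\<close>

definition hpoly :: "nat \<Rightarrow> complex poly \<Rightarrow> complex \<Rightarrow> complex \<Rightarrow> complex" where
  "hpoly d p x y = (\<Sum>i\<le>d. coeff p i * x ^ i * y ^ (d - i))"

lemma hpoly_dehomogenize:
  assumes "degree p \<le> d" "y \<noteq> 0"
  shows "hpoly d p x y = y ^ d * poly p (x / y)"
proof -
  have "poly p (x / y) = (\<Sum>i\<le>d. coeff p i * (x / y) ^ i)"
    unfolding poly_altdef using assms(1) by (intro sum.mono_neutral_left) (auto intro: coeff_eq_0)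
  then have "y ^ d * poly p (x / y) = (\<Sum>i\<le>d. y ^ d * (coeff p i * (x / y) ^ i))"
    by (simp add: sum_distrib_left)
  also have "\<dots> = hpoly d p x y" unfolding hpoly_def
  proof (rule sum.cong[OF refl])
    fix i assume "i \<in> {..d}"
    then have "y ^ d = y ^ (d - i) * y ^ i" by (simp flip: power_add)
    then show "y ^ d * (coeff p i * (x / y) ^ i) = coeff p i * x ^ i * y ^ (d - i)"
      using assms(2) by (simp add: power_divide)
  qed
  finally show ?thesis by simp
qed

lemma hpoly_infinity: "hpoly d p x 0 = coeff p d * x ^ d"
proof -
  have "hpoly d p x 0 = (\<Sum>i\<le>d. if i = d then coeff p d * x ^ d else 0)"
    unfolding hpoly_def by (rule sum.cong) auto
  then show ?thesis by simp
qed

text \<open>Since \<open>d\<close> is the exact maximum of the degrees, one of the two coefficients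
  of index \<open>d\<close> is nonzero, so the homogenised pair has no common zero at infinity
  either.\<close>

lemma rat_map_proj:
  assumes pq: "coprime p q" "q \<noteq> 0" and d: "max (degree p) (degree q) = d" "d \<ge> 1"
    and xy: "x \<noteq> 0 \<or> y \<noteq> 0"
  shows "hpoly d p x y \<noteq> 0 \<or> hpoly d q x y \<noteq> 0"
    and "rat_map p q (proj x y) = proj (hpoly d p x y) (hpoly d q x y)"
proof -
  have dp: "degree p \<le> d" and dq: "degree q \<le> d" using d by auto
  have "(hpoly d p x y \<noteq> 0 \<or> hpoly d q x y \<noteq> 0) \<and> rat_map p q (proj x y) = proj (hpoly d p x y) (hpoly d q x y)"
  proof (cases "y = 0")
    case False
    have "poly p (x / y) \<noteq> 0 \<or> poly q (x / y) \<noteq> 0" by (rule coprime_poly_0[OF pq(1)])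
    then show ?thesis
      using False by (auto simp: hpoly_dehomogenize[OF dp False] hpoly_dehomogenize[OF dq False] rat_map_def proj_def)
  next
    case True
    then have x: "x \<noteq> 0" using xy by simp
    have cp: "coeff p d \<noteq> 0 \<longleftrightarrow> degree p = d"
      using dp d(2) by (metis coeff_eq_0 le_neq_implies_less leading_coeff_0_iff degree_0 not_one_le_zero)
    have cq: "coeff q d \<noteq> 0 \<longleftrightarrow> degree q = d"
      using dq d(2) by (metis coeff_eq_0 le_neq_implies_less leading_coeff_0_iff degree_0 not_one_le_zero)
    have "degree p = d \<or> degree q = d" using d(1) by (auto simp: max_def split: if_splits)
    moreover have "rat_map p q None = proj (coeff p d) (coeff q d)"
    proof -
      consider "degree p = d" "degree q = d" | "degree p = d" "degree q < d" | "degree p < d" "degree q = d"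
        using d(1) dp dq by linarith
      then show ?thesis
        by cases (use cp cq in \<open>auto simp: rat_map_def proj_def\<close>)
    qed
    ultimately show ?thesis
      using True x cp cq by (auto simp: hpoly_infinity proj_def)
  qed
  then show "hpoly d p x y \<noteq> 0 \<or> hpoly d q x y \<noteq> 0"
    "rat_map p q (proj x y) = proj (hpoly d p x y) (hpoly d q x y)" by auto
qed

text \<open>The homogenised polynomial along the affine line through (d1, d2) in direction (c1, c2):
  the parameter value 0 is the point (d1 : d2), and infinity is (c1 : c2).\<close>

definition line_poly :: "nat \<Rightarrow> complex poly \<Rightarrow> complex \<Rightarrow> complex \<Rightarrow> complex \<Rightarrow> complex \<Rightarrow> complex poly" where
  "line_poly d p c1 d1 c2 d2 = (\<Sum>i\<le>d. smult (coeff p i) ([:d1, c1:] ^ i * [:d2, c2:] ^ (d - i)))"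

lemma poly_line_poly: "poly (line_poly d p c1 d1 c2 d2) X = hpoly d p (X * c1 + d1) (X * c2 + d2)"
  by (simp add: line_poly_def hpoly_def poly_sum mult.assoc add.commute)

lemma poly_without_roots:
  fixes p :: "complex poly"
  assumes "\<And>z. poly p z \<noteq> 0"
  shows "poly p z = poly p 0"
  using fundamental_theorem_of_algebra[of p] assms unfolding constant_def by metis

lemma poly_only_root_0:
  fixes p :: "complex poly"
  assumes "\<And>z. poly p z = 0 \<longleftrightarrow> z = 0"
  obtains k m where "k \<noteq> 0" "\<And>z. poly p z = k * z ^ m"
proof -
  have "p \<noteq> 0" using assms[of 1] by auto
  then obtain q where q: "p = [:- 0, 1:] ^ order 0 p * q" "\<not> [:- 0, 1:] dvd q"
    using order_decomp by blast
  have "poly q z \<noteq> 0" for z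
  proof
    assume 0: "poly q z = 0"
    then have "poly p z = 0" by (subst q(1)) simp
    then have "z = 0" using assms by simp
    then show False using 0 q(2) by (simp add: poly_eq_0_iff_dvd)
  qed
  then have c: "poly q z = poly q 0" "poly q 0 \<noteq> 0" for z using poly_without_roots by blast+
  have "poly p z = poly q 0 * z ^ order 0 p" for z
    by (subst q(1)) (simp add: c(1)[of z] mult.commute)
  then show ?thesis using that c(2) by blast
qed

text \<open>With \<gamma> at infinity and \<gamma>' at 0, the numerator of F - \<alpha> has no root
  and that of F - \<beta> only the root 0, so F is a power map in these coordinates. The degree of F
  is not given; the exponent is 2 because fibres have at most two points and one fibre has
  two.\<close>

lemma rational_map_squaring:
  assumes F: "rational_map F"
    and \<alpha>: "\<And>w. F w = \<alpha> \<longleftrightarrow> w = \<gamma>" and \<beta>: "\<And>w. F w = \<beta> \<longleftrightarrow> w = \<gamma>'" and ne: "\<gamma> \<noteq> \<gamma>'"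
    and two: "\<And>w1 w2 w3. F w1 = F w2 \<Longrightarrow> F w2 = F w3 \<Longrightarrow> w1 = w2 \<or> w2 = w3 \<or> w1 = w3"
    and double: "F u1 = F u2" "u1 \<noteq> u2"
    and w: "w \<noteq> \<gamma>" "w \<noteq> \<gamma>'" "w0 \<noteq> \<gamma>" "w0 \<noteq> \<gamma>'"
  shows "CR (F w) (F w0) \<beta> \<alpha> = (CR w w0 \<gamma>' \<gamma>)\<^sup>2"
proof -
  obtain d where d: "d \<ge> 1" "rational_map_deg d F" using F by (auto simp: rational_map_def)
  then obtain p q where pq: "coprime p q" "q \<noteq> 0" "max (degree p) (degree q) = d" "F = rat_map p q"
    by (auto simp: rational_map_deg_def)
  define c1 where "c1 = hx \<gamma>" define c2 where "c2 = hy \<gamma>"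
  define d1 where "d1 = hx \<gamma>'" define d2 where "d2 = hy \<gamma>'"
  have det: "c1 * d2 - d1 * c2 \<noteq> 0" using ne br_eq_0_iff[of \<gamma> \<gamma>'] by (simp add: br_def c1_def c2_def d1_def d2_def)
  define pt where "pt X = proj (X * c1 + d1) (X * c2 + d2)" for X
  have pn: "X * c1 + d1 \<noteq> 0 \<or> X * c2 + d2 \<noteq> 0" for X
    using lin_nonzero[of c1 d2 d1 c2 X 1] det by (simp add: mult.commute)
  have pt_inj: "pt X = pt Y \<longleftrightarrow> X = Y" for X Y
  proof -
    have "pt X = pt Y \<longleftrightarrow> (X * c1 + d1) * (Y * c2 + d2) = (X * c2 + d2) * (Y * c1 + d1)"
      unfolding pt_def by (rule proj_eq_iff[OF pn pn])
    also have "\<dots> \<longleftrightarrow> (X - Y) * (c1 * d2 - d1 * c2) = 0" by algebra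
    finally show ?thesis using det by simp
  qed
  have pt_\<gamma>: "pt X \<noteq> \<gamma>" for X
  proof
    assume "pt X = \<gamma>"
    then have "proj (X * c1 + d1) (X * c2 + d2) = proj c1 c2" by (simp add: pt_def c1_def c2_def)
    then have "(X * c1 + d1) * c2 = (X * c2 + d2) * c1"
      using proj_eq_iff[OF pn hx_hy_nonzero[of \<gamma>]] by (simp add: c1_def c2_def)
    then show False using det by (simp add: algebra_simps)
  qed
  have pt_0: "pt 0 = \<gamma>'" by (simp add: pt_def d1_def d2_def)
  have pt_surj: "\<exists>X. w = pt X" if "w \<noteq> \<gamma>" for w
  proof -
    \<comment> \<open>Cramer's rule: \<open>s\<close> and \<open>t\<close> are, up to the
      determinant, the coordinates of \<open>w\<close> in the basis of representatives of \<gamma>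
      and \<gamma>'. The coefficient \<open>t\<close> vanishes only at \<gamma>.\<close>
    define x where "x = hx w" define y where "y = hy w"
    define t where "t = c1 * y - c2 * x" define s where "s = x * d2 - y * d1"
    have t: "t \<noteq> 0" using that br_eq_0_iff[of \<gamma> w] by (simp add: br_def t_def c1_def c2_def x_def y_def mult.commute)
    have "(c1 * d2 - d1 * c2) * x = s * c1 + t * d1" "(c1 * d2 - d1 * c2) * y = s * c2 + t * d2"
      unfolding s_def t_def by algebra+
    then have "proj ((c1 * d2 - d1 * c2) * x) ((c1 * d2 - d1 * c2) * y) = proj (t * (s / t * c1 + d1)) (t * (s / t * c2 + d2))"
      using t by (simp add: distrib_left)
    then have "w = pt (s / t)" using det t by (simp add: proj_mult pt_def x_def y_def)
    then show ?thesis by blast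
  qed
  note F_proj = rat_map_proj[OF pq(1-3) d(1)]
  \<comment> \<open>\<open>U\<close> and \<open>W\<close> vanish where F takes the value \<alpha>
    and \<beta>, also when one of these values is infinity.\<close>
  define U where "U = smult (hy \<alpha>) (line_poly d p c1 d1 c2 d2) - smult (hx \<alpha>) (line_poly d q c1 d1 c2 d2)"
  define W where "W = smult (hy \<beta>) (line_poly d p c1 d1 c2 d2) - smult (hx \<beta>) (line_poly d q c1 d1 c2 d2)"
  define Px where "Px X = hpoly d p (X * c1 + d1) (X * c2 + d2)" for X
  define Qx where "Qx X = hpoly d q (X * c1 + d1) (X * c2 + d2)" for X
  have Fpt: "F (pt X) = proj (Px X) (Qx X)" for X
    unfolding pt_def Px_def Qx_def pq(4) by (rule F_proj(2)[OF pn])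
  have PQ: "Px X \<noteq> 0 \<or> Qx X \<noteq> 0" for X unfolding Px_def Qx_def by (rule F_proj(1)[OF pn])
  have polyU: "poly U X = Px X * hy \<alpha> - hx \<alpha> * Qx X" for X
    by (simp add: U_def poly_line_poly Px_def Qx_def mult.commute)
  have polyW: "poly W X = Px X * hy \<beta> - hx \<beta> * Qx X" for X
    by (simp add: W_def poly_line_poly Px_def Qx_def mult.commute)
  have eqp: "Px X * hy a - hx a * Qx X = 0 \<longleftrightarrow> F (pt X) = a" for X a
    using proj_eq_iff[OF PQ[of X] hx_hy_nonzero[of a]] by (auto simp: Fpt mult.commute)
  have U0: "poly U X \<noteq> 0" for X using polyU eqp \<alpha> pt_\<gamma> by simp
  then have Uc: "poly U X = poly U 0" for X by (rule poly_without_roots)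
  have "poly W X = 0 \<longleftrightarrow> X = 0" for X using polyW eqp[of X \<beta>] \<beta> pt_0 pt_inj by metis
  then obtain k m where k: "k \<noteq> 0" "\<And>X. poly W X = k * X ^ m" by (rule poly_only_root_0) blast
  have CRF: "CR (F (pt X)) (F (pt Y)) \<beta> \<alpha> = (X / Y) ^ m" if "Y \<noteq> 0" for X Y
  proof -
    have "CR (F (pt X)) (F (pt Y)) \<beta> \<alpha> = poly W X * poly U Y / (poly W Y * poly U X)"
      using CR_proj[OF PQ[of X] PQ[of Y] hx_hy_nonzero[of \<beta>] hx_hy_nonzero[of \<alpha>]]
      by (simp add: polyU polyW Fpt)
    also have "\<dots> = (k * X ^ m) * poly U 0 / ((k * Y ^ m) * poly U 0)" by (simp only: k(2) Uc[of X] Uc[of Y])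
    also have "\<dots> = (X / Y) ^ m" using k(1) U0[of 0] by (simp add: power_divide)
    finally show ?thesis .
  qed
  have F_eq: "F (pt X) = F (pt Y)" if "X ^ m = Y ^ m" "Y \<noteq> 0" for X Y
  proof (rule CR_eq_1)
    show "CR (F (pt X)) (F (pt Y)) \<beta> \<alpha> = 1" using CRF[OF that(2)] that by (simp add: power_divide)
    show "\<beta> \<noteq> \<alpha>" using \<alpha> \<beta> ne by metis
  qed
  have m2: "m = 2"
  proof -
    have "m \<noteq> 0 \<and> m \<noteq> 1"
    proof -
      have u: "u1 \<noteq> \<gamma>" "u2 \<noteq> \<gamma>" "u1 \<noteq> \<gamma>'" "u2 \<noteq> \<gamma>'" using double \<alpha> \<beta> by metis+
      obtain X Y where XY: "u1 = pt X" "u2 = pt Y" using pt_surj u by meson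
      then have "X \<noteq> 0" "Y \<noteq> 0" "X \<noteq> Y" using u pt_0 double by auto
      have "F (pt Y) \<noteq> \<beta>" "F (pt Y) \<noteq> \<alpha>" using u \<alpha> \<beta> XY by auto
      then have "(X / Y) ^ m = 1" using CRF[OF \<open>Y \<noteq> 0\<close>, of X] double XY by (simp add: CR_self)
      moreover have "m \<noteq> 0"
      proof
        assume "m = 0"
        then show False using k(2)[of 0] k(1) polyW[of 0] eqp[of 0 \<beta>] \<beta>[of \<gamma>'] pt_0 by simp
      qed
      ultimately show ?thesis using \<open>X \<noteq> Y\<close> \<open>Y \<noteq> 0\<close> by (auto simp: field_simps)
    qed
    moreover have "\<not> m \<ge> 3"
    proof
      assume m: "m \<ge> 3"
      \<comment> \<open>Three roots of unity would be three points in one fibre.\<close>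
      have "card {z::complex. z ^ m = 1} = m" using card_roots_unity_eq[of m] m by simp
      then obtain T where T: "T \<subseteq> {z::complex. z ^ m = 1}" "card T = 3"
        using m obtain_subset_with_card_n by metis
      then obtain z1 z2 z3 where z: "T = {z1, z2, z3}" "z1 \<noteq> z2" "z2 \<noteq> z3" "z1 \<noteq> z3"
        by (auto simp: card_3_iff)
      have r: "z1 ^ m = 1" "z2 ^ m = 1" "z3 ^ m = 1" using T(1) z(1) by auto
      then have nz: "z2 \<noteq> 0" "z3 \<noteq> 0" using m by (auto simp: power_0_left split: if_splits)
      have "F (pt z1) = F (pt z2)" by (rule F_eq) (use r nz in simp_all)
      moreover have "F (pt z2) = F (pt z3)" by (rule F_eq) (use r nz in simp_all)
      ultimately have "pt z1 = pt z2 \<or> pt z2 = pt z3 \<or> pt z1 = pt z3" by (rule two)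
      then show False unfolding pt_inj using z(2-4) by blast
    qed
    ultimately show ?thesis by auto
  qed
  obtain X Y where XY: "w = pt X" "w0 = pt Y" using pt_surj w by meson
  have Y: "Y \<noteq> 0" using w XY pt_0 by auto
  have "CR w w0 \<gamma>' \<gamma> = X / Y"
  proof -
    have "CR (proj (X * c1 + d1) (X * c2 + d2)) (proj (Y * c1 + d1) (Y * c2 + d2)) (proj d1 d2) (proj c1 c2) =
      ((X * c1 + d1) * d2 - d1 * (X * c2 + d2)) * ((Y * c1 + d1) * c2 - c1 * (Y * c2 + d2)) /
      (((Y * c1 + d1) * d2 - d1 * (Y * c2 + d2)) * ((X * c1 + d1) * c2 - c1 * (X * c2 + d2)))"
      by (rule CR_proj[OF pn pn]) (use det in auto)
    also have "\<dots> = (X * (c1 * d2 - d1 * c2)) * (- (c1 * d2 - d1 * c2)) / ((Y * (c1 * d2 - d1 * c2)) * (- (c1 * d2 - d1 * c2)))"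
    proof -
      have e: "(Z * c1 + d1) * d2 - d1 * (Z * c2 + d2) = Z * (c1 * d2 - d1 * c2)"
        "(Z * c1 + d1) * c2 - c1 * (Z * c2 + d2) = - (c1 * d2 - d1 * c2)" for Z by algebra+
      show ?thesis by (simp only: e)
    qed
    also have "\<dots> = X / Y" using det by simp
    finally show ?thesis by (simp add: XY pt_def c1_def c2_def d1_def d2_def)
  qed
  then show ?thesis using CRF[OF Y, of X] m2 XY by simp
qed

text \<open>Two Moebius coordinates with the same pole \<open>a\<close> differ by an affine map, so
  the new one is determined by where it has its 0 and its 1.\<close>

lemma CR_affine:
  assumes "q0 \<noteq> v" "q0 \<noteq> a" "p \<noteq> a" "q \<noteq> a" "u \<noteq> a" "v \<noteq> a" "q \<noteq> u"
  shows "CR p q u a = (CR p q0 v a - CR u q0 v a) / (CR q q0 v a - CR u q0 v a)"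
proof -
  have d: "CR r q0 v a - CR u q0 v a = br r u * (br q0 a * br v a / (br q0 v * br r a * br u a))" if "r \<noteq> a" for r
  proof -
    have nz: "br q0 v \<noteq> 0" "br r a \<noteq> 0" "br u a \<noteq> 0" using assms that by (simp_all add: br_eq_0_iff)
    have "CR r q0 v a - CR u q0 v a = br q0 a * (br r v * br u a - br u v * br r a) / (br q0 v * br r a * br u a)"
      using nz by (simp add: CR_def field_simps)
    also have "br r v * br u a - br u v * br r a = br r u * br v a" by (rule Pluecker)
    finally show ?thesis by (simp add: mult_ac)
  qed
  have nz: "br q0 v \<noteq> 0" "br q0 a \<noteq> 0" "br p a \<noteq> 0" "br q a \<noteq> 0" "br u a \<noteq> 0" "br v a \<noteq> 0" "br q u \<noteq> 0"
    using assms by (simp_all add: br_eq_0_iff)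
  show ?thesis unfolding d[OF assms(3)] d[OF assms(4)] using nz by (simp add: CR_def)
qed

lemma CR_swap: "CR p q u a = CR q p a u"
  by (simp add: CR_def mult.commute)

text \<open>The square contains x / (1 - x) twice. One copy is evaluated by the expression in the
  squares, the other by the linear expression, and after cancellation the product of the two is the
  inverse of the square of \<open>Q\<close>.\<close>

lemma square_relation:
  fixes t1 t2 t3 Q x :: complex
  assumes ne: "t1\<^sup>2 \<noteq> t2\<^sup>2" "t1\<^sup>2 \<noteq> t3\<^sup>2" "t2\<^sup>2 \<noteq> t3\<^sup>2"
    and x: "x = (t2\<^sup>2 - t3\<^sup>2) / (t1\<^sup>2 - t3\<^sup>2)" "x = (t2 - t1) / (t3 - t1)"
    and Q: "Q\<^sup>2 = (t1 + t2) / (t2 + t3)"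
  shows "(Q * x / (1 - x))\<^sup>2 = 1"
proof -
  have d: "t1 - t2 \<noteq> 0" "t1 + t2 \<noteq> 0" "t1 - t3 \<noteq> 0" "t1 + t3 \<noteq> 0" "t2 - t3 \<noteq> 0" "t2 + t3 \<noteq> 0" "t3 - t1 \<noteq> 0"
    using ne by (auto simp: power2_eq_iff eq_neg_iff_add_eq_0)
  have 1: "x / (1 - x) = (t2\<^sup>2 - t3\<^sup>2) / (t1\<^sup>2 - t2\<^sup>2)"
  proof -
    have "1 - x = (t1\<^sup>2 - t2\<^sup>2) / (t1\<^sup>2 - t3\<^sup>2)" using ne by (simp add: x(1) field_simps)
    then show ?thesis using ne by (simp add: x(1))
  qed
  have 2: "x / (1 - x) = (t2 - t1) / (t3 - t2)"
  proof -
    have "1 - x = (t3 - t2) / (t3 - t1)" using d by (simp add: x(2) field_simps)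
    then show ?thesis using d by (simp add: x(2))
  qed
  have "(Q * x / (1 - x))\<^sup>2 = Q\<^sup>2 * (x / (1 - x)) * (x / (1 - x))" by (simp add: power2_eq_square)
  also have "\<dots> = (t1 + t2) / (t2 + t3) * ((t2\<^sup>2 - t3\<^sup>2) / (t1\<^sup>2 - t2\<^sup>2)) * ((t2 - t1) / (t3 - t2))"
    by (subst 1, subst 2) (simp add: Q)
  also have "\<dots> = (t1 + t2) * ((t2 - t3) * (t2 + t3)) * (t2 - t1) / ((t2 + t3) * ((t1 - t2) * (t1 + t2)) * (t3 - t2))"
  proof -
    have f: "t2\<^sup>2 - t3\<^sup>2 = (t2 - t3) * (t2 + t3)" "t1\<^sup>2 - t2\<^sup>2 = (t1 - t2) * (t1 + t2)" by algebra+
    show ?thesis by (simp only: f times_divide_times_eq)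
  qed
  also have "\<dots> = 1"
  proof -
    have "(t1 + t2) * ((t2 - t3) * (t2 + t3)) * (t2 - t1) = (t2 + t3) * ((t1 - t2) * (t1 + t2)) * (t3 - t2)" by algebra
    moreover have "(t2 + t3) * ((t1 - t2) * (t1 + t2)) * (t3 - t2) \<noteq> 0" using d by (simp add: eq_neg_iff_add_eq_0)
    ultimately show ?thesis by simp
  qed
  finally show ?thesis .
qed

section \<open>Quadratic rational maps\<close>

locale quadratic_forms =
  fixes p0 p1 p2 q0 q1 q2 :: complex
begin

definition "P x y = p2 * x\<^sup>2 + p1 * x * y + p0 * y\<^sup>2"
definition "Q x y = q2 * x\<^sup>2 + q1 * x * y + q0 * y\<^sup>2"
text \<open>\<open>BP\<close> and \<open>BQ\<close> are the symmetric bilinear forms of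
  \<open>P\<close> and \<open>Q\<close>, scaled to be the mixed coefficients of their
  expansions.\<close>

definition "BP x y u v = 2 * p2 * x * u + p1 * (x * v + u * y) + 2 * p0 * y * v"
definition "BQ x y u v = 2 * q2 * x * u + q1 * (x * v + u * y) + 2 * q0 * y * v"
text \<open>Half the Jacobian determinant of the pair (P, Q), whose zeros are the critical
  points.\<close>

definition "J x y = (p2 * q1 - p1 * q2) * x\<^sup>2 + 2 * (p2 * q0 - p0 * q2) * x * y + (p1 * q0 - p0 * q1) * y\<^sup>2"

lemma P_expand: "P (s * x + t * u) (s * y + t * v) = P x y * s\<^sup>2 + BP x y u v * s * t + P u v * t\<^sup>2"
  unfolding P_def BP_def by algebra

lemma Q_expand: "Q (s * x + t * u) (s * y + t * v) = Q x y * s\<^sup>2 + BQ x y u v * s * t + Q u v * t\<^sup>2"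
  unfolding Q_def BQ_def by algebra

lemma J_eq: "P x y * BQ x y u v - Q x y * BP x y u v = J x y * (x * v - u * y)"
  unfolding P_def Q_def BP_def BQ_def J_def by algebra

lemma PQ_scale: "P (k * x) (k * y) = k\<^sup>2 * P x y" "Q (k * x) (k * y) = k\<^sup>2 * Q x y"
  unfolding P_def Q_def by algebra+

lemma J_scale: "J (k * x) (k * y) = k\<^sup>2 * J x y"
  unfolding J_def by algebra

definition "f w = proj (P (hx w) (hy w)) (Q (hx w) (hy w))"

lemma f_proj:
  assumes "x \<noteq> 0 \<or> y \<noteq> 0"
  shows "f (proj x y) = proj (P x y) (Q x y)"
proof -
  obtain k where k: "k \<noteq> 0" "x = k * hx (proj x y)" "y = k * hy (proj x y)"
    using proj_scale[OF assms] by blast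
  have "proj (P x y) (Q x y) = proj (k\<^sup>2 * P (hx (proj x y)) (hy (proj x y))) (k\<^sup>2 * Q (hx (proj x y)) (hy (proj x y)))"
    by (metis PQ_scale k(2,3))
  then show ?thesis using k(1) by (simp add: f_def proj_mult)
qed

end

locale nondegenerate_forms = quadratic_forms +
  assumes nz: "x \<noteq> 0 \<or> y \<noteq> 0 \<Longrightarrow> P x y \<noteq> 0 \<or> Q x y \<noteq> 0"
begin

text \<open>To first order along \<open>loc\<close>, the forms are P0 + P1 \<zeta> and Q0 + Q1
  \<zeta>. In either chart the derivative vanishes iff P0 Q1 = Q0 P1, and \<open>J_eq\<close> turns
  this into the vanishing of \<open>J\<close>.\<close>

lemma critical_point_iff: "critical_point f w \<longleftrightarrow> J (hx w) (hy w) = 0"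
proof -
  \<comment> \<open>(u, v) is the direction in which \<open>loc\<close> leaves the representative of
    \<open>w\<close>, at finite points and at infinity alike.\<close>
  define u :: complex where "u = (case w of None \<Rightarrow> 0 | Some a \<Rightarrow> 1)"
  define v :: complex where "v = (case w of None \<Rightarrow> 1 | Some a \<Rightarrow> 0)"
  define x where "x = hx w"
  define y where "y = hy w"
  define P0 where "P0 = P x y" define P1 where "P1 = BP x y u v" define P2 where "P2 = P u v"
  define Q0 where "Q0 = Q x y" define Q1 where "Q1 = BQ x y u v" define Q2 where "Q2 = Q u v"
  have det: "x * v - u * y \<noteq> 0" by (cases w) (auto simp: x_def y_def u_def v_def)
  have xy: "x \<noteq> 0 \<or> y \<noteq> 0" unfolding x_def y_def by (rule hx_hy_nonzero)
  have loc: "loc w \<zeta> = proj (x + \<zeta> * u) (y + \<zeta> * v)" for \<zeta>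
    by (cases w) (auto simp: x_def y_def u_def v_def loc_def proj_def)
  have ne: "x + \<zeta> * u \<noteq> 0 \<or> y + \<zeta> * v \<noteq> 0" for \<zeta>
  proof (rule ccontr)
    assume "\<not> ?thesis"
    then have "x = - (\<zeta> * u)" "y = - (\<zeta> * v)" by (auto simp: eq_neg_iff_add_eq_0)
    then show False using det by (simp add: algebra_simps)
  qed
  have fl: "f (loc w \<zeta>) = proj (P0 + P1 * \<zeta> + P2 * \<zeta>\<^sup>2) (Q0 + Q1 * \<zeta> + Q2 * \<zeta>\<^sup>2)" for \<zeta>
    unfolding loc f_proj[OF ne] using P_expand[of 1 x \<zeta> u y v] Q_expand[of 1 x \<zeta> u y v]
    by (simp add: P0_def P1_def P2_def Q0_def Q1_def Q2_def)
  have fw: "f w = proj P0 Q0" by (simp add: f_def P0_def Q0_def x_def y_def)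
  have PQ0: "P0 \<noteq> 0 \<or> Q0 \<noteq> 0" unfolding P0_def Q0_def by (rule nz[OF xy])
  define g where "g \<zeta> = chart (f w) (f (loc w \<zeta>))" for \<zeta>
  have "\<exists>D. (g has_field_derivative D) (at 0) \<and> (D = 0 \<longleftrightarrow> P0 * Q1 - Q0 * P1 = 0)"
  proof (cases "Q0 = 0")
    case True
    then have P0: "P0 \<noteq> 0" using PQ0 by simp
    \<comment> \<open>The equality holds for every \<zeta>: both sides are 0 where a numerator or
      denominator vanishes, by the conventions for division by 0 and for
      \<open>chart\<close>.\<close>
    have g: "g = (\<lambda>\<zeta>. (Q0 + Q1 * \<zeta> + Q2 * \<zeta>\<^sup>2) / (P0 + P1 * \<zeta> + P2 * \<zeta>\<^sup>2))"
      unfolding g_def fl fw using True by (auto simp: fun_eq_iff chart_def proj_def)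
    have "(g has_field_derivative (Q1 * P0 - Q0 * P1) / (P0 * P0)) (at 0)"
      unfolding g by (rule derivative_eq_intros refl | use P0 in simp)+
    then show ?thesis using P0 by (intro exI conjI) (auto simp: mult.commute)
  next
    case False
    define h where "h \<zeta> = (P0 + P1 * \<zeta> + P2 * \<zeta>\<^sup>2) / (Q0 + Q1 * \<zeta> + Q2 * \<zeta>\<^sup>2) - P0 / Q0" for \<zeta>
    have h: "(h has_field_derivative (P1 * Q0 - P0 * Q1) / (Q0 * Q0)) (at 0)"
      unfolding h_def by (rule derivative_eq_intros refl | use False in simp)+
    have "((\<lambda>\<zeta>. Q0 + Q1 * \<zeta> + Q2 * \<zeta>\<^sup>2) \<longlongrightarrow> Q0 + Q1 * 0 + Q2 * 0\<^sup>2) (nhds 0)"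
      by (intro tendsto_intros filterlim_ident)
    \<comment> \<open>Here \<open>chart\<close> has the default 0 where f is infinite, so
      \<open>h\<close> and \<open>g\<close> are only compared near 0, where the denominator does not
      vanish.\<close>
    then have "eventually (\<lambda>\<zeta>. Q0 + Q1 * \<zeta> + Q2 * \<zeta>\<^sup>2 \<noteq> 0) (nhds 0)"
      by (rule tendsto_imp_eventually_ne) (use False in simp)
    then have "eventually (\<lambda>\<zeta>. h \<zeta> = g \<zeta>) (nhds 0)"
      by eventually_elim (use False in \<open>auto simp: g_def h_def fl fw chart_def proj_def\<close>)
    then have "(g has_field_derivative (P1 * Q0 - P0 * Q1) / (Q0 * Q0)) (at 0)"
      using h DERIV_cong_ev[OF refl] by blast
    then show ?thesis using False by (intro exI conjI) (auto simp: mult.commute)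
  qed
  then obtain D where D: "(g has_field_derivative D) (at 0)" "D = 0 \<longleftrightarrow> P0 * Q1 - Q0 * P1 = 0" by blast
  have "critical_point f w \<longleftrightarrow> (g has_field_derivative 0) (at 0)"
    by (simp add: critical_point_def g_def[abs_def])
  also have "\<dots> \<longleftrightarrow> D = 0" using D(1) DERIV_unique by blast
  also have "\<dots> \<longleftrightarrow> J x y * (x * v - u * y) = 0"
    unfolding D(2) P0_def Q0_def P1_def Q1_def J_eq ..
  finally show ?thesis using det by (simp add: x_def y_def)
qed

text \<open>At a critical point the mixed coefficients are proportional to the values of the forms,
  so one shift of the second basis vector removes both mixed terms. In the new basis both forms are
  combinations of s^2 and t^2, which is squaring followed by a linear map.\<close>

lemma normal_form:
  assumes c: "critical_point f c"
  obtains m1 m2 m3 m4 n1 n2 n3 n4 where "m1 * m4 - m2 * m3 \<noteq> 0" "n1 * n4 - n2 * n3 \<noteq> 0"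
    "\<And>w. f (mob n1 n2 n3 n4 w) = mob m1 m2 m3 m4 (map_option (\<lambda>z. z\<^sup>2) w)"
    "mob n1 n2 n3 n4 None = c" "critical_point f (mob n1 n2 n3 n4 (Some 0))"
proof -
  define u :: complex where "u = (case c of None \<Rightarrow> 0 | Some a \<Rightarrow> 1)"
  define v :: complex where "v = (case c of None \<Rightarrow> 1 | Some a \<Rightarrow> 0)"
  define x where "x = hx c"
  define y where "y = hy c"
  have det: "x * v - u * y \<noteq> 0" by (cases c) (auto simp: x_def y_def u_def v_def)
  have xy: "x \<noteq> 0 \<or> y \<noteq> 0" unfolding x_def y_def by (rule hx_hy_nonzero)
  have "J x y = 0" using c by (simp add: critical_point_iff x_def y_def)
  then have par: "P x y * BQ x y u v = Q x y * BP x y u v" using J_eq[of x y u v] by simp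
  have "\<exists>\<kappa>. BP x y u v = \<kappa> * P x y \<and> BQ x y u v = \<kappa> * Q x y"
  proof (cases "P x y = 0")
    case True
    then have "Q x y \<noteq> 0" using nz[OF xy] by simp
    then show ?thesis using par True by (intro exI[of _ "BQ x y u v / Q x y"]) auto
  next
    case False
    then show ?thesis using par by (intro exI[of _ "BP x y u v / P x y"]) (auto simp: field_simps)
  qed
  then obtain \<kappa> where \<kappa>: "BP x y u v = \<kappa> * P x y" "BQ x y u v = \<kappa> * Q x y" by blast
  \<comment> \<open>Completing the square for both forms at once, by the common factor
    \<kappa>.\<close>
  define d1 where "d1 = u - \<kappa> / 2 * x"
  define d2 where "d2 = v - \<kappa> / 2 * y"
  have det': "x * d2 - d1 * y \<noteq> 0" using det by (simp add: d1_def d2_def algebra_simps)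
  have comb: "s * x + t * d1 = (s - \<kappa> / 2 * t) * x + t * u" "s * y + t * d2 = (s - \<kappa> / 2 * t) * y + t * v" for s t
    by (simp_all add: d1_def d2_def algebra_simps)
  have PX: "P (s * x + t * d1) (s * y + t * d2) = P x y * s\<^sup>2 + (P u v - \<kappa>\<^sup>2 / 4 * P x y) * t\<^sup>2" for s t
    unfolding comb P_expand \<kappa> by (simp add: power2_eq_square algebra_simps)
  have QX: "Q (s * x + t * d1) (s * y + t * d2) = Q x y * s\<^sup>2 + (Q u v - \<kappa>\<^sup>2 / 4 * Q x y) * t\<^sup>2" for s t
    unfolding comb Q_expand \<kappa> by (simp add: power2_eq_square algebra_simps)
  define e1 where "e1 = P u v - \<kappa>\<^sup>2 / 4 * P x y"
  define e2 where "e2 = Q u v - \<kappa>\<^sup>2 / 4 * Q x y"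
  note PX = PX[folded e1_def] and QX = QX[folded e2_def]
  have ind: "s * x + t * d1 \<noteq> 0 \<or> s * y + t * d2 \<noteq> 0" if "s \<noteq> 0 \<or> t \<noteq> 0" for s t
    using lin_nonzero[of x d2 d1 y s t] det' that by (simp add: mult.commute)
  \<comment> \<open>If the rows were proportional, a suitable ratio of s^2 to t^2 would give a
    common zero of P and Q.\<close>
  have detM: "P x y * e2 - e1 * Q x y \<noteq> 0"
  proof
    assume 0: "P x y * e2 - e1 * Q x y = 0"
    obtain s t where st: "s \<noteq> 0 \<or> t \<noteq> 0" "P x y * s\<^sup>2 + e1 * t\<^sup>2 = 0" "Q x y * s\<^sup>2 + e2 * t\<^sup>2 = 0"
    proof (cases "P x y = 0")
      case True
      then have q: "Q x y \<noteq> 0" using nz[OF xy] by simp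
      then have "e1 = 0" using 0 True by simp
      then show ?thesis using that[of "csqrt (- e2 / Q x y)" 1] True q by simp
    next
      case False
      then have "e2 = e1 * Q x y / P x y" using 0 by (simp add: field_simps)
      then show ?thesis using that[of "csqrt (- e1 / P x y)" 1] False by simp
    qed
    show False using nz[OF ind[OF st(1)]] PX[of s t] QX[of s t] st by simp
  qed
  have main: "f (mob x d1 y d2 w) = mob (P x y) e1 (Q x y) e2 (map_option (\<lambda>z. z\<^sup>2) w)" for w
  proof -
    have "f (mob x d1 y d2 w) = proj (P (hx w * x + hy w * d1) (hx w * y + hy w * d2)) (Q (hx w * x + hy w * d1) (hx w * y + hy w * d2))"
      using f_proj[OF ind[OF hx_hy_nonzero]] by (simp add: mob_def mult.commute)
    also have "\<dots> = mob (P x y) e1 (Q x y) e2 (map_option (\<lambda>z. z\<^sup>2) w)"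
      unfolding PX QX by (cases w) (auto simp: mob_def)
    finally show ?thesis .
  qed
  have "critical_point f (proj d1 d2)"
  proof -
    have ne: "d1 \<noteq> 0 \<or> d2 \<noteq> 0" using det' by auto
    obtain k where k: "k \<noteq> 0" "d1 = k * hx (proj d1 d2)" "d2 = k * hy (proj d1 d2)"
      using proj_scale[OF ne] by blast
    have "P d1 d2 + BP d1 d2 x y + P x y = P x y + e1" "Q d1 d2 + BQ d1 d2 x y + Q x y = Q x y + e2"
      using PX[of 1 1] QX[of 1 1] P_expand[of 1 d1 1 x d2 y] Q_expand[of 1 d1 1 x d2 y] by (simp_all add: add.commute)
    moreover have "P d1 d2 = e1" "Q d1 d2 = e2" using PX[of 0 1] QX[of 0 1] by simp_all
    ultimately have "BP d1 d2 x y = 0" "BQ d1 d2 x y = 0" by simp_all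
    then have "J d1 d2 * (d1 * y - x * d2) = 0" using J_eq[of d1 d2 x y] by simp
    then have "J d1 d2 = 0" using det' by (simp add: mult.commute)
    then have "J (hx (proj d1 d2)) (hy (proj d1 d2)) = 0" using J_scale[of k] k by (metis mult_eq_0_iff power_not_zero)
    then show ?thesis by (simp add: critical_point_iff)
  qed
  then have crit: "critical_point f (mob x d1 y d2 (Some 0))" by (simp add: mob_def)
  show ?thesis
    by (rule that[OF detM det' main _ crit]) (simp add: mob_def x_def y_def)
qed

end

lemma quadratic_normal_form:
  assumes f: "rational_map_deg 2 f" and c: "critical_point f c"
  obtains m1 m2 m3 m4 n1 n2 n3 n4 where "m1 * m4 - m2 * m3 \<noteq> 0" "n1 * n4 - n2 * n3 \<noteq> 0"
    "\<And>w. f (mob n1 n2 n3 n4 w) = mob m1 m2 m3 m4 (map_option (\<lambda>z. z\<^sup>2) w)"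
    "mob n1 n2 n3 n4 None = c" "critical_point f (mob n1 n2 n3 n4 (Some 0))"
proof -
  obtain p q where pq: "coprime p q" "q \<noteq> 0" "max (degree p) (degree q) = 2" "f = rat_map p q"
    using f by (auto simp: rational_map_deg_def)
  have quad: "\<exists>a b c. p = [:a, b, c:]" if "degree p \<le> 2" for p :: "complex poly"
  proof -
    have "p = [:coeff p 0, coeff p 1, coeff p 2:]"
    proof (rule poly_eqI)
      fix n
      show "coeff p n = coeff [:coeff p 0, coeff p 1, coeff p 2:] n"
        using that coeff_eq_0[of p n] by (auto simp: coeff_pCons numeral_2_eq_2 split: nat.split)
    qed
    then show ?thesis by blast
  qed
  have "degree p \<le> 2" "degree q \<le> 2" using pq(3) by linarith+
  then obtain p0 p1 p2 q0 q1 q2 where p: "p = [:p0, p1, p2:]" and q: "q = [:q0, q1, q2:]"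
    using quad by meson
  have dp: "p2 \<noteq> 0 \<longleftrightarrow> degree p = 2" and dq: "q2 \<noteq> 0 \<longleftrightarrow> degree q = 2"
    by (auto simp: p q)
  have lead: "p2 \<noteq> 0 \<or> q2 \<noteq> 0" using pq(3) dp dq by (auto simp: max_def split: if_splits)
  interpret F: quadratic_forms p0 p1 p2 q0 q1 q2 .
  have PQ1: "F.P z 1 = poly p z" "F.Q z 1 = poly q z" for z
    by (simp_all add: p q F.P_def F.Q_def power2_eq_square algebra_simps)
  interpret F: nondegenerate_forms p0 p1 p2 q0 q1 q2
  proof
    fix x y :: complex assume xy: "x \<noteq> 0 \<or> y \<noteq> 0"
    show "F.P x y \<noteq> 0 \<or> F.Q x y \<noteq> 0"
    proof (cases "y = 0")
      case True
      then show ?thesis using xy lead by (auto simp: F.P_def F.Q_def)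
    next
      case False
      have "F.P x y = y\<^sup>2 * F.P (x / y) 1" "F.Q x y = y\<^sup>2 * F.Q (x / y) 1"
        using F.PQ_scale[of y "x / y" 1] False by simp_all
      moreover have "poly p (x / y) \<noteq> 0 \<or> poly q (x / y) \<noteq> 0"
        by (rule coprime_poly_0[OF pq(1)])
      ultimately show ?thesis using False by (simp add: PQ1)
    qed
  qed
  have "rat_map p q w = F.f w" for w
  proof (cases w)
    case (Some z)
    then show ?thesis by (simp add: rat_map_def F.f_def PQ1 proj_def)
  next
    case None
    have "degree p < 2 \<or> p2 \<noteq> 0" "degree q < 2 \<or> q2 \<noteq> 0" using dp dq \<open>degree p \<le> 2\<close> \<open>degree q \<le> 2\<close> by linarith+
    moreover have "coeff p 2 = p2" "coeff q 2 = q2" by (simp_all add: p q numeral_2_eq_2)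
    ultimately show ?thesis using None pq(3) dp dq
      by (auto simp: rat_map_def F.f_def F.P_def F.Q_def proj_def max_def split: if_splits)
  qed
  then have "f = F.f" using pq(4) by blast
  then show ?thesis using F.normal_form[of c] c that by metis
qed

section \<open>Quadratic maps with a superattracting four-cycle\<close>

text \<open>In the coordinate \<open>N\<close> on the source and \<open>M\<close> on the target, \<open>f\<close> is the squaring map. The four-cycle is
  infinity, \<open>s1\<close>, \<open>s2\<close>, \<open>s3\<close> in the first coordinate, and the free critical value is 0 in the second.\<close>

locale normal_form =
  fixes m1 m2 m3 m4 n1 n2 n3 n4 s1 s2 s3 :: complex and f :: "complex option \<Rightarrow> complex option"
  assumes detM: "m1 * m4 - m2 * m3 \<noteq> 0" and detN: "n1 * n4 - n2 * n3 \<noteq> 0"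
    and f: "f (mob n1 n2 n3 n4 w) = mob m1 m2 m3 m4 (map_option (\<lambda>z. z\<^sup>2) w)"
    and nz: "s1 \<noteq> 0" "s2 \<noteq> 0" "s3 \<noteq> 0"
    and ne: "s1\<^sup>2 \<noteq> s2\<^sup>2" "s1\<^sup>2 \<noteq> s3\<^sup>2" "s2\<^sup>2 \<noteq> s3\<^sup>2"
    and cycle: "mob m1 m2 m3 m4 None = mob n1 n2 n3 n4 (Some s1)"
      "mob m1 m2 m3 m4 (Some (s1\<^sup>2)) = mob n1 n2 n3 n4 (Some s2)"
      "mob m1 m2 m3 m4 (Some (s2\<^sup>2)) = mob n1 n2 n3 n4 (Some s3)"
      "mob m1 m2 m3 m4 (Some (s3\<^sup>2)) = mob n1 n2 n3 n4 None"
begin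

definition "M = mob m1 m2 m3 m4"
definition "N = mob n1 n2 n3 n4"
definition "a0 = N None"
definition "a1 = N (Some s1)"
definition "a2 = N (Some s2)"
definition "a3 = N (Some s3)"
definition "v = M (Some 0)"
text \<open>The cross ratio of the cycle with \<open>a0\<close> at 0, \<open>a2\<close> at 1 and
  \<open>a1\<close> at infinity, evaluated at \<open>a3\<close> in the target coordinate.\<close>

definition "x = (s2\<^sup>2 - s3\<^sup>2) / (s1\<^sup>2 - s3\<^sup>2)"

lemma M_eq: "M p = M q \<longleftrightarrow> p = q" and N_eq: "N p = N q \<longleftrightarrow> p = q"
  using bij_mob[OF detM] bij_mob[OF detN] by (auto simp: M_def N_def bij_def inj_eq)

lemma a_M: "a0 = M (Some (s3\<^sup>2))" "a1 = M None" "a2 = M (Some (s1\<^sup>2))" "a3 = M (Some (s2\<^sup>2))"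
  using cycle by (simp_all add: a0_def a1_def a2_def a3_def M_def N_def)

lemma s_ne: "s1 \<noteq> s2" "s1 \<noteq> s3" "s2 \<noteq> s3" "s1 \<noteq> - s2" "s1 \<noteq> - s3" "s2 \<noteq> - s3" "s1 + s2 \<noteq> 0" "s1 + s3 \<noteq> 0" "s2 + s3 \<noteq> 0"
  using ne by (auto simp: eq_neg_iff_add_eq_0[symmetric])

lemma distinct_a: "distinct [a0, a1, a2, a3, v]"
proof -
  have "distinct [a0, a1, a2, a3]" unfolding a0_def a1_def a2_def a3_def using s_ne by (simp add: N_eq)
  moreover have "v \<notin> {a0, a1, a2, a3}" unfolding v_def a_M using nz by (simp add: M_eq)
  ultimately show ?thesis by auto
qed

lemma f_N: "f (N w) = M (map_option (\<lambda>z. z\<^sup>2) w)"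
  using f by (simp add: M_def N_def)

lemma bij_N: "bij N"
  using bij_mob[OF detN] by (simp add: N_def)

lemma f_fibre_a1: "f w = a1 \<longleftrightarrow> w = a0"
proof -
  obtain u where u: "w = N u" using bij_N by (metis bij_pointE)
  then show ?thesis by (cases u) (auto simp: f_N a_M(2) M_eq a0_def N_eq)
qed

lemma f_fibre_v: "f w = v \<longleftrightarrow> w = N (Some 0)"
proof -
  obtain u where u: "w = N u" using bij_N by (metis bij_pointE)
  then show ?thesis by (cases u) (auto simp: f_N v_def M_eq a0_def N_eq)
qed

lemma f_fibre_card: "f w1 = f w2 \<Longrightarrow> f w2 = f w3 \<Longrightarrow> w1 = w2 \<or> w2 = w3 \<or> w1 = w3"
proof -
  assume *: "f w1 = f w2" "f w2 = f w3"
  obtain u1 u2 u3 where u: "w1 = N u1" "w2 = N u2" "w3 = N u3" using bij_N by (metis bij_pointE)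
  show ?thesis using *
    by (cases u1; cases u2; cases u3) (auto simp: u f_N M_eq N_eq power2_eq_iff)
qed

text \<open>The same four points are read in the target and in the source coordinate. That both
  readings agree expresses that the identity lies over the diagonal.\<close>

lemma x_eq: "x = (s2 - s1) / (s3 - s1)"
proof -
  have "CR a3 a2 a0 a1 = CR (Some (s2\<^sup>2)) (Some (s1\<^sup>2)) (Some (s3\<^sup>2)) None"
    unfolding a_M M_def by (rule CR_mob[OF detM])
  moreover have "CR a3 a2 a0 a1 = CR (Some s3) (Some s2) None (Some s1)"
    unfolding a0_def a1_def a2_def a3_def N_def by (rule CR_mob[OF detN])
  ultimately have "(s3\<^sup>2 - s2\<^sup>2) / (s3\<^sup>2 - s1\<^sup>2) = (s1 - s2) / (s1 - s3)" by (simp add: CR_def[of "Some _"] br_def)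
  then show ?thesis unfolding x_def by (metis minus_diff_eq minus_divide_divide)
qed

text \<open>If x were 1/2, \<open>s2\<close> would be the midpoint of \<open>s1\<close> and
  \<open>s3\<close>, and likewise for the squares, forcing \<open>s1 = s2\<close>. This value must
  be excluded because there the removed curve x' = 1 - x meets the diagonal.\<close>

lemma x_ne: "x \<noteq> 0" "1 - x \<noteq> 0" "2 * x \<noteq> 1"
proof -
  show "x \<noteq> 0" using ne by (simp add: x_def)
  have e: "1 - x = (s1\<^sup>2 - s2\<^sup>2) / (s1\<^sup>2 - s3\<^sup>2)" using ne by (simp add: x_def field_simps)
  then show "1 - x \<noteq> 0" using ne by simp
  show "2 * x \<noteq> 1"
  proof
    assume "2 * x = 1"
    then have "2 * (s2 - s1) = s3 - s1" using x_eq s_ne by (simp add: field_simps)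
    then have s3: "s3 = 2 * s2 - s1" by (simp add: algebra_simps)
    have "2 * (s2\<^sup>2 - s3\<^sup>2) = s1\<^sup>2 - s3\<^sup>2" using \<open>2 * x = 1\<close> ne by (simp add: x_def field_simps)
    then have "- 2 * (s1 - s2)\<^sup>2 = 0" unfolding s3 by algebra
    then show False using s_ne by simp
  qed
qed

lemma M_cont: "continuous_on T g \<Longrightarrow> continuous_map (top_of_set T) P1 (\<lambda>t. M (Some (g t)))"
proof -
  assume "continuous_on T g"
  then have "continuous_map (top_of_set T) P1 (\<lambda>t. Some (g t))" by (intro continuous_map_Some) simp
  moreover have "continuous_map P1 P1 M"
    using homeomorphic_map_mob[OF detM] by (simp add: M_def homeomorphic_map_P1_iff)
  ultimately show ?thesis using continuous_map_compose by (fastforce simp: o_def)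
qed

text \<open>The value of \<open>QQ\<close> at the base point on the branch that the invariant of
  components uses.\<close>

definition "q0 = (1 - x) / x"

lemma q0_power2: "q0\<^sup>2 = (s1 + s2) / (s2 + s3)"
proof -
  have 1: "q0 = (s3 - s2) / (s2 - s1)"
  proof -
    have "1 - x = (s3 - s2) / (s3 - s1)" using s_ne by (simp add: x_eq field_simps)
    then show ?thesis unfolding q0_def using s_ne by (simp add: x_eq)
  qed
  have 2: "q0 = (s1\<^sup>2 - s2\<^sup>2) / (s2\<^sup>2 - s3\<^sup>2)"
  proof -
    have "1 - x = (s1\<^sup>2 - s2\<^sup>2) / (s1\<^sup>2 - s3\<^sup>2)" using ne by (simp add: x_def field_simps)
    then show ?thesis unfolding q0_def using ne by (simp add: x_def)
  qed
  have "q0\<^sup>2 = (s1\<^sup>2 - s2\<^sup>2) * (s3 - s2) / ((s2\<^sup>2 - s3\<^sup>2) * (s2 - s1))"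
    unfolding power2_eq_square[of q0] by (subst 1, subst 2) (simp add: mult.commute)
  also have "\<dots> = ((s1 - s2) * (s3 - s2) * (s1 + s2)) / ((s1 - s2) * (s3 - s2) * (s2 + s3))"
  proof -
    have "(s1\<^sup>2 - s2\<^sup>2) * (s3 - s2) = (s1 - s2) * (s3 - s2) * (s1 + s2)"
      "(s2\<^sup>2 - s3\<^sup>2) * (s2 - s1) = (s1 - s2) * (s3 - s2) * (s2 + s3)" by algebra+
    then show ?thesis by (simp only:)
  qed
  also have "\<dots> = (s1 + s2) / (s2 + s3)" using s_ne by simp
  finally show ?thesis .
qed

end

text \<open>The middle path is described through the logarithm \<omega> of its \<open>rr\<close> at
  the identity, and the end value of \<omega> is chosen so that \<open>QQ id\<close> is
  \<open>q0\<close> itself. The end point alone determines only the square, hence the root up to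
  sign.\<close>

locale normal_form_paths = normal_form +
  fixes p1 \<omega> p3 :: "real \<Rightarrow> complex"
  assumes p1: "continuous_on {0..1} p1" "p1 0 = s2" "p1 1 = s3" "t \<in> {0..1} \<Longrightarrow> p1 t \<noteq> 0"
    and p3: "continuous_on {0..1} p3" "p3 0 = s1\<^sup>2" "p3 1 = s2\<^sup>2" "t \<in> {0..1} \<Longrightarrow> p3 t \<noteq> s3\<^sup>2"
    and \<omega>: "continuous_on {0..1} \<omega>" "\<omega> 0 = 0" "exp (\<omega> 1 / 2) = q0"
      "t \<in> {0..1} \<Longrightarrow> - s2 + (s3 + s2) * exp (\<omega> t) \<notin> {0, s2}"
      "t \<in> {0<..1} \<Longrightarrow> (- s2 + (s3 + s2) * exp (\<omega> t))\<^sup>2 \<noteq> s3\<^sup>2"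
begin

definition "p2 t = - s2 + (s3 + s2) * exp (\<omega> t)"

lemma exp_\<omega>1: "exp (\<omega> 1) = (s1 + s2) / (s2 + s3)"
  unfolding q0_power2[symmetric] \<omega>(3)[symmetric] by (simp add: exp_double[symmetric])

lemma p2: "continuous_on {0..1} p2" "p2 0 = s3" "p2 1 = s1"
  "t \<in> {0..1} \<Longrightarrow> p2 t \<noteq> 0 \<and> p2 t \<noteq> s2 \<and> p2 t \<noteq> - s2"
  "t \<in> {0<..1} \<Longrightarrow> (p2 t)\<^sup>2 \<noteq> s3\<^sup>2"
proof -
  show "continuous_on {0..1} p2" unfolding p2_def by (intro continuous_intros \<omega>(1))
  show "p2 0 = s3" by (simp add: p2_def \<omega>(2))
  show "p2 1 = s1" using s_ne by (simp add: p2_def exp_\<omega>1 add.commute)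
  show "p2 t \<noteq> 0 \<and> p2 t \<noteq> s2 \<and> p2 t \<noteq> - s2" if "t \<in> {0..1}"
    using \<omega>(4)[OF that] s_ne by (auto simp: p2_def add.commute)
  show "(p2 t)\<^sup>2 \<noteq> s3\<^sup>2" if "t \<in> {0<..1}" using \<omega>(5)[OF that] by (simp add: p2_def)
qed

sublocale marked_paths a0 a1 a2 a3 v "\<lambda>t. M (Some ((p1 t)\<^sup>2))" "\<lambda>t. M (Some ((p2 t)\<^sup>2))" "\<lambda>t. M (Some (p3 t))"
proof
  show "continuous_map I01 P1 (\<lambda>t. M (Some ((p1 t)\<^sup>2)))" "continuous_map I01 P1 (\<lambda>t. M (Some ((p2 t)\<^sup>2)))"
    "continuous_map I01 P1 (\<lambda>t. M (Some (p3 t)))"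
    by (intro M_cont continuous_intros p1 p2 p3)+
  show "M (Some ((p1 0)\<^sup>2)) = a3" "M (Some ((p1 1)\<^sup>2)) = a0" "M (Some ((p2 0)\<^sup>2)) = a0" "M (Some ((p2 1)\<^sup>2)) = a2"
    "M (Some (p3 0)) = a2" "M (Some (p3 1)) = a3"
    by (simp_all add: p1 p2 p3 a_M)
  show "distinct [a0, a1, a2, a3, v]" by (rule distinct_a)
  show "M (Some ((p1 t)\<^sup>2)) \<notin> {v, a1}" if "t \<in> {0..1}" for t
    using p1(4)[OF that] by (simp add: M_eq v_def a_M(2))
  show "M (Some ((p2 t)\<^sup>2)) \<notin> {v, a1, a3}" if "t \<in> {0..1}" for t
    using p2(4)[OF that] by (simp add: M_eq v_def a_M power2_eq_iff)
  show "M (Some ((p2 t)\<^sup>2)) \<noteq> a0" if "t \<in> {0<..1}" for t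
    using p2(5)[OF that] by (simp add: M_eq a_M)
  show "M (Some (p3 t)) \<notin> {a0, a1}" if "t \<in> {0..1}" for t
    using p3(4)[OF that] by (simp add: M_eq a_M)
qed

text \<open>\<open>\<theta>\<close> is the coordinate of a lift of \<open>\<phi>\<close> through \<open>f\<close>.\<close>

context
  fixes \<phi> \<theta>
  assumes \<phi>: "homeomorphic_map P1 P1 \<phi>"
    and \<theta>: "continuous_on (- {0}) \<theta>" "\<And>z. z \<noteq> 0 \<Longrightarrow> \<theta> z \<noteq> 0"
    and lift: "\<And>z z'. z \<noteq> 0 \<Longrightarrow> z' \<noteq> 0 \<Longrightarrow>
      CR (\<phi> (M (Some (z\<^sup>2)))) (\<phi> (M (Some (z'\<^sup>2)))) (\<phi> v) (\<phi> a1) = (\<theta> z / \<theta> z')\<^sup>2"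
begin

lemma inj_\<phi>: "\<phi> p = \<phi> q \<longleftrightarrow> p = q"
  using \<phi> by (auto simp: homeomorphic_map_P1_iff bij_def inj_eq)

lemma \<phi>_fam: "fam (discrete_topology {()}) (\<lambda>_. \<phi>)"
  by (rule fam_const[OF \<phi>])

text \<open>Quotients of \<theta> are continuous, start at 1 and have the right squares, so by
  uniqueness they are the roots chosen by \<open>sq\<close>.\<close>

lemma sq_g_lift:
  assumes t: "t \<in> {0..1}"
  shows "sq (g1 \<phi>) t = \<theta> (p1 t) / \<theta> s2" "sq (g2 \<phi>) t = \<theta> (p2 t) / \<theta> s3"
proof -
  show "sq (g1 \<phi>) t = \<theta> (p1 t) / \<theta> s2"
  proof (rule sq_unique[OF _ _ _ _ t])
    show "continuous_on {0..1} (\<lambda>t. \<theta> (p1 t) / \<theta> s2)"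
      by (intro continuous_intros continuous_on_compose2[OF \<theta>(1) p1(1)]) (use p1(4) \<theta>(2) nz in auto)
    show "(\<theta> (p1 t) / \<theta> s2)\<^sup>2 = g1 \<phi> t" if "t \<in> {0..1}" for t
      unfolding g1_def unfolding a_M(4) by (rule lift[symmetric]) (use p1(4)[OF that] nz in auto)
    show "\<theta> (p1 t) / \<theta> s2 \<noteq> 0" if "t \<in> {0..1}" for t using \<theta>(2) p1(4)[OF that] nz by simp
  qed (use p1 \<theta>(2) nz in auto)
  show "sq (g2 \<phi>) t = \<theta> (p2 t) / \<theta> s3"
  proof (rule sq_unique[OF _ _ _ _ t])
    show "continuous_on {0..1} (\<lambda>t. \<theta> (p2 t) / \<theta> s3)"
      by (intro continuous_intros continuous_on_compose2[OF \<theta>(1) p2(1)]) (use p2(4) \<theta>(2) nz in auto)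
    show "(\<theta> (p2 t) / \<theta> s3)\<^sup>2 = g2 \<phi> t" if "t \<in> {0..1}" for t
      unfolding g2_def unfolding a_M(1) by (rule lift[symmetric]) (use p2(4)[OF that] nz in auto)
    show "\<theta> (p2 t) / \<theta> s3 \<noteq> 0" if "t \<in> {0..1}" for t using \<theta>(2) p2(4)[OF that] nz by simp
  qed (use p2 \<theta>(2) nz in auto)
qed

lemma \<theta>_nz: "\<theta> s1 \<noteq> 0" "\<theta> s2 \<noteq> 0" "\<theta> s3 \<noteq> 0"
  using \<theta>(2) nz by auto

lemma \<theta>_ne: "(\<theta> s1)\<^sup>2 \<noteq> (\<theta> s2)\<^sup>2" "(\<theta> s1)\<^sup>2 \<noteq> (\<theta> s3)\<^sup>2" "(\<theta> s2)\<^sup>2 \<noteq> (\<theta> s3)\<^sup>2"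
proof -
  have *: "(\<theta> z)\<^sup>2 \<noteq> (\<theta> z')\<^sup>2" if z: "z \<noteq> 0" "z' \<noteq> 0" "z\<^sup>2 \<noteq> z'\<^sup>2" for z z'
  proof
    assume "(\<theta> z)\<^sup>2 = (\<theta> z')\<^sup>2"
    then have "CR (\<phi> (M (Some (z\<^sup>2)))) (\<phi> (M (Some (z'\<^sup>2)))) (\<phi> v) (\<phi> a1) = 1"
      using lift[OF z(1,2)] \<theta>(2) z by (simp add: power_divide)
    then have "\<phi> (M (Some (z\<^sup>2))) = \<phi> (M (Some (z'\<^sup>2)))"
      by (rule CR_eq_1) (use distinct_a inj_\<phi> in auto)
    then show False using z by (simp add: inj_\<phi> M_eq)
  qed
  show "(\<theta> s1)\<^sup>2 \<noteq> (\<theta> s2)\<^sup>2" "(\<theta> s1)\<^sup>2 \<noteq> (\<theta> s3)\<^sup>2" "(\<theta> s2)\<^sup>2 \<noteq> (\<theta> s3)\<^sup>2"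
    by (rule *; use nz ne in simp)+
qed

lemma rr_lift:
  assumes t: "t \<in> {0..1}"
  shows "rr \<phi> t = (\<theta> (p2 t) + \<theta> s2) / (\<theta> s2 + \<theta> s3)"
proof -
  have r: "\<rho> \<phi> = \<theta> s3 / \<theta> s2" unfolding \<rho>_def using sq_g_lift(1)[of 1] by (simp add: p1(3))
  have s: "\<theta> s2 + \<theta> s3 \<noteq> 0" using \<theta>_ne(3) by (auto simp: power2_eq_iff eq_neg_iff_add_eq_0)
  have 1: "\<theta> (p2 t) / \<theta> s3 * (\<theta> s3 / \<theta> s2) + 1 = (\<theta> (p2 t) + \<theta> s2) / \<theta> s2"
    "\<theta> s3 / \<theta> s2 + 1 = (\<theta> s2 + \<theta> s3) / \<theta> s2"
    using \<theta>_nz by (simp_all add: add_divide_distrib)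
  show ?thesis unfolding rr_def r sq_g_lift(2)[OF t] 1 using \<theta>_nz s by simp
qed

lemma QQ_lift: "(QQ \<phi>)\<^sup>2 = (\<theta> s1 + \<theta> s2) / (\<theta> s2 + \<theta> s3)"
proof -
  have "(QQ \<phi>)\<^sup>2 = rr \<phi> 1"
    using exp_invariants(3)[OF \<phi>_fam, of "()"] by (simp add: rr_def)
  then show ?thesis using rr_lift[of 1] by (simp add: p2(3))
qed

lemma CR_lift: "CR (\<phi> a3) (\<phi> a2) (\<phi> a0) (\<phi> a1) = ((\<theta> s2)\<^sup>2 - (\<theta> s3)\<^sup>2) / ((\<theta> s1)\<^sup>2 - (\<theta> s3)\<^sup>2)"
proof -
  have "CR (\<phi> a3) (\<phi> a2) (\<phi> a0) (\<phi> a1) = (CR (\<phi> a3) (\<phi> a0) (\<phi> v) (\<phi> a1) - CR (\<phi> a0) (\<phi> a0) (\<phi> v) (\<phi> a1)) /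
     (CR (\<phi> a2) (\<phi> a0) (\<phi> v) (\<phi> a1) - CR (\<phi> a0) (\<phi> a0) (\<phi> v) (\<phi> a1))"
    by (rule CR_affine) (use distinct_a in \<open>auto simp: inj_\<phi>\<close>)
  also have "\<dots> = ((\<theta> s2 / \<theta> s3)\<^sup>2 - (\<theta> s3 / \<theta> s3)\<^sup>2) / ((\<theta> s1 / \<theta> s3)\<^sup>2 - (\<theta> s3 / \<theta> s3)\<^sup>2)"
  proof -
    have "CR (\<phi> a3) (\<phi> a0) (\<phi> v) (\<phi> a1) = (\<theta> s2 / \<theta> s3)\<^sup>2"
      unfolding a_M(4) a_M(1) by (rule lift[OF nz(2,3)])
    moreover have "CR (\<phi> a2) (\<phi> a0) (\<phi> v) (\<phi> a1) = (\<theta> s1 / \<theta> s3)\<^sup>2"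
      unfolding a_M(3) a_M(1) by (rule lift[OF nz(1,3)])
    moreover have "CR (\<phi> a0) (\<phi> a0) (\<phi> v) (\<phi> a1) = (\<theta> s3 / \<theta> s3)\<^sup>2"
      unfolding a_M(1) by (rule lift[OF nz(3,3)])
    ultimately show ?thesis by simp
  qed
  also have "\<dots> = ((\<theta> s2)\<^sup>2 - (\<theta> s3)\<^sup>2) / ((\<theta> s1)\<^sup>2 - (\<theta> s3)\<^sup>2)"
  proof -
    have "((\<theta> s2 / \<theta> s3)\<^sup>2 - (\<theta> s3 / \<theta> s3)\<^sup>2) = ((\<theta> s2)\<^sup>2 - (\<theta> s3)\<^sup>2) / (\<theta> s3)\<^sup>2"
      "((\<theta> s1 / \<theta> s3)\<^sup>2 - (\<theta> s3 / \<theta> s3)\<^sup>2) = ((\<theta> s1)\<^sup>2 - (\<theta> s3)\<^sup>2) / (\<theta> s3)\<^sup>2"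
      by (simp_all add: power_divide diff_divide_distrib)
    then show ?thesis using \<theta>_nz by simp
  qed
  finally show ?thesis .
qed

lemma exp_KK_lift: "exp (KK \<phi>) = ((\<theta> s2)\<^sup>2 - (\<theta> s3)\<^sup>2) / ((\<theta> s1)\<^sup>2 - (\<theta> s3)\<^sup>2)"
  using exp_invariants(2)[OF \<phi>_fam, of "()"] CR_lift by simp

end

text \<open>The rational map inherits from \<open>f\<close> its two totally ramified values and its
  fibres, hence is squaring in the coordinate \<theta> taken from \<psi>. Equality of the classes on
  \<open>A\<close> allows the cross ratio of \<phi> to be computed from \<psi> as well, which gives
  the two expressions of \<open>square_relation\<close>.\<close>

lemma Def_space_relation:
  assumes \<phi>: "\<phi> \<in> homeo_plus" and \<psi>: "\<psi> \<in> homeo_plus" and F: "rational_map (\<phi> \<circ> f \<circ> inv \<psi>)"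
    and A: "teich_class A \<psi> = teich_class A \<phi>" "{a0, a1, a2, a3} \<subseteq> A"
  shows "(QQ \<phi> * exp (KK \<phi>) / (1 - exp (KK \<phi>)))\<^sup>2 = 1"
proof -
  have h\<phi>: "homeomorphic_map P1 P1 \<phi>" and h\<psi>: "homeomorphic_map P1 P1 \<psi>" using \<phi> \<psi> by (simp_all add: homeo_plus_def)
  have i\<phi>: "\<phi> p = \<phi> q \<longleftrightarrow> p = q" and i\<psi>: "\<psi> p = \<psi> q \<longleftrightarrow> p = q" for p q
    using h\<phi> h\<psi> by (auto simp: homeomorphic_map_P1_iff bij_def inj_eq)
  have b\<psi>: "bij \<psi>" using h\<psi> by (simp add: homeomorphic_map_P1_iff)
  let ?F = "\<phi> \<circ> f \<circ> inv \<psi>"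
  have F\<psi>: "?F (\<psi> w) = \<phi> (f w)" for w using b\<psi> by (simp add: bij_def)
  have surj: "\<exists>u. w = \<psi> u" for w using b\<psi> by (metis bij_pointE)
  define c' where "c' = N (Some 0)"
  have sq: "CR (\<phi> (f w)) (\<phi> (f w0)) (\<phi> v) (\<phi> a1) = (CR (\<psi> w) (\<psi> w0) (\<psi> c') (\<psi> a0))\<^sup>2"
    if w: "w \<noteq> a0" "w \<noteq> c'" "w0 \<noteq> a0" "w0 \<noteq> c'" for w w0
  proof -
    have "CR (?F (\<psi> w)) (?F (\<psi> w0)) (\<phi> v) (\<phi> a1) = (CR (\<psi> w) (\<psi> w0) (\<psi> c') (\<psi> a0))\<^sup>2"
    proof (rule rational_map_squaring[OF F])
      show "?F u = \<phi> a1 \<longleftrightarrow> u = \<psi> a0" for u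
        using surj[of u] F\<psi> by (auto simp: i\<phi> i\<psi> f_fibre_a1 simp del: o_apply)
      show "?F u = \<phi> v \<longleftrightarrow> u = \<psi> c'" for u
        using surj[of u] F\<psi> by (auto simp: i\<phi> i\<psi> f_fibre_v c'_def simp del: o_apply)
      show "\<psi> a0 \<noteq> \<psi> c'" by (simp add: i\<psi> a0_def c'_def N_eq)
      show "w1 = w2 \<or> w2 = w3 \<or> w1 = w3" if "?F w1 = ?F w2" "?F w2 = ?F w3" for w1 w2 w3
      proof -
        obtain u1 u2 u3 where u: "w1 = \<psi> u1" "w2 = \<psi> u2" "w3 = \<psi> u3" using surj by metis
        have "f u1 = f u2" "f u2 = f u3" using that unfolding u F\<psi> by (simp_all add: i\<phi>)
        then show ?thesis using f_fibre_card[of u1 u2 u3] u by auto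
      qed
      \<comment> \<open>A fibre with two points: 1 and -1 have the same square.\<close>
      show "?F (\<psi> (N (Some 1))) = ?F (\<psi> (N (Some (-1))))" unfolding F\<psi> by (simp add: f_N)
      show "\<psi> (N (Some 1)) \<noteq> \<psi> (N (Some (-1)))" by (simp add: i\<psi> N_eq)
    qed (use w in \<open>auto simp: i\<psi>\<close>)
    then show ?thesis unfolding F\<psi> .
  qed
  define \<theta> where "\<theta> z = CR (\<psi> (N (Some z))) (\<psi> a3) (\<psi> c') (\<psi> a0)" for z
  have N0: "N (Some z) \<noteq> a0" "N (Some z) = c' \<longleftrightarrow> z = 0" for z by (simp_all add: a0_def c'_def N_eq)
  have a3: "a3 \<noteq> a0" "a3 \<noteq> c'" using nz by (simp_all add: a3_def a0_def c'_def N_eq)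
  have \<theta>nz: "\<theta> z \<noteq> 0" if "z \<noteq> 0" for z
    unfolding \<theta>_def by (rule notI, drule CR_eq_0) (use that N0 a3 in \<open>auto simp: i\<psi>\<close>)
  have \<theta>c: "continuous_on (- {0}) \<theta>"
  proof -
    have "continuous_map (top_of_set (- {0})) P1 (\<lambda>z. Some z :: complex option)"
      by (rule continuous_map_Some) simp
    moreover have "continuous_map P1 P1 N"
      using homeomorphic_map_mob[OF detN] by (simp add: N_def homeomorphic_map_P1_iff)
    ultimately have "continuous_map (top_of_set (- {0})) P1 (N \<circ> (\<lambda>z. Some z))" by (rule continuous_map_compose)
    moreover have "continuous_map P1 P1 \<psi>" using h\<psi> by (simp add: homeomorphic_map_P1_iff)
    ultimately have "continuous_map (top_of_set (- {0})) P1 (\<psi> \<circ> (N \<circ> (\<lambda>z. Some z)))" by (rule continuous_map_compose)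
    then have "continuous_map (top_of_set (- {0})) P1 (\<lambda>z. \<psi> (N (Some z)))" by (simp add: o_def)
    then have "continuous_map (top_of_set (- {0})) euclidean \<theta>"
      unfolding \<theta>_def by (rule continuous_map_CR) (use N0 a3 in \<open>auto simp: i\<psi>\<close>)
    then show ?thesis by simp
  qed
  have \<theta>\<theta>: "CR (\<psi> (N (Some z))) (\<psi> (N (Some z'))) (\<psi> c') (\<psi> a0) = \<theta> z / \<theta> z'" if "z \<noteq> 0" "z' \<noteq> 0" for z z'
  proof -
    have "CR (\<psi> (N (Some z))) (\<psi> (N (Some z'))) (\<psi> c') (\<psi> a0) * \<theta> z' = \<theta> z"
      unfolding \<theta>_def by (rule CR_mult) (use that N0 in \<open>auto simp: i\<psi>\<close>)
    then show ?thesis using \<theta>nz[OF that(2)] by (simp add: field_simps)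
  qed
  have lift: "CR (\<phi> (M (Some (z\<^sup>2)))) (\<phi> (M (Some (z'\<^sup>2)))) (\<phi> v) (\<phi> a1) = (\<theta> z / \<theta> z')\<^sup>2" if "z \<noteq> 0" "z' \<noteq> 0" for z z'
    using sq[of "N (Some z)" "N (Some z')"] that N0 by (simp add: f_N \<theta>\<theta>)
  have x1: "exp (KK \<phi>) = ((\<theta> s2)\<^sup>2 - (\<theta> s3)\<^sup>2) / ((\<theta> s1)\<^sup>2 - (\<theta> s3)\<^sup>2)"
    by (rule exp_KK_lift[OF h\<phi> \<theta>c \<theta>nz lift])
  have x2: "exp (KK \<phi>) = (\<theta> s2 - \<theta> s1) / (\<theta> s3 - \<theta> s1)"
  proof -
    have "\<psi> \<in> teich_class A \<phi>" using teich_class_self[OF \<psi>] A(1) by blast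
    then obtain \<nu> where \<nu>: "mobius \<nu>" "\<And>p. p \<in> A \<Longrightarrow> \<nu> (\<phi> p) = \<psi> p"
      by (auto simp: teich_class_def teich_equiv_def)
    obtain a b c d where n: "a * d - b * c \<noteq> 0" "\<nu> = mob a b c d" by (rule mobius_imp_mob[OF \<nu>(1)])
    have "CR (\<nu> (\<phi> a3)) (\<nu> (\<phi> a2)) (\<nu> (\<phi> a0)) (\<nu> (\<phi> a1)) = CR (\<phi> a3) (\<phi> a2) (\<phi> a0) (\<phi> a1)"
      unfolding n(2) by (rule CR_mob[OF n(1)])
    then have "CR (\<psi> a3) (\<psi> a2) (\<psi> a0) (\<psi> a1) = CR (\<phi> a3) (\<phi> a2) (\<phi> a0) (\<phi> a1)"
      using \<nu>(2) A(2) by simp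
    then have "exp (KK \<phi>) = CR (\<psi> a3) (\<psi> a2) (\<psi> a0) (\<psi> a1)"
      using exp_invariants(2)[OF \<phi>_fam[OF h\<phi> \<theta>c \<theta>nz lift], of "()"] by simp
    \<comment> \<open>The symmetry of the cross ratio moves the pole to \<open>a0\<close>, where
      \<theta> has its pole.\<close>
    also have "\<dots> = CR (\<psi> a2) (\<psi> a3) (\<psi> a1) (\<psi> a0)" by (rule CR_swap)
    also have "\<dots> = (CR (\<psi> a2) (\<psi> a3) (\<psi> c') (\<psi> a0) - CR (\<psi> a1) (\<psi> a3) (\<psi> c') (\<psi> a0)) /
        (CR (\<psi> a3) (\<psi> a3) (\<psi> c') (\<psi> a0) - CR (\<psi> a1) (\<psi> a3) (\<psi> c') (\<psi> a0))"
      by (rule CR_affine) (use distinct_a a3 in \<open>auto simp: i\<psi> c'_def a0_def N_eq\<close>)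
    also have "\<dots> = (\<theta> s2 - \<theta> s1) / (\<theta> s3 - \<theta> s1)" by (simp add: \<theta>_def a1_def a2_def a3_def)
    finally show ?thesis .
  qed
  show ?thesis
    by (rule square_relation[OF \<theta>_ne[OF h\<phi> \<theta>c \<theta>nz lift] x1 x2 QQ_lift[OF h\<phi> \<theta>c \<theta>nz lift]])
qed

end

section \<open>Elements of the deformation space from loops\<close>

lemma fam_imp_homeo_plus:
  assumes H: "fam I01 H" "H 0 = id"
  shows "H 1 \<in> homeo_plus"
proof -
  have "isotopic_rel {} id (H 1)" unfolding isotopic_rel_iff using H by (intro exI[of _ H]) auto
  then have "homotopic_with (\<lambda>_. True) P1 P1 id (H 1)"
    unfolding isotopic_rel_def by (rule homotopic_with_mono) auto
  then show ?thesis using fam_homeomorphic_map[OF H(1), of 1] by (simp add: homeo_plus_def homotopic_with_sym)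
qed

lemma isotopic_rel_reverse:
  assumes H: "fam I01 H" "H 0 = id" "H 1 = \<phi>" and fixed: "\<And>t p. t \<in> {0..1} \<Longrightarrow> p \<in> A \<Longrightarrow> H t p = p"
  shows "isotopic_rel A \<phi> id"
  unfolding isotopic_rel_iff
proof (intro exI conjI ballI)
  show "fam I01 (\<lambda>t. H (1 - t))"
    by (rule fam_reparam[OF H(1)]) (auto simp: continuous_map_in_subtopology intro!: continuous_intros)
qed (use H fixed in auto)

lemma isotopic_rel_trans:
  assumes "isotopic_rel A \<phi> \<psi>" "isotopic_rel A \<psi> \<omega>" "\<And>p. p \<in> A \<Longrightarrow> \<psi> p = \<omega> p"
  shows "isotopic_rel A \<phi> \<omega>"
proof -
  have "homotopic_with (\<lambda>h. homeomorphic_map P1 P1 h \<and> (\<forall>x\<in>A. h x = \<omega> x)) P1 P1 \<phi> \<psi>"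
    by (rule homotopic_with_mono[OF assms(1)[unfolded isotopic_rel_def]]) (use assms(3) in auto)
  from homotopic_with_trans[OF this assms(2)[unfolded isotopic_rel_def]] show ?thesis
    by (simp add: isotopic_rel_def)
qed

lemma teich_class_isotopic_id:
  assumes iso: "isotopic_rel A \<psi> id"
  shows "teich_class A \<psi> = teich_class A id"
proof -
  obtain H where H: "fam I01 H" "H 0 = \<psi>" "H 1 = id" "\<And>t p. t \<in> {0..1} \<Longrightarrow> p \<in> A \<Longrightarrow> H t p = p"
    using iso unfolding isotopic_rel_iff by auto
  have \<psi>A: "\<psi> p = p" if "p \<in> A" for p using H(2) H(4)[of 0 p] that by auto
  have "teich_equiv A \<psi> \<omega> \<longleftrightarrow> teich_equiv A id \<omega>" for \<omega>
  proof -
    have "(\<forall>p\<in>A. \<nu> (\<psi> p) = \<omega> p) \<and> isotopic_rel A (\<nu> \<circ> \<psi>) \<omega> \<longleftrightarrow> (\<forall>p\<in>A. \<nu> p = \<omega> p) \<and> isotopic_rel A \<nu> \<omega>"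
      if \<nu>: "mobius \<nu>" for \<nu>
    proof (cases "\<forall>p\<in>A. \<nu> p = \<omega> p")
      case True
      obtain a b c d where n: "a * d - b * c \<noteq> 0" "\<nu> = mob a b c d" by (rule mobius_imp_mob[OF \<nu>])
      have h: "homeomorphic_map P1 P1 \<nu>" unfolding n(2) by (rule homeomorphic_map_mob[OF n(1)])
      have f1: "fam I01 (\<lambda>t. \<nu> \<circ> H t)" by (intro fam_compose fam_const h H(1))
      have 1: "isotopic_rel A (\<nu> \<circ> \<psi>) \<nu>"
        unfolding isotopic_rel_iff
        by (rule exI[of _ "\<lambda>t. \<nu> \<circ> H t"]) (use H f1 in auto)
      have 2: "isotopic_rel A \<nu> (\<nu> \<circ> \<psi>)"
        unfolding isotopic_rel_iff
      proof (rule exI[of _ "\<lambda>t. \<nu> \<circ> H (1 - t)"], intro conjI ballI)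
        show "fam I01 (\<lambda>t. \<nu> \<circ> H (1 - t))"
          by (intro fam_compose fam_const h fam_reparam[OF H(1)])
            (auto simp: continuous_map_in_subtopology intro!: continuous_intros)
      qed (use H \<psi>A in auto)
      have "isotopic_rel A (\<nu> \<circ> \<psi>) \<omega> \<longleftrightarrow> isotopic_rel A \<nu> \<omega>"
      proof
        assume "isotopic_rel A \<nu> \<omega>"
        then show "isotopic_rel A (\<nu> \<circ> \<psi>) \<omega>" by (rule isotopic_rel_trans[OF 1]) (use True in simp)
      next
        assume "isotopic_rel A (\<nu> \<circ> \<psi>) \<omega>"
        then show "isotopic_rel A \<nu> \<omega>" by (rule isotopic_rel_trans[OF 2]) (use True \<psi>A in simp)
      qed
      then show ?thesis using True \<psi>A by auto
    next
      case False
      then show ?thesis using \<psi>A by auto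
    qed
    then show ?thesis unfolding teich_equiv_def by auto
  qed
  then show ?thesis by (simp add: teich_class_def)
qed

lemma mob_conj_id:
  assumes "a * d - b * c \<noteq> 0"
  shows "mob a b c d \<circ> mob d (-b) (-c) a = id" "mob d (-b) (-c) a \<circ> mob a b c d = id"
  using mob_inverse[OF assms] by (auto simp: fun_eq_iff)

lemma fam_mob_conj:
  assumes "fam X \<Phi>" "a * d - b * c \<noteq> 0"
  shows "fam X (\<lambda>t. mob a b c d \<circ> \<Phi> t \<circ> mob d (-b) (-c) a)"
  by (intro fam_compose fam_const homeomorphic_map_mob assms(1)) (use assms(2) in \<open>simp_all add: mult.commute\<close>)

lemma isotopic_rel_mob_conj:
  assumes iso: "isotopic_rel X h id" and n: "a * d - b * c \<noteq> 0"
  shows "isotopic_rel (mob a b c d ` X) (mob a b c d \<circ> h \<circ> mob d (-b) (-c) a) id"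
proof -
  obtain H where H: "fam I01 H" "H 0 = h" "H 1 = id" "\<And>t p. t \<in> {0..1} \<Longrightarrow> p \<in> X \<Longrightarrow> H t p = p"
    using iso unfolding isotopic_rel_iff by auto
  show ?thesis unfolding isotopic_rel_iff
    by (rule exI[of _ "\<lambda>t. mob a b c d \<circ> H t \<circ> mob d (-b) (-c) a"])
      (use H fam_mob_conj[OF H(1) n] mob_conj_id[OF n] mob_inverse[OF n] in auto)
qed

lemma csqrt_power2_cases: "csqrt (z\<^sup>2) = z \<or> csqrt (z\<^sup>2) = - z"
  by (metis power2_csqrt power2_eq_iff)

section \<open>Descent through squaring and realisation of loops\<close>

lemma descend_odd:
  fixes G :: "real \<Rightarrow> complex \<Rightarrow> complex"
  assumes cont: "continuous_on (T \<times> UNIV) (\<lambda>(t, z). G t z)" and bij: "\<And>t. t \<in> T \<Longrightarrow> bij (G t)"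
    and far: "\<And>t z. t \<in> T \<Longrightarrow> R \<le> cmod z \<Longrightarrow> G t z = z" and odd: "\<And>t z. t \<in> T \<Longrightarrow> G t (- z) = - G t z"
  defines "D \<equiv> \<lambda>t w. (G t (csqrt w))\<^sup>2"
  shows "\<And>t z. t \<in> T \<Longrightarrow> D t (z\<^sup>2) = (G t z)\<^sup>2"
    and "fam (top_of_set T) (\<lambda>t. map_option (D t))"
proof -
  show D: "D t (z\<^sup>2) = (G t z)\<^sup>2" if "t \<in> T" for t z
    unfolding D_def using csqrt_power2_cases[of z] odd[OF that] by auto
  \<comment> \<open>The second branch of the square root, with its cut on the positive axis. Oddness
    makes \<open>D\<close> independent of the branch, so \<open>D\<close> is continuous wherever one
    of the two branches is.\<close>
  have D': "D t w = (G t (\<i> * csqrt (- w)))\<^sup>2" if "t \<in> T" for t w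
  proof -
    have "w = (\<i> * csqrt (- w))\<^sup>2" by (simp add: power_mult_distrib)
    then show ?thesis using D[OF that] by metis
  qed
  show "fam (top_of_set T) (\<lambda>t. map_option (D t))"
  proof (rule fam_map_option)
    show "continuous_on (T \<times> UNIV) (\<lambda>(t, z). D t z)"
    proof -
      have "continuous (at w within T \<times> UNIV) (\<lambda>(t, z). D t z)" if w: "w \<in> T \<times> UNIV" for w
      proof -
        have csq: "isCont csqrt z \<or> isCont (\<lambda>z. \<i> * csqrt (- z)) z" for z :: complex
        proof (cases "z \<in> \<real>\<^sub>\<le>\<^sub>0")
          case False
          then show ?thesis by (simp add: continuous_at_csqrt)
        next
          case True
          show ?thesis
          proof (cases "z = 0")
            case True
            have "(csqrt \<longlongrightarrow> 0) (at 0)"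
            proof (rule tendsto_norm_zero_cancel)
              have "((\<lambda>w. sqrt (cmod w)) \<longlongrightarrow> sqrt (cmod 0)) (at 0)" by (intro tendsto_intros)
              then show "((\<lambda>w. cmod (csqrt w)) \<longlongrightarrow> 0) (at 0)" by (simp add: norm_csqrt)
            qed
            then show ?thesis using True by (simp add: isCont_def)
          next
            case False
            then have "- z \<notin> \<real>\<^sub>\<le>\<^sub>0" using True by (auto simp: complex_nonpos_Reals_iff complex_eq_iff)
            then have "isCont (\<lambda>z. \<i> * csqrt (- z)) z"
              by (intro continuous_intros isCont_csqrt')
            then show ?thesis by blast
          qed
        qed
        have key: "continuous (at w within T \<times> UNIV) (\<lambda>u. (G (fst u) (g (snd u)))\<^sup>2)" if g: "isCont g (snd w)" for g
        proof -
          have "continuous (at w within T \<times> UNIV) (\<lambda>u. g (snd u))"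
            by (rule continuous_within_compose3[where g = g and f = snd and x = w, OF g]) (intro continuous_intros)
          then have "continuous (at w within T \<times> UNIV) (\<lambda>u. (fst u, g (snd u)))"
            by (intro continuous_intros)
          moreover have "continuous (at (fst w, g (snd w)) within T \<times> UNIV) (\<lambda>(t, z). G t z)"
            using cont w by (auto simp: continuous_on_eq_continuous_within)
          ultimately have "continuous (at w within T \<times> UNIV) ((\<lambda>(t, z). G t z) \<circ> (\<lambda>u. (fst u, g (snd u))))"
            by (intro continuous_within_compose) (auto intro: continuous_within_subset)
          then show ?thesis by (intro continuous_intros) (simp add: o_def)
        qed
        from csq[of "snd w"] show ?thesis
        proof
          assume "isCont csqrt (snd w)"
          from key[OF this] show ?thesis by (simp add: D_def case_prod_unfold)
        next
          assume "isCont (\<lambda>z. \<i> * csqrt (- z)) (snd w)"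
          from key[OF this] show ?thesis
            by (rule continuous_transform_within[OF _ zero_less_one w]) (use D' in auto)
        qed
      qed
      then show ?thesis by (simp add: continuous_on_eq_continuous_within)
    qed
    show "bij (D t)" if t: "t \<in> T" for t
    proof (rule bijI)
      show "inj (D t)"
      proof (rule injI)
        fix w w' assume "D t w = D t w'"
        then have "G t (csqrt w) = G t (csqrt w') \<or> G t (csqrt w) = G t (- csqrt w')"
          using odd[OF t] by (simp add: D_def power2_eq_iff)
        then have "csqrt w = csqrt w' \<or> csqrt w = - csqrt w'"
          using bij[OF t] by (simp add: bij_def inj_eq)
        then show "w = w'" by (metis power2_csqrt power2_minus)
      qed
      have "w \<in> range (D t)" for w
      proof -
        obtain z where "csqrt w = G t z" using bij[OF t] by (metis bij_pointE)
        then have "w = D t (z\<^sup>2)" using D[OF t, of z] by (metis power2_csqrt)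
        then show ?thesis by blast
      qed
      then show "surj (D t)" by blast
    qed
    show "D t w = w" if t: "t \<in> T" "(max R 0)\<^sup>2 \<le> cmod w" for t w
    proof -
      have "max R 0 \<le> sqrt (cmod w)" by (rule real_le_rsqrt[OF t(2)])
      then have "R \<le> cmod (csqrt w)" using max.cobounded1[of R 0] unfolding norm_csqrt by linarith
      then show ?thesis using far[OF t(1)] by (simp add: D_def)
    qed
  qed
qed

context normal_form
begin

text \<open>The conic \<open>s2^2 - s3^2 = x * (s1^2 - s3^2)\<close>, parametrised by the slope
  \<open>y = (s2 - s1) / (s3 - s1)\<close> of its lines through \<open>(1, 1, 1)\<close>.\<close>

definition "S1 y = y\<^sup>2 - (1 - x)"
definition "S2 y = - (y\<^sup>2 - 2 * (1 - x) * y + (1 - x))"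
definition "S3 y = y\<^sup>2 - 2 * y + (1 - x)"

text \<open>The scale that gives \<open>S3 x - S1 x\<close> the length \<open>s3 - s1\<close>, so
  that the parameter value x returns the given cycle.\<close>

definition "\<mu> = (s3 - s1) / (2 * (1 - 2 * x))"

text \<open>As x is neither 0 nor 1, these factorisations show that the three numbers are distinct
  up to sign iff y avoids 0, 1 and 1 - x; at y = 1 - x the first and third coincide.\<close>

lemma conic_id:
  "S1 y + S2 y = 2 * (1 - x) * (y - 1)" "S1 y - S2 y = 2 * y * (y - (1 - x))"
  "S1 y - S3 y = 2 * (y - (1 - x))" "S1 y + S3 y = 2 * y * (y - 1)"
  "S2 y - S3 y = - 2 * (y - 1) * (y - (1 - x))" "S2 y + S3 y = - 2 * x * y"
  unfolding S1_def S2_def S3_def by algebra+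

lemma \<mu>: "\<mu> \<noteq> 0" "s1 = \<mu> * S1 x" "s2 = \<mu> * S2 x" "s3 = \<mu> * S3 x"
proof -
  have d: "2 * (1 - 2 * x) \<noteq> 0" using x_ne(3) by simp
  show "\<mu> \<noteq> 0" unfolding \<mu>_def using d s_ne by simp
  have m: "s3 - s1 = 2 * (1 - 2 * x) * \<mu>" using d by (simp add: \<mu>_def)
  have m2: "s2 - s1 = x * (s3 - s1)" unfolding x_eq using s_ne by simp
  have c: "s2\<^sup>2 - s3\<^sup>2 = x * (s1\<^sup>2 - s3\<^sup>2)" unfolding x_def using ne by simp
  define e where "e = s3 - s1"
  have s: "s3 = s1 + e" "s2 = s1 + x * e" using m2 by (simp_all add: e_def algebra_simps)
  \<comment> \<open>The equation of the conic in terms of \<open>s1\<close> and \<open>e\<close>: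
    the factor \<open>e\<close> splits off and leaves an equation linear in
    \<open>s1\<close>.\<close>
  have "e * (s1 * (4 * x - 2) - e * (1 - x - x\<^sup>2)) = (s1 + x * e)\<^sup>2 - (s1 + e)\<^sup>2 - x * (s1\<^sup>2 - (s1 + e)\<^sup>2)" by algebra
  also have "\<dots> = 0" unfolding s[symmetric] using c by simp
  finally have "s1 * (4 * x - 2) - e * (1 - x - x\<^sup>2) = 0" using s_ne by (simp add: e_def)
  then have e: "s1 * (4 * x - 2) = e * (1 - x - x\<^sup>2)" by (simp only: right_minus_eq)
  have "2 * (1 - 2 * x) * (s1 - \<mu> * S1 x) = - (s1 * (4 * x - 2)) - (2 * (1 - 2 * x) * \<mu>) * S1 x" by algebra
  also have "\<dots> = - (e * (1 - x - x\<^sup>2)) - e * S1 x" unfolding e m[symmetric] e_def ..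
  also have "\<dots> = 0" unfolding S1_def by algebra
  finally show s1: "s1 = \<mu> * S1 x" using d by simp
  have "s2 = s1 + x * (s3 - s1)" using m2 by (simp only: m2[symmetric]) simp
  also have "\<dots> = s1 + x * (2 * (1 - 2 * x) * \<mu>)" by (simp only: m)
  also have "\<dots> = \<mu> * S1 x + x * (2 * (1 - 2 * x) * \<mu>)" using s1 by simp
  also have "\<dots> = \<mu> * S2 x" unfolding S1_def S2_def by algebra
  finally show "s2 = \<mu> * S2 x" .
  have "s3 = s1 + 2 * (1 - 2 * x) * \<mu>" using m by (simp add: algebra_simps)
  also have "\<dots> = \<mu> * S1 x + 2 * (1 - 2 * x) * \<mu>" using s1 by simp
  also have "\<dots> = \<mu> * S3 x" unfolding S1_def S3_def by algebra
  finally show "s3 = \<mu> * S3 x" .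
qed

end

context normal_form_paths
begin

text \<open>At the identity \<theta> is the identity function, so \<open>rr\<close> is the
  exponential of \<omega>, and halving \<omega> gives the root that starts at 1.\<close>

lemma QQ_id: "QQ id = q0"
proof -
  have "sq (rr id) 1 = exp (\<omega> 1 / 2)"
  proof (rule sq_unique)
    show "continuous_on {0..1} (\<lambda>t. exp (\<omega> t / 2))" by (intro continuous_intros \<omega>(1)) auto
    show "(exp (\<omega> t / 2))\<^sup>2 = rr id t" if t: "t \<in> {0..1}" for t
    proof -
      have "rr id t = (p2 t + s2) / (s2 + s3)"
      proof (rule rr_lift[where \<theta> = "\<lambda>z. z", OF _ _ _ _ t])
        show "homeomorphic_map P1 P1 id" by (simp add: homeomorphic_map_P1_iff)
        show "CR (id (M (Some (z\<^sup>2)))) (id (M (Some (z'\<^sup>2)))) (id v) (id a1) = (z / z')\<^sup>2" if "z \<noteq> 0" "z' \<noteq> 0" for z z'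
        proof -
          have "CR (M (Some (z\<^sup>2))) (M (Some (z'\<^sup>2))) v a1 = CR (Some (z\<^sup>2)) (Some (z'\<^sup>2)) (Some 0) None"
            unfolding v_def a_M(2) unfolding M_def by (rule CR_mob[OF detM])
          then show ?thesis by (simp add: CR_def br_def power_divide)
        qed
      qed auto
      also have "\<dots> = exp (\<omega> t)" using s_ne by (simp add: p2_def add.commute)
      finally show ?thesis by (simp add: exp_double[symmetric])
    qed
  qed (use \<omega>(2) in auto)
  then show ?thesis by (simp add: QQ_def \<omega>(3))
qed

text \<open>Along the motion x is constant, x' is \<open>y t\<close> and \<open>QQ\<close> is
  \<open>q t\<close>. Both end maps turn out to be isotopic to the identity rel \<open>A\<close>,
  for different reasons: for the target because x is constant, for the source because the loop of x'
  contracts by \<open>H\<close>. The branch of \<open>LL\<close> nevertheless advances by the change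
  of \<eta>.\<close>

lemma realize_loop:
  fixes y q \<eta> :: "real \<Rightarrow> complex" and H :: "real \<times> real \<Rightarrow> complex"
  assumes F: "rational_map f"
    and y: "continuous_on {0..1} y" "y 0 = x" "y 1 = x"
      "\<And>t. t \<in> {0..1} \<Longrightarrow> y t \<noteq> 0 \<and> y t \<noteq> 1 \<and> y t \<noteq> 1 - x \<and> S1 (y t) \<noteq> 0 \<and> S2 (y t) \<noteq> 0 \<and> S3 (y t) \<noteq> 0"
    and q: "continuous_on {0..1} q" "q 0 = q0" "q 1 = q0"
      "\<And>t. t \<in> {0..1} \<Longrightarrow> q t \<noteq> 0 \<and> (q t)\<^sup>2 = (1 - x) * (1 - y t) / (x * y t)"
    and \<eta>: "continuous_on {0..1} \<eta>" "\<And>t. t \<in> {0..1} \<Longrightarrow> exp (\<eta> t) = 1 + q t"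
    and H: "continuous_on ({0..1} \<times> {0..1}) H" "\<And>w. w \<in> {0..1} \<times> {0..1} \<Longrightarrow> H w \<noteq> 0 \<and> H w \<noteq> 1"
      "\<And>t. t \<in> {0..1} \<Longrightarrow> H (0, t) = y t" "\<And>t. t \<in> {0..1} \<Longrightarrow> H (1, t) = x"
      "\<And>s. s \<in> {0..1} \<Longrightarrow> H (s, 0) = x" "\<And>s. s \<in> {0..1} \<Longrightarrow> H (s, 1) = x"
    and A: "A = {a0, a1, a2, a3}"
  shows "\<exists>\<phi>\<in>homeo_plus. teich_class B \<phi> \<in> Def_space B A f \<and>
    QQ \<phi> * exp (KK \<phi>) / (1 - exp (KK \<phi>)) = 1 \<and> LL \<phi> + KK \<phi> = LL id + KK id + (\<eta> 1 - \<eta> 0)"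
proof -
  define r1 where "r1 t = \<mu> * S1 (y t)" for t
  define r2 where "r2 t = \<mu> * S2 (y t)" for t
  define r3 where "r3 t = \<mu> * S3 (y t)" for t
  have r_cont: "continuous_on {0..1} r1" "continuous_on {0..1} r2" "continuous_on {0..1} r3"
    unfolding r1_def r2_def r3_def S1_def S2_def S3_def by (intro continuous_intros y(1))+
  have r_ends: "r1 0 = s1" "r2 0 = s2" "r3 0 = s3" "r1 1 = s1" "r2 1 = s2" "r3 1 = s3"
    using \<mu> y(2,3) by (simp_all add: r1_def r2_def r3_def)
  have r_id: "r1 t + r2 t = \<mu> * (2 * (1 - x) * (y t - 1))" "r1 t - r2 t = \<mu> * (2 * y t * (y t - (1 - x)))"
    "r1 t - r3 t = \<mu> * (2 * (y t - (1 - x)))" "r1 t + r3 t = \<mu> * (2 * y t * (y t - 1))"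
    "r2 t - r3 t = \<mu> * (- 2 * (y t - 1) * (y t - (1 - x)))" "r2 t + r3 t = \<mu> * (- 2 * x * y t)" for t
    unfolding r1_def r2_def r3_def conic_id[symmetric] by (simp_all add: algebra_simps)
  have r_nz: "r1 t \<noteq> 0" "r2 t \<noteq> 0" "r3 t \<noteq> 0" "r1 t + r2 t \<noteq> 0" "r1 t - r2 t \<noteq> 0" "r1 t - r3 t \<noteq> 0"
    "r1 t + r3 t \<noteq> 0" "r2 t - r3 t \<noteq> 0" "r2 t + r3 t \<noteq> 0" if "t \<in> {0..1}" for t
  proof -
    have "y t \<noteq> 0" "y t - 1 \<noteq> 0" "y t - (1 - x) \<noteq> 0" using y(4)[OF that] by auto
    then show "r1 t + r2 t \<noteq> 0" "r1 t - r2 t \<noteq> 0" "r1 t - r3 t \<noteq> 0" "r1 t + r3 t \<noteq> 0" "r2 t - r3 t \<noteq> 0" "r2 t + r3 t \<noteq> 0"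
      unfolding r_id using \<mu>(1) x_ne(1,2) by (simp_all only: mult_eq_0_iff) simp_all
    show "r1 t \<noteq> 0" "r2 t \<noteq> 0" "r3 t \<noteq> 0" using y(4)[OF that] \<mu>(1) by (simp_all add: r1_def r2_def r3_def)
  qed
  have r_x: "(r2 t)\<^sup>2 - (r3 t)\<^sup>2 = x * ((r1 t)\<^sup>2 - (r3 t)\<^sup>2)" for t
  proof -
    have "(r2 t)\<^sup>2 - (r3 t)\<^sup>2 = (r2 t - r3 t) * (r2 t + r3 t)" by algebra
    also have "\<dots> = x * ((r1 t - r3 t) * (r1 t + r3 t))" unfolding r_id by algebra
    also have "(r1 t - r3 t) * (r1 t + r3 t) = (r1 t)\<^sup>2 - (r3 t)\<^sup>2" by algebra
    finally show ?thesis .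
  qed
  have r_y: "r2 t - r1 t = y t * (r3 t - r1 t)" for t
  proof -
    have "r1 t - r2 t = y t * (r1 t - r3 t)" unfolding r_id by algebra
    then show ?thesis by algebra
  qed

  \<comment> \<open>The labels are signed so that negation of labels is negation of points. The
    origin is fixed by oddness alone.\<close>
  define I :: "int set" where "I = {-3, -2, -1, 1, 2, 3}"
  define p where "p t i = (if i = 1 then r1 t else if i = 2 then r2 t else if i = 3 then r3 t
    else if i = -1 then - r1 t else if i = -2 then - r2 t else - r3 t)" for t and i :: int
  have p_simps: "p t 1 = r1 t" "p t 2 = r2 t" "p t 3 = r3 t" "p t (-1) = - r1 t" "p t (-2) = - r2 t" "p t (-3) = - r3 t" for t
    by (simp_all add: p_def)
  have I: "finite I" "1 \<in> I" "2 \<in> I" "3 \<in> I" by (simp_all add: I_def)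
  have bij_m: "bij_betw uminus I I" by (rule bij_betw_byWitness[where f' = uminus]) (auto simp: I_def)
  have p_odd: "p t (- i) = - p t i" if "t \<in> {0..1}" "i \<in> I" for t i using that(2) by (auto simp: I_def p_simps)
  have p_cont: "continuous_on {0..1} (\<lambda>t. p t i)" if "i \<in> I" for i
    using that by (auto simp: I_def p_simps intro!: continuous_intros r_cont)
  have p_dist: "p t i \<noteq> p t j" if "t \<in> {0..1}" "i \<in> I" "j \<in> I" "i \<noteq> j" for t i j
  proof -
    have "r1 t \<noteq> r2 t" "r1 t \<noteq> r3 t" "r2 t \<noteq> r3 t" "r1 t \<noteq> - r2 t" "r1 t \<noteq> - r3 t" "r2 t \<noteq> - r3 t"
      "- r1 t \<noteq> r2 t" "- r1 t \<noteq> r3 t" "- r2 t \<noteq> r3 t"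
      using r_nz[OF that(1)] by (auto simp: eq_neg_iff_add_eq_0 neg_eq_iff_add_eq_0)
    then show ?thesis using r_nz(1-3)[OF that(1)] that(2-4)
      unfolding I_def by (elim insertE emptyE) (auto simp: p_simps dest: sym)
  qed
  obtain G R where G: "continuous_on ({0..1} \<times> UNIV) (\<lambda>(t, z). G t z)" "\<And>t. t \<in> {0..1} \<Longrightarrow> bij (G t)"
    "\<And>t z. t \<in> {0..1} \<Longrightarrow> R \<le> cmod z \<Longrightarrow> G t z = z" "\<And>z. G 0 z = z"
    "\<And>t i. t \<in> {0..1} \<Longrightarrow> i \<in> I \<Longrightarrow> G t (p 0 i) = p t i" "\<And>t z. t \<in> {0..1} \<Longrightarrow> G t (- z) = - G t z"
  proof (rule configuration_path_follow[where p = p and I = I and m = uminus, OF I(1) p_cont p_dist bij_m p_odd])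
    fix G R assume a: "continuous_on ({0..1} \<times> UNIV) (\<lambda>(t, z). G t z)" "\<And>t. t \<in> {0..1} \<Longrightarrow> bij (G t)"
      "\<And>t z. t \<in> {0..1} \<Longrightarrow> R \<le> cmod z \<Longrightarrow> G t z = z" "\<And>z. G 0 z = z"
      "\<And>t i. t \<in> {0..1} \<Longrightarrow> i \<in> I \<Longrightarrow> G t (p 0 i) = p t i" "\<And>t z. t \<in> {0..1} \<Longrightarrow> G t (- z) = - G t z"
    show ?thesis by (rule that[OF a])
  qed
  have Gs: "G t s1 = r1 t" "G t s2 = r2 t" "G t s3 = r3 t" if "t \<in> {0..1}" for t
    using G(5)[OF that I(2)] G(5)[OF that I(3)] G(5)[OF that I(4)] by (simp_all add: p_simps r_ends)
  have G_zero: "G t z = 0 \<longleftrightarrow> z = 0" if "t \<in> {0..1}" for t z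
  proof -
    have "G t 0 = 0" using G(6)[OF that, of 0] by simp
    then show ?thesis using G(2)[OF that] by (metis bij_def injD)
  qed
  define D where "D t w = (G t (csqrt w))\<^sup>2" for t w
  have D: "D t (z\<^sup>2) = (G t z)\<^sup>2" if "t \<in> {0..1}" for t z
    unfolding D_def by (rule descend_odd(1)[OF G(1-3,6) that])
  have D_zero: "D t 0 = 0" if "t \<in> {0..1}" for t using D[OF that, of 0] G_zero[OF that] by simp
  have famD: "fam I01 (\<lambda>t. map_option (D t))"
    unfolding D_def by (rule descend_odd(2)[OF G(1-3,6)])
  have famG: "fam I01 (\<lambda>t. map_option (G t))" by (rule fam_map_option[OF G(1-3)])

  define M' where "M' = mob m4 (- m2) (- m3) m1"
  define N' where "N' = mob n4 (- n2) (- n3) n1"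
  have M': "M (M' p) = p" "M' (M p) = p" and N': "N (N' p) = p" "N' (N p) = p" for p
    using mob_inverse[OF detM] mob_inverse[OF detN] by (simp_all add: M_def M'_def N_def N'_def)
  define \<Phi> where "\<Phi> t = M \<circ> map_option (D t) \<circ> M'" for t
  define \<Psi> where "\<Psi> t = N \<circ> map_option (G t) \<circ> N'" for t
  have fam\<Phi>: "fam I01 \<Phi>" unfolding \<Phi>_def[abs_def] M_def M'_def by (rule fam_mob_conj[OF famD detM])
  have fam\<Psi>: "fam I01 \<Psi>" unfolding \<Psi>_def[abs_def] N_def N'_def by (rule fam_mob_conj[OF famG detN])
  have G0: "map_option (G 0) = id" using G(4) by (auto simp: fun_eq_iff option.map_ident map_option_case split: option.split)
  have D0: "map_option (D 0) = id" using G(4) by (auto simp: fun_eq_iff D_def map_option_case split: option.split)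
  have \<Phi>0: "\<Phi> 0 = id" unfolding \<Phi>_def D0 using M' by (auto simp: fun_eq_iff)
  have \<Psi>0: "\<Psi> 0 = id" unfolding \<Psi>_def G0 using N' by (auto simp: fun_eq_iff)
  have hom: "\<Phi> 1 \<in> homeo_plus" "\<Psi> 1 \<in> homeo_plus"
    using fam_imp_homeo_plus[OF fam\<Phi> \<Phi>0] fam_imp_homeo_plus[OF fam\<Psi> \<Psi>0] by auto
  have \<Phi>_M: "\<Phi> t (M u) = M (map_option (D t) u)" for t u by (simp add: \<Phi>_def M')
  have \<Psi>_N: "\<Psi> t (N u) = N (map_option (G t) u)" for t u by (simp add: \<Psi>_def N')

  \<comment> \<open>\<open>G 1\<close> covers \<open>D 1\<close> through squaring, so the map
    between the two deformed spheres is \<open>f\<close> itself; rationality is inherited and \<psi>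
    is explicit.\<close>
  have semiconj: "\<Phi> 1 (f w) = f (\<Psi> 1 w)" for w
  proof -
    obtain u where u: "w = N u" using N' by metis
    show ?thesis unfolding u f_N \<Phi>_M \<Psi>_N using D[of 1] by (cases u) auto
  qed
  have "\<Phi> 1 \<circ> f \<circ> inv (\<Psi> 1) = f"
  proof -
    have "bij (\<Psi> 1)" using hom(2) by (simp add: homeo_plus_def homeomorphic_map_P1_iff)
    then show ?thesis using semiconj by (auto simp: fun_eq_iff bij_def surj_f_inv_f)
  qed
  then have rat: "rational_map (\<Phi> 1 \<circ> f \<circ> inv (\<Psi> 1))" using F by simp

  have iso\<Phi>: "isotopic_rel A (\<Phi> 1) id"
  proof -
    \<comment> \<open>The affine map that returns the first and third squares to their places. By
      \<open>r_x\<close> it returns the second one as well, and it is trivial at both ends, so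
      \<open>\<Phi> 1\<close> is reached by an isotopy fixing \<open>A\<close>.\<close>
    define \<alpha> where "\<alpha> t = (s1\<^sup>2 - s3\<^sup>2) / ((r1 t)\<^sup>2 - (r3 t)\<^sup>2)" for t
    define \<beta> where "\<beta> t = s3\<^sup>2 - \<alpha> t * (r3 t)\<^sup>2" for t
    have rr: "(r1 t)\<^sup>2 - (r3 t)\<^sup>2 \<noteq> 0" if "t \<in> {0..1}" for t
    proof -
      have "(r1 t)\<^sup>2 - (r3 t)\<^sup>2 = (r1 t - r3 t) * (r1 t + r3 t)" by algebra
      then show ?thesis using r_nz[OF that] by simp
    qed
    have \<alpha>: "\<alpha> t \<noteq> 0" "\<alpha> t * ((r1 t)\<^sup>2 - (r3 t)\<^sup>2) = s1\<^sup>2 - s3\<^sup>2" if "t \<in> {0..1}" for t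
      using rr[OF that] ne by (simp_all add: \<alpha>_def)
    have c\<alpha>: "continuous_on {0..1} \<alpha>" "continuous_on {0..1} \<beta>"
      unfolding \<beta>_def \<alpha>_def by (intro continuous_intros r_cont; use rr in simp)+
    define E where "E t = mob (\<alpha> t) (\<beta> t) 0 1" for t
    have E: "E t (Some w) = Some (\<alpha> t * w + \<beta> t)" "E t None = None" if "t \<in> {0..1}" for t w
      using \<alpha>(1)[OF that] by (simp_all add: E_def mob_def)
    have E1: "E t p = p" if "t = 0 \<or> t = 1" for t p
    proof -
      have "\<alpha> t = 1" "\<beta> t = 0" using that ne by (auto simp: \<alpha>_def \<beta>_def r_ends)
      then show ?thesis by (simp add: E_def mob_id)
    qed
    have famE: "fam I01 E" unfolding E_def[abs_def] by (rule fam_mob) (use c\<alpha> \<alpha>(1) in auto)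
    let ?K = "\<lambda>t. M \<circ> (E t \<circ> map_option (D t)) \<circ> M'"
    show ?thesis
    proof (rule isotopic_rel_reverse[where H = ?K])
      show "fam I01 ?K" unfolding M_def M'_def by (rule fam_mob_conj[OF fam_compose[OF famE famD] detM])
      show "?K 0 = id" using E1[of 0] by (auto simp: D0 fun_eq_iff M')
      show "?K 1 = \<Phi> 1" using E1[of 1] by (auto simp: \<Phi>_def fun_eq_iff)
      fix t p assume t: "t \<in> {0..1::real}" and p: "p \<in> A"
      have "\<alpha> t * (r2 t)\<^sup>2 + \<beta> t = s2\<^sup>2"
      proof -
        have "\<alpha> t * (r2 t)\<^sup>2 + \<beta> t = s3\<^sup>2 + \<alpha> t * ((r2 t)\<^sup>2 - (r3 t)\<^sup>2)" unfolding \<beta>_def by algebra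
        also have "\<dots> = s3\<^sup>2 + x * (s1\<^sup>2 - s3\<^sup>2)" unfolding r_x \<alpha>(2)[OF t, symmetric] by algebra
        also have "\<dots> = s2\<^sup>2" using ne by (simp add: x_def)
        finally show ?thesis .
      qed
      moreover have "\<alpha> t * (r1 t)\<^sup>2 + \<beta> t = s1\<^sup>2" using \<alpha>(2)[OF t] unfolding \<beta>_def by algebra
      moreover have "\<alpha> t * (r3 t)\<^sup>2 + \<beta> t = s3\<^sup>2" unfolding \<beta>_def by algebra
      ultimately show "?K t p = p"
        using p unfolding A a_M by (auto simp: M' E[OF t] D[OF t] Gs[OF t])
    qed
  qed

  have iso\<Psi>: "isotopic_rel A (\<Psi> 1) id"
  proof -
    \<comment> \<open>The affine normalisation with \<open>r1\<close> at 0 and \<open>r3\<close> at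
      1, which puts \<open>r2\<close> at \<open>y t\<close>. Below, \<open>L\<close> is its inverse
      at both ends, so the conjugated isotopy follows the loop \<open>y\<close> and \<open>H\<close>
      applies.\<close>
    define E where "E t = mob 1 (- r1 t) 0 (r3 t - r1 t)" for t
    have d: "r3 t - r1 t \<noteq> 0" if "t \<in> {0..1}" for t using r_nz(6)[OF that] by simp
    have E: "E t (Some w) = Some ((w - r1 t) / (r3 t - r1 t))" "E t None = None" if "t \<in> {0..1}" for t w
      using d[OF that] by (simp_all add: E_def mob_def proj_def)
    define L where "L = mob (s3 - s1) s1 0 1"
    have s31: "s3 - s1 \<noteq> 0" using s_ne by simp
    have L: "L (Some w) = Some ((s3 - s1) * w + s1)" "L None = None" for w
      using s31 by (simp_all add: L_def mob_def)
    have EL: "E t (L p) = p" "L (E t p) = p" if "t = 0 \<or> t = 1" for t p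
      using that s31 by (cases p; auto simp: E L r_ends)+
    have famE: "fam I01 E" unfolding E_def[abs_def] by (rule fam_mob) (use r_cont d in \<open>auto intro!: continuous_intros\<close>)
    have famL: "fam I01 (\<lambda>_. L)" unfolding L_def by (rule fam_const[OF homeomorphic_map_mob]) (use s31 in simp)
    let ?K = "\<lambda>t. E t \<circ> (map_option (G t) \<circ> L)"
    define h where "h w i = (if i = 0 then 0 else if i = 1 then 1 else H w)" for w and i :: nat
    define b where "b i = (if i = 0 then 0 else if i = 1 then 1 else x)" for i :: nat
    have "isotopic_rel (insert None ((\<lambda>i. Some (b i)) ` {0, 1, 2})) (?K 1) id"
    proof (rule isotopic_id_if_nullhomotopic[where h = h])
      show "continuous_on ({0..1} \<times> {0..1}) (\<lambda>w. h w i)" for i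
        by (cases "i = 0"; cases "i = 1") (use H(1) in \<open>auto simp: h_def\<close>)
      show "h w i \<noteq> h w j" if "w \<in> {0..1} \<times> {0..1}" "i \<in> {0, 1, 2}" "j \<in> {0, 1, 2}" "i \<noteq> j" for w i j
        using that(2-4) H(2)[OF that(1)] by (auto simp: h_def)
      show "h (1, t) i = b i" if "t \<in> {0..1}" for t i using H(4)[OF that] by (simp add: h_def b_def)
      show "h (s, 0) i = b i" if "s \<in> {0..1}" for s i using H(5)[OF that] by (simp add: h_def b_def)
      show "h (s, 1) i = b i" if "s \<in> {0..1}" for s i using H(6)[OF that] by (simp add: h_def b_def)
      show "fam I01 ?K" by (intro fam_compose famE famG famL)
      show "?K 0 = id" using EL[of 0] by (auto simp: G0 fun_eq_iff)
      show "?K t None = None" if "t \<in> {0..1}" for t using that by (simp add: L E)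
      show "?K t (Some (b i)) = Some (h (0, t) i)" if t: "t \<in> {0..1}" and i: "i \<in> {0, 1, 2}" for t i
      proof -
        have "(s3 - s1) * x + s1 = s2" using s31 by (simp add: x_eq)
        moreover have "(r2 t - r1 t) / (r3 t - r1 t) = y t" using r_y[of t] d[OF t] by simp
        ultimately show ?thesis using i d[OF t] by (auto simp: b_def h_def L E[OF t] Gs[OF t] H(3)[OF t])
      qed
    qed simp_all
    then have iso: "isotopic_rel {None, Some 0, Some 1, Some x} (?K 1) id" by (simp add: b_def insert_commute)
    \<comment> \<open>The matrix of \<open>N\<close> composed with \<open>L\<close>, which returns
      from the normalised coordinate to the sphere.\<close>
    define C where "C = mob (n1 * (s3 - s1)) (n1 * s1 + n2) (n3 * (s3 - s1)) (n3 * s1 + n4)"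
    define C' where "C' = mob (n3 * s1 + n4) (- (n1 * s1 + n2)) (- (n3 * (s3 - s1))) (n1 * (s3 - s1))"
    have detC: "n1 * (s3 - s1) * (n3 * s1 + n4) - (n1 * s1 + n2) * (n3 * (s3 - s1)) \<noteq> 0"
    proof -
      have "n1 * (s3 - s1) * (n3 * s1 + n4) - (n1 * s1 + n2) * (n3 * (s3 - s1)) = (n1 * n4 - n2 * n3) * (s3 - s1)" by algebra
      then show ?thesis using detN s31 by simp
    qed
    have C: "C p = N (L p)" for p
      unfolding C_def N_def L_def by (subst mob_mob) (use s31 in \<open>simp_all add: algebra_simps\<close>)
    have C': "C' p = E 1 (N' p)" for p
    proof -
      have "C (E 1 (N' p)) = p" using EL[of 1] by (simp add: C N')
      moreover have "C' (C q) = q" for q unfolding C_def C'_def by (rule mob_inverse(1)[OF detC])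
      ultimately show ?thesis by metis
    qed
    have "isotopic_rel (C ` {None, Some 0, Some 1, Some x}) (C \<circ> ?K 1 \<circ> C') id"
      unfolding C_def C'_def by (rule isotopic_rel_mob_conj[OF iso detC])
    moreover have "C \<circ> ?K 1 \<circ> C' = \<Psi> 1"
      using EL[of 1] by (auto simp: fun_eq_iff C C' \<Psi>_def)
    moreover have "C ` {None, Some 0, Some 1, Some x} = A"
    proof -
      have "(s3 - s1) * x + s1 = s2" using s31 by (simp add: x_eq)
      then show ?thesis unfolding A a0_def a1_def a2_def a3_def by (auto simp: C L)
    qed
    ultimately show ?thesis by simp
  qed

  have cls: "teich_class A (\<Psi> 1) = teich_class A (\<Phi> 1)"
    using teich_class_isotopic_id[OF iso\<Phi>] teich_class_isotopic_id[OF iso\<Psi>] by simp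
  have Def: "teich_class B (\<Phi> 1) \<in> Def_space B A f"
    unfolding Def_space_def teich_def
    using hom rat cls teich_class_self[OF hom(1), of B] by blast

  have h\<Phi>: "homeomorphic_map P1 P1 (\<Phi> t)" if "t \<in> {0..1}" for t
    by (rule fam_homeomorphic_map[OF fam\<Phi>]) (use that in simp)
  have contG: "continuous_on (- {0}) (G t)" if "t \<in> {0..1}" for t
    by (rule continuous_on_compose2[OF G(1), of "- {0}" "\<lambda>z. (t, z)", simplified]) (use that in \<open>auto intro!: continuous_intros\<close>)
  have lift: "CR (\<Phi> t (M (Some (z\<^sup>2)))) (\<Phi> t (M (Some (z'\<^sup>2)))) (\<Phi> t v) (\<Phi> t a1) = (G t z / G t z')\<^sup>2"
    if t: "t \<in> {0..1}" for t z z'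
  proof -
    have "CR (M (Some ((G t z)\<^sup>2))) (M (Some ((G t z')\<^sup>2))) (M (Some 0)) (M None) =
      CR (Some ((G t z)\<^sup>2)) (Some ((G t z')\<^sup>2)) (Some 0) None"
      unfolding M_def by (rule CR_mob[OF detM])
    then show ?thesis unfolding v_def a_M(2) \<Phi>_M by (simp add: D[OF t] D_zero[OF t] CR_def br_def power_divide)
  qed
  have QQ2: "(QQ (\<Phi> t))\<^sup>2 = (q t)\<^sup>2" if t: "t \<in> {0..1}" for t
  proof -
    have "(QQ (\<Phi> t))\<^sup>2 = (G t s1 + G t s2) / (G t s2 + G t s3)"
      by (rule QQ_lift[OF h\<Phi>[OF t] contG[OF t] _ lift[OF t]]) (use G_zero[OF t] in auto)
    also have "\<dots> = (1 - x) * (1 - y t) / (x * y t)"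
    proof -
      have e: "\<mu> * (2 * (1 - x) * (y t - 1)) = (- 2 * \<mu>) * ((1 - x) * (1 - y t))" "\<mu> * (- 2 * x * y t) = (- 2 * \<mu>) * (x * y t)"
        by algebra+
      show ?thesis unfolding Gs[OF t] r_id e by (rule mult_divide_mult_cancel_left) (use \<mu>(1) in simp)
    qed
    finally show ?thesis using q(4)[OF t] by simp
  qed
  \<comment> \<open>Two continuous roots of the same function, equal at time 0.\<close>
  have QQ: "QQ (\<Phi> t) = q t" if t: "t \<in> {0..1}" for t
  proof (rule continuous_sqrt_unique[of "{0..1}" "\<lambda>t. QQ (\<Phi> t)" q 0])
    show "continuous_on {0..1} (\<lambda>t. QQ (\<Phi> t))" using continuous_invariants(1)[OF fam\<Phi>] by simp
    show "QQ (\<Phi> 0) = q 0" by (simp add: \<Phi>0 QQ_id q(2))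
  qed (use q QQ2 t in auto)
  have KKx: "exp (KK (\<Phi> t)) = x" if t: "t \<in> {0..1}" for t
  proof -
    have "exp (KK (\<Phi> t)) = ((G t s2)\<^sup>2 - (G t s3)\<^sup>2) / ((G t s1)\<^sup>2 - (G t s3)\<^sup>2)"
      by (rule exp_KK_lift[OF h\<Phi>[OF t] contG[OF t] _ lift[OF t]]) (use G_zero[OF t] in auto)
    also have "\<dots> = x"
    proof -
      have "(r1 t)\<^sup>2 - (r3 t)\<^sup>2 = (r1 t - r3 t) * (r1 t + r3 t)" by algebra
      then show ?thesis unfolding Gs[OF t] r_x using r_nz[OF t] by simp
    qed
    finally show ?thesis .
  qed
  have KK: "KK (\<Phi> 1) = KK (\<Phi> 0)"
    by (rule constant_if_exp_constant[of "{0..1}" "\<lambda>t. KK (\<Phi> t)" x])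
      (use KKx continuous_invariants(3)[OF fam\<Phi>] in auto)
  have "LL (\<Phi> 1) - \<eta> 1 = LL (\<Phi> 0) - \<eta> 0"
  proof (rule constant_if_exp_constant[of "{0..1}" "\<lambda>t. LL (\<Phi> t) - \<eta> t" "1 / 2"])
    show "continuous_on {0..1} (\<lambda>t. LL (\<Phi> t) - \<eta> t)"
      using continuous_invariants(2)[OF fam\<Phi>] \<eta>(1) by (intro continuous_intros) auto
    fix t assume t: "t \<in> {0..1::real}"
    have "exp (LL (\<Phi> t)) = exp (\<eta> t) / 2"
      using exp_invariants(1)[OF fam\<Phi>, of t] QQ[OF t] \<eta>(2)[OF t] t by simp
    then show "exp (LL (\<Phi> t) - \<eta> t) = 1 / 2" by (simp add: exp_diff)
  qed auto
  then have "LL (\<Phi> 1) + KK (\<Phi> 1) = LL id + KK id + (\<eta> 1 - \<eta> 0)"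
    using KK \<Phi>0 by (simp add: algebra_simps)
  moreover have "QQ (\<Phi> 1) * exp (KK (\<Phi> 1)) / (1 - exp (KK (\<Phi> 1))) = 1"
    using QQ[of 1] KKx[of 1] x_ne by (simp add: q(3) q0_def)
  ultimately show ?thesis using hom(1) Def by blast
qed

end

section \<open>Existence of paths and loops\<close>

lemma countable_exp_vimage:
  fixes C :: "complex set"
  assumes "countable C"
  shows "countable {w. exp w \<in> C}"
proof -
  have one: "countable {w. exp w = c}" for c :: complex
  proof (cases "\<exists>w0. exp w0 = c")
    case True
    then obtain w0 where w0: "exp w0 = c" by blast
    have "{w. exp w = c} \<subseteq> range (\<lambda>n::int. w0 + of_int (2 * n) * pi * \<i>)"
    proof
      fix w assume "w \<in> {w. exp w = c}"
      then have "exp w = exp w0" using w0 by simp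
      then obtain n :: int where "w = w0 + of_int (2 * n) * pi * \<i>" unfolding exp_eq by blast
      then show "w \<in> range (\<lambda>n::int. w0 + of_int (2 * n) * pi * \<i>)" by blast
    qed
    then show ?thesis by (rule countable_subset) simp
  next
    case False
    then have "{w. exp w = c} = {}" by auto
    then show ?thesis by simp
  qed
  have "{w. exp w \<in> C} = (\<Union>c\<in>C. {w. exp w = c})" by auto
  then show ?thesis using assms one by simp
qed

lemma point_in_path_image: "t \<in> {0..1} \<Longrightarrow> g t \<in> path_image g"
  unfolding path_image_def by (rule imageI)

lemma path_avoiding_countable:
  fixes a b :: complex
  assumes "countable C" "a \<notin> C" "b \<notin> C"
  obtains g where "path g" "path_image g \<subseteq> - C" "pathstart g = a" "pathfinish g = b"
proof -
  have "path_connected (- C)" by (rule path_connected_complement_countable) (use assms in auto)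
  then show ?thesis using assms that unfolding path_connected_def by blast
qed

text \<open>Injectivity is needed for the path \<omega>, which must never return to its starting
  point.\<close>

lemma arc_avoiding_countable:
  fixes a b :: complex
  assumes "countable C" "a \<notin> C" "b \<notin> C" "a \<noteq> b"
  obtains g where "arc g" "path_image g \<subseteq> - C" "pathstart g = a" "pathfinish g = b"
proof -
  have "path_connected (- C)" by (rule path_connected_complement_countable) (use assms in auto)
  then show ?thesis using assms that unfolding path_connected_arcwise by blast
qed

text \<open>The winding around \<open>-1\<close> is recorded by the logarithm \<open>\<eta>\<close> of \<open>1 + q\<close>. The loop runs along a path to a
  neighbourhood of \<open>-1\<close>, around \<open>-1\<close>, and back along the same path; hence it is null-homotopic once \<open>-1\<close>
  is filled in.\<close>

lemma winding_loop:
  fixes T :: "complex set" and n :: nat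
  assumes T: "finite T" "q0 \<notin> T" "-1 \<notin> T" and q0: "q0 \<noteq> -1"
  obtains \<eta> :: "real \<Rightarrow> complex" where "path \<eta>" "\<eta> 1 - \<eta> 0 = 2 * of_nat n * pi * \<i>"
    "\<And>t. t \<in> {0..1} \<Longrightarrow> -1 + exp (\<eta> t) \<notin> T" "-1 + exp (\<eta> 0) = q0" "-1 + exp (\<eta> 1) = q0"
    "homotopic_paths (- T) (\<lambda>t. -1 + exp (\<eta> t)) (linepath q0 q0)"
proof -
  obtain \<epsilon> where \<epsilon>: "\<epsilon> > 0" "\<And>z. z \<in> T \<Longrightarrow> \<epsilon> \<le> dist (-1) z"
    using finite_set_avoid[OF T(1), of "-1"] T(3) by metis
  have ball: "ball (-1) \<epsilon> \<subseteq> - T" using \<epsilon>(2) by force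
  define E :: "complex \<Rightarrow> complex" where "E z = -1 + exp z" for z
  \<comment> \<open>\<open>e1\<close> lies over a point of the circle of radius \<epsilon>/2 about
    -1, and the vertical segment from \<open>e1\<close> to \<open>e1 + s\<close> covers that circle
    n times.\<close>
  define e1 where "e1 = complex_of_real (ln (\<epsilon> / 2))"
  define e0 where "e0 = Ln (1 + q0)"
  have "1 + q0 \<noteq> 0" using q0 by (metis add.inverse_unique)
  then have Ee0: "E e0 = q0" by (simp add: E_def e0_def)
  have exp_e1: "exp e1 = of_real (\<epsilon> / 2)" using \<epsilon>(1) by (simp add: e1_def exp_of_real)
  have Ee1: "E e1 \<in> ball (-1) \<epsilon>" using \<epsilon>(1) by (simp add: E_def exp_e1 dist_norm norm_divide)
  define C where "C = {w. exp w \<in> (\<lambda>z. 1 + z) ` T}"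
  have C: "w \<in> C \<longleftrightarrow> E w \<in> T" for w
    by (auto simp: C_def E_def image_iff) (metis add.assoc add.left_inverse add_0 add_uminus_conv_diff diff_add_cancel add.commute)+
  have "countable C" unfolding C_def by (rule countable_exp_vimage) (use T(1) countable_finite in blast)
  moreover have "e0 \<notin> C" "e1 \<notin> C" using C Ee0 Ee1 T(2) ball by auto
  ultimately obtain a where a: "path a" "path_image a \<subseteq> - C" "pathstart a = e0" "pathfinish a = e1"
    by (rule path_avoiding_countable)
  define s :: complex where "s = 2 * of_nat n * pi * \<i>"
  have Es: "E (z + s) = E z" for z
  proof -
    have "exp s = 1" using exp_eq_1[of s] by (auto simp: s_def intro!: exI[of _ "int n"])
    then show ?thesis by (simp add: E_def exp_add)
  qed
  \<comment> \<open>The way back is the reversed path translated by the period \<open>s\<close>, so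
    its image under \<open>E\<close> retraces the way out.\<close>
  define b where "b t = reversepath a t + s" for t
  have b: "path b" "pathstart b = e1 + s" "pathfinish b = e0 + s"
    using a by (auto simp: b_def[abs_def] path_def pathstart_def pathfinish_def reversepath_def intro!: continuous_intros
      continuous_on_compose2[OF a(1)[unfolded path_def]])
  define \<eta> where "\<eta> = a +++ (linepath e1 (e1 + s) +++ b)"
  have path_\<eta>: "path \<eta>" using a b by (simp add: \<eta>_def)
  have ends: "\<eta> 0 = e0" "\<eta> 1 = e0 + s"
    using a b unfolding \<eta>_def by (metis pathstart_def pathstart_join, metis pathfinish_def pathfinish_join)
  have Eb: "E \<circ> b = reversepath (E \<circ> a)" by (auto simp: fun_eq_iff b_def reversepath_def Es)
  have Eline: "(E \<circ> linepath e1 (e1 + s)) t \<in> ball (-1) \<epsilon>" for t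
  proof -
    have "linepath e1 (e1 + s) t = e1 + of_real (t * (2 * real n * pi)) * \<i>"
      by (simp add: linepath_def s_def scaleR_conv_of_real algebra_simps)
    then have "exp (linepath e1 (e1 + s) t) = exp e1 * cis (t * (2 * real n * pi))"
      by (simp add: exp_add cis_conv_exp mult.commute)
    then have "cmod (exp (linepath e1 (e1 + s) t)) = cmod (exp e1 * cis (t * (2 * real n * pi)))" by (simp only:)
    also have "\<dots> = \<epsilon> / 2" using \<epsilon>(1) by (simp add: norm_mult exp_e1 norm_divide del: norm_exp_eq_Re)
    finally show ?thesis using \<epsilon>(1) by (simp add: E_def dist_norm)
  qed
  have E_\<eta>: "E \<circ> \<eta> = (E \<circ> a) +++ ((E \<circ> linepath e1 (e1 + s)) +++ reversepath (E \<circ> a))"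
    by (simp add: \<eta>_def path_compose_join Eb)
  have contE: "continuous_on S E" for S unfolding E_def by (intro continuous_intros)
  have pathE: "path (E \<circ> p)" if "path p" for p using that by (intro path_continuous_image contE)
  have Ea: "path_image (E \<circ> a) \<subseteq> - T" using a(2) C by (auto simp: path_image_compose)
  have Eends: "pathstart (E \<circ> a) = q0" "pathfinish (E \<circ> a) = E e1"
    using a Ee0 by (simp_all add: pathstart_compose pathfinish_compose)
  have Eline_ends: "pathstart (E \<circ> linepath e1 (e1 + s)) = E e1" "pathfinish (E \<circ> linepath e1 (e1 + s)) = E e1"
    by (simp_all add: pathstart_compose pathfinish_compose Es)
  \<comment> \<open>The turns around -1 contract linearly inside the ball, which contains no point
    of \<open>T\<close> although it contains -1.\<close>
  have h1: "homotopic_paths (- T) (E \<circ> linepath e1 (e1 + s)) (linepath (E e1) (E e1))"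
  proof (rule homotopic_paths_linear)
    fix t
    have "closed_segment ((E \<circ> linepath e1 (e1 + s)) t) (linepath (E e1) (E e1) t) \<subseteq> ball (-1) \<epsilon>"
      by (rule closed_segment_subset[OF Eline _ convex_ball]) (use Ee1 in \<open>simp add: linepath_refl\<close>)
    then show "closed_segment ((E \<circ> linepath e1 (e1 + s)) t) (linepath (E e1) (E e1) t) \<subseteq> - T" using ball by blast
  qed (use pathE Eline_ends in auto)
  have rev: "path (reversepath (E \<circ> a))" "path_image (reversepath (E \<circ> a)) \<subseteq> - T"
    using pathE[OF a(1)] Ea by simp_all
  have "homotopic_paths (- T) (E \<circ> \<eta>) ((E \<circ> a) +++ (linepath (E e1) (E e1) +++ reversepath (E \<circ> a)))"
    unfolding E_\<eta>
    by (intro homotopic_paths_join h1) (use pathE[OF a(1)] Ea rev Eends Eline_ends in simp_all)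
  also have "homotopic_paths (- T) \<dots> ((E \<circ> a) +++ reversepath (E \<circ> a))"
    by (intro homotopic_paths_join homotopic_paths_lid' rev) (use pathE[OF a(1)] Ea Eends in simp_all)
  also have "homotopic_paths (- T) \<dots> (linepath (pathstart (E \<circ> a)) (pathstart (E \<circ> a)))"
    by (rule homotopic_paths_rinv[OF pathE[OF a(1)] Ea])
  finally have hom: "homotopic_paths (- T) (E \<circ> \<eta>) (linepath q0 q0)" by (simp add: Eends)
  have im: "path_image (E \<circ> \<eta>) \<subseteq> - T" using homotopic_paths_imp_subset[OF hom] by blast
  show ?thesis
  proof (rule that[OF path_\<eta>])
    show "\<eta> 1 - \<eta> 0 = 2 * of_nat n * pi * \<i>" by (simp add: ends s_def)
    show "-1 + exp (\<eta> t) \<notin> T" if "t \<in> {0..1}" for t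
    proof -
      have "(E \<circ> \<eta>) t \<in> path_image (E \<circ> \<eta>)" using that by (rule point_in_path_image)
      then show ?thesis using im by (auto simp: E_def simp del: add_uminus_conv_diff uminus_add_conv_diff)
    qed
    show "-1 + exp (\<eta> 0) = q0" "-1 + exp (\<eta> 1) = q0" using Ee0 Es[of e0] by (simp_all add: ends E_def)
    show "homotopic_paths (- T) (\<lambda>t. -1 + exp (\<eta> t)) (linepath q0 q0)" using hom unfolding E_def o_def .
  qed
qed

context normal_form
begin

lemma q0_ne: "q0 \<noteq> 0" "q0 \<noteq> 1" "q0 \<noteq> -1"
  using x_ne by (auto simp: q0_def field_simps)

lemma paths_exist: "\<exists>p1 \<omega> p3. normal_form_paths m1 m2 m3 m4 n1 n2 n3 n4 s1 s2 s3 f p1 \<omega> p3"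
proof -
  obtain p1 where p1: "path p1" "path_image p1 \<subseteq> - {0}" "pathstart p1 = s2" "pathfinish p1 = s3"
    using path_avoiding_countable[of "{0}" s2 s3] nz by auto
  obtain p3 where p3: "path p3" "path_image p3 \<subseteq> - {s3\<^sup>2}" "pathstart p3 = s1\<^sup>2" "pathfinish p3 = s2\<^sup>2"
    using path_avoiding_countable[of "{s3\<^sup>2}" "s1\<^sup>2" "s2\<^sup>2"] ne by auto
  define w1 where "w1 = 2 * Ln q0"
  have w1: "exp (w1 / 2) = q0" using q0_ne by (simp add: w1_def)
  have "w1 \<noteq> 0" using w1 q0_ne by auto
  define c where "c = {0, s2, s3, - s3}"
  \<comment> \<open>The start \<omega> = 0 gives the point \<open>s3\<close>, which is forbidden
    only at later times; hence 0 is taken out of \<open>C\<close> and the arc property excludes a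
    return. Other logarithms of 1 stay in \<open>C\<close>.\<close>
  define C where "C = {w. exp w \<in> (\<lambda>z. (z + s2) / (s3 + s2)) ` c} - {0}"
  have s32: "s3 + s2 \<noteq> 0" using s_ne by (simp add: add.commute)
  have C: "w \<in> C \<longleftrightarrow> - s2 + (s3 + s2) * exp w \<in> c \<and> w \<noteq> 0" for w
  proof -
    have "exp w = (z + s2) / (s3 + s2) \<longleftrightarrow> - s2 + (s3 + s2) * exp w = z" for z
      using s32 by (auto simp: field_simps)
    then show ?thesis unfolding C_def by auto
  qed
  have "countable C" unfolding C_def by (intro countable_Diff countable_exp_vimage) (simp add: c_def)
  moreover have "0 \<notin> C" by (simp add: C)
  moreover have "w1 \<notin> C"
  proof -
    note q0_power2
    moreover have "exp w1 = q0\<^sup>2" unfolding w1[symmetric] by (simp add: exp_double[symmetric])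
    ultimately have "- s2 + (s3 + s2) * exp w1 = s1" using s32 by (simp add: add.commute)
    then show ?thesis using nz s_ne by (simp add: C c_def)
  qed
  ultimately obtain \<omega> where \<omega>: "arc \<omega>" "path_image \<omega> \<subseteq> - C" "pathstart \<omega> = 0" "pathfinish \<omega> = w1"
    using arc_avoiding_countable \<open>w1 \<noteq> 0\<close> by metis
  have \<omega>C: "\<omega> t \<notin> C" if "t \<in> {0..1}" for t
    using \<omega>(2) point_in_path_image[OF that, of \<omega>] by blast
  have \<omega>0: "\<omega> t \<noteq> 0" if "t \<in> {0<..1}" for t
  proof
    assume "\<omega> t = 0"
    then have "\<omega> t = \<omega> 0" using \<omega>(3) by (simp add: pathstart_def)
    moreover have "inj_on \<omega> {0..1}" using \<omega>(1) by (simp add: arc_def)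
    ultimately have "t = 0" using that by (auto dest: inj_onD[of \<omega> "{0..1}" t 0])
    then show False using that by simp
  qed
  have "normal_form_paths m1 m2 m3 m4 n1 n2 n3 n4 s1 s2 s3 f p1 \<omega> p3"
  proof unfold_locales
    show "continuous_on {0..1} p1" "p1 0 = s2" "p1 1 = s3" using p1 by (simp_all add: path_def pathstart_def pathfinish_def)
    show "p1 t \<noteq> 0" if "t \<in> {0..1}" for t using p1(2) point_in_path_image[OF that, of p1] by auto
    show "continuous_on {0..1} p3" "p3 0 = s1\<^sup>2" "p3 1 = s2\<^sup>2" using p3 by (simp_all add: path_def pathstart_def pathfinish_def)
    show "p3 t \<noteq> s3\<^sup>2" if "t \<in> {0..1}" for t using p3(2) point_in_path_image[OF that, of p3] by auto
    show "continuous_on {0..1} \<omega>" using \<omega>(1) by (simp add: arc_def path_def)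
    show "\<omega> 0 = 0" using \<omega>(3) by (simp add: pathstart_def)
    show "exp (\<omega> 1 / 2) = q0" using \<omega>(4) w1 by (simp add: pathfinish_def)
    show "- s2 + (s3 + s2) * exp (\<omega> t) \<notin> {0, s2}" if "t \<in> {0..1}" for t
    proof (cases "\<omega> t = 0")
      case True
      then show ?thesis using nz s_ne by auto
    next
      case False
      then show ?thesis using \<omega>C[OF that] by (auto simp: C c_def)
    qed
    show "(- s2 + (s3 + s2) * exp (\<omega> t))\<^sup>2 \<noteq> s3\<^sup>2" if "t \<in> {0<..1}" for t
      using \<omega>C[of t] \<omega>0[OF that] that by (auto simp: C c_def power2_eq_iff)
  qed
  then show ?thesis by blast
qed

text \<open>The solution for x' of q^2 = (1 - x) (1 - x') / (x x'). The parameters in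
  \<open>bad\<close> are those where x' would be 1 or infinity.\<close>

definition "Y q = (1 - x) / (1 - x + x * q\<^sup>2)"
definition "bad = {q. q = 0 \<or> 1 - x + x * q\<^sup>2 = 0}"

lemma finite_sqrt: "finite {q :: complex. q\<^sup>2 = c}"
proof -
  have "{q. q\<^sup>2 = c} \<subseteq> {csqrt c, - csqrt c}" using power2_eq_iff[of _ "csqrt c"] by auto
  then show ?thesis using finite_subset by blast
qed

lemma finite_bad: "finite bad"
proof -
  have "bad \<subseteq> {0} \<union> {q. q\<^sup>2 = - (1 - x) / x}"
    using x_ne by (auto simp: bad_def field_simps add_eq_0_iff)
  then show ?thesis using finite_sqrt finite_subset by blast
qed

lemma Y:
  assumes "q \<notin> bad"
  shows "Y q \<noteq> 0" "Y q \<noteq> 1" "q\<^sup>2 = (1 - x) * (1 - Y q) / (x * Y q)" "Y q = 1 - x \<longleftrightarrow> q\<^sup>2 = 1"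
proof -
  have d: "1 - x + x * q\<^sup>2 \<noteq> 0" "q \<noteq> 0" using assms by (auto simp: bad_def)
  show "Y q \<noteq> 0" using d x_ne by (simp add: Y_def)
  have e: "1 - Y q = x * q\<^sup>2 / (1 - x + x * q\<^sup>2)" using d by (simp add: Y_def field_simps)
  then show "Y q \<noteq> 1" using d x_ne by auto
  show "q\<^sup>2 = (1 - x) * (1 - Y q) / (x * Y q)" unfolding e using d x_ne by (simp add: Y_def)
  have "Y q = 1 - x \<longleftrightarrow> 1 - x + x * q\<^sup>2 = 1" using d x_ne(2) by (auto simp: Y_def divide_eq_eq)
  also have "\<dots> \<longleftrightarrow> x * (q\<^sup>2 - 1) = 0" by algebra
  finally show "Y q = 1 - x \<longleftrightarrow> q\<^sup>2 = 1" using x_ne by simp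
qed

lemma finite_Y_vimage:
  assumes "finite R"
  shows "finite {q. q \<notin> bad \<and> Y q \<in> R}"
proof -
  have "{q. q \<notin> bad \<and> Y q \<in> R} \<subseteq> (\<Union>r\<in>R. {q. q\<^sup>2 = (1 - x) * (1 - r) / (x * r)})" using Y(3) by auto
  then show ?thesis using assms finite_sqrt finite_subset by blast
qed

lemma finite_S_roots: "finite {y. S1 y = 0 \<or> S2 y = 0 \<or> S3 y = 0}"
proof -
  have "{y. S1 y = 0 \<or> S2 y = 0 \<or> S3 y = 0} \<subseteq> {y. poly [:- (1 - x), 0, 1:] y = 0} \<union>
     {y. poly [:- (1 - x), 2 * (1 - x), - 1:] y = 0} \<union> {y. poly [:1 - x, - 2, 1:] y = 0}"
    by (auto simp: S1_def S2_def S3_def power2_eq_square algebra_simps)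
  moreover have "finite ({y. poly [:- (1 - x), 0, 1:] y = 0} \<union>
     {y. poly [:- (1 - x), 2 * (1 - x), - 1:] y = 0} \<union> {y. poly [:1 - x, - 2, 1:] y = 0})"
    by (intro finite_UnI poly_roots_finite) auto
  ultimately show ?thesis using finite_subset by blast
qed

lemma Y_q0: "q0 \<notin> bad" "Y q0 = x"
proof -
  have "1 - x + x * q0\<^sup>2 = (1 - x) / x" using x_ne by (simp add: q0_def power2_eq_square field_simps)
  then show "q0 \<notin> bad" "Y q0 = x" using x_ne q0_ne by (simp_all add: bad_def Y_def)
qed

lemma S_x: "S1 x \<noteq> 0" "S2 x \<noteq> 0" "S3 x \<noteq> 0"
  using \<mu> nz by auto

end

context normal_form_paths
begin

lemma realize:
  assumes F: "rational_map f" and A: "A = {a0, a1, a2, a3}"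
  shows "\<exists>\<phi>\<in>homeo_plus. teich_class B \<phi> \<in> Def_space B A f \<and>
    QQ \<phi> * exp (KK \<phi>) / (1 - exp (KK \<phi>)) = 1 \<and> LL \<phi> + KK \<phi> = LL id + KK id + 2 * of_nat n * pi * \<i>"
proof -
  define T0 where "T0 = {q. q \<notin> bad \<and> Y q \<in> {y. S1 y = 0 \<or> S2 y = 0 \<or> S3 y = 0}}"
  \<comment> \<open>Both 1 and -1 give x' = 1 - x, but only 1 is put into \<open>T\<close>. The loop
    avoids -1 because it is -1 plus an exponential, while the homotopy must be free to pass over
    it.\<close>
  define T where "T = bad \<union> {1} \<union> T0"
  have T: "finite T" unfolding T_def T0_def using finite_bad finite_Y_vimage[OF finite_S_roots] by simp
  have q0T: "q0 \<notin> T" using Y_q0 q0_ne S_x by (simp add: T_def T0_def)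
  have m1: "-1 \<notin> bad" "Y (-1) = 1 - x" by (simp_all add: bad_def Y_def)
  \<comment> \<open>At x' = 1 - x none of the three points is at the origin, so -1 is indeed outside
    \<open>T\<close>.\<close>
  have "S1 (1 - x) = - x * (1 - x)" "S2 (1 - x) = - x * (1 - x)" "S3 (1 - x) = - x * (1 - x)"
    unfolding S1_def S2_def S3_def by algebra+
  then have m1T: "-1 \<notin> T" using m1 x_ne by (simp add: T_def T0_def)
  obtain \<eta> where \<eta>: "path \<eta>" "\<eta> 1 - \<eta> 0 = 2 * of_nat n * pi * \<i>" "\<And>t. t \<in> {0..1} \<Longrightarrow> -1 + exp (\<eta> t) \<notin> T"
    "-1 + exp (\<eta> 0) = q0" "-1 + exp (\<eta> 1) = q0" "homotopic_paths (- T) (\<lambda>t. -1 + exp (\<eta> t)) (linepath q0 q0)"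
    using winding_loop[OF T q0T m1T q0_ne(3), of n] by blast
  define q where "q t = -1 + exp (\<eta> t)" for t
  obtain h :: "real \<times> real \<Rightarrow> complex" where h: "continuous_on ({0..1} \<times> {0..1}) h" "h \<in> {0..1} \<times> {0..1} \<rightarrow> - T"
    "\<forall>t\<in>{0..1}. h (0, t) = q t" "\<forall>t\<in>{0..1}. h (1, t) = linepath q0 q0 t"
    "\<forall>s\<in>{0..1}. pathstart (h \<circ> Pair s) = pathstart q \<and> pathfinish (h \<circ> Pair s) = pathfinish q"
    using \<eta>(6) unfolding homotopic_paths q_def[abs_def, symmetric] by blast
  have bad: "w \<notin> bad" if "w \<notin> T" for w using that by (simp add: T_def)
  have contY: "continuous_on (- T) Y"
    unfolding Y_def using bad by (intro continuous_intros) (auto simp: bad_def)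
  have Yq: "Y w \<noteq> 0 \<and> Y w \<noteq> 1 \<and> (w \<noteq> -1 \<longrightarrow> Y w \<noteq> 1 - x) \<and> S1 (Y w) \<noteq> 0 \<and> S2 (Y w) \<noteq> 0 \<and> S3 (Y w) \<noteq> 0" if w: "w \<notin> T" for w
    using Y(1,2,4)[OF bad[OF w]] w by (auto simp: T_def T0_def power2_eq_1_iff)
  have contq: "continuous_on {0..1} q" unfolding q_def by (intro continuous_intros \<eta>(1)[unfolded path_def])
  have qT: "q t \<notin> T" "q t \<noteq> -1" if "t \<in> {0..1}" for t using \<eta>(3)[OF that] by (simp_all add: q_def)
  have "\<exists>\<phi>\<in>homeo_plus. teich_class B \<phi> \<in> Def_space B A f \<and>
    QQ \<phi> * exp (KK \<phi>) / (1 - exp (KK \<phi>)) = 1 \<and> LL \<phi> + KK \<phi> = LL id + KK id + (\<eta> 1 - \<eta> 0)"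
  proof (rule realize_loop[where y = "\<lambda>t. Y (q t)" and q = q and H = "\<lambda>w. Y (h w)"])
    show "continuous_on {0..1} (\<lambda>t. Y (q t))" by (rule continuous_on_compose2[OF contY contq]) (use qT in auto)
    show "Y (q 0) = x" "Y (q 1) = x" "q 0 = q0" "q 1 = q0" using \<eta>(4,5) Y_q0 by (simp_all add: q_def)
    show "Y (q t) \<noteq> 0 \<and> Y (q t) \<noteq> 1 \<and> Y (q t) \<noteq> 1 - x \<and> S1 (Y (q t)) \<noteq> 0 \<and> S2 (Y (q t)) \<noteq> 0 \<and> S3 (Y (q t)) \<noteq> 0"
      if "t \<in> {0..1}" for t using Yq[OF qT(1)[OF that]] qT(2)[OF that] by blast
    show "q t \<noteq> 0 \<and> (q t)\<^sup>2 = (1 - x) * (1 - Y (q t)) / (x * Y (q t))" if "t \<in> {0..1}" for t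
      using Y(3)[OF bad[OF qT(1)[OF that]]] bad[OF qT(1)[OF that]] by (auto simp: bad_def)
    show "continuous_on {0..1} \<eta>" using \<eta>(1) by (simp add: path_def)
    show "exp (\<eta> t) = 1 + q t" for t by (simp add: q_def)
    show "continuous_on ({0..1} \<times> {0..1}) (\<lambda>w. Y (h w))" by (rule continuous_on_compose2[OF contY h(1)]) (use h(2) in auto)
    show "Y (h w) \<noteq> 0 \<and> Y (h w) \<noteq> 1" if "w \<in> {0..1} \<times> {0..1}" for w using Yq[of "h w"] h(2) that by blast
    show "Y (h (0, t)) = Y (q t)" if "t \<in> {0..1}" for t using h(3) that by simp
    show "Y (h (1, t)) = x" if "t \<in> {0..1}" for t using h(4) that Y_q0 by (simp add: linepath_refl)
    show "Y (h (s, 0)) = x" "Y (h (s, 1)) = x" if "s \<in> {0..1}" for s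
      using h(5) that \<eta>(4,5) Y_q0 by (simp_all add: pathstart_def pathfinish_def q_def)
  qed (use contq F A in simp_all)
  then show ?thesis by (simp only: \<eta>(2))
qed

end

lemma (in normal_form) infinitely_many_components:
  assumes F: "rational_map f" and A: "A = {a0, a1, a2, a3}" and B: "insert v A \<subseteq> B"
  shows "infinite (connected_components_of (subtopology (teich_top B) (Def_space B A f)))"
proof -
  obtain p1 \<omega> p3 where "normal_form_paths m1 m2 m3 m4 n1 n2 n3 n4 s1 s2 s3 f p1 \<omega> p3"
    using paths_exist by blast
  then interpret P: normal_form_paths m1 m2 m3 m4 n1 n2 n3 n4 s1 s2 s3 f p1 \<omega> p3 .
  show ?thesis
  proof (rule P.infinite_components)
    show "{a0, a1, a2, a3, v} \<subseteq> B" using A B by auto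
    show "(P.QQ \<phi> * exp (P.KK \<phi>) / (1 - exp (P.KK \<phi>)))\<^sup>2 = 1"
      if "\<phi> \<in> homeo_plus" "\<psi> \<in> homeo_plus" "rational_map (\<phi> \<circ> f \<circ> inv \<psi>)" "teich_class A \<psi> = teich_class A \<phi>" for \<phi> \<psi>
      by (rule P.Def_space_relation[OF that]) (simp add: A)
    show "\<exists>\<phi>\<in>homeo_plus. teich_class B \<phi> \<in> Def_space B A f \<and> P.QQ \<phi> * exp (P.KK \<phi>) / (1 - exp (P.KK \<phi>)) = 1 \<and>
        P.LL \<phi> + P.KK \<phi> = (P.LL id + P.KK id) + 2 * of_nat n * pi * \<i>" for n
      by (rule P.realize[OF F A])
  qed
qed

theorem mainTheorem1:
  fixes f :: "complex option \<Rightarrow> complex option" and c :: "complex option"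
  assumes quad: "rational_map_deg 2 f"
    and crit: "critical_point f c"
    and per4: "(f ^^ 4) c = c" and exact: "\<forall>k\<in>{1..3::nat}. (f ^^ k) c \<noteq> c"
    and onecrit: "\<forall>k<4. critical_point f ((f ^^ k) c) \<longrightarrow> (f ^^ k) c = c"
    and A_def: "A = {(f ^^ k) c | k. k < (4::nat)}"
    and B_def: "B = A \<union> critical_values f"
  shows "infinite (connected_components_of (subtopology (teich_top B) (Def_space B A f)))"
proof -
  obtain m1 m2 m3 m4 n1 n2 n3 n4 where mn: "m1 * m4 - m2 * m3 \<noteq> 0" "n1 * n4 - n2 * n3 \<noteq> 0"
    "\<And>w. f (mob n1 n2 n3 n4 w) = mob m1 m2 m3 m4 (map_option (\<lambda>z. z\<^sup>2) w)"
    "mob n1 n2 n3 n4 None = c" "critical_point f (mob n1 n2 n3 n4 (Some 0))"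
  proof (rule quadratic_normal_form[OF quad crit])
    fix m1 m2 m3 m4 n1 n2 n3 n4 assume mn: "m1 * m4 - m2 * m3 \<noteq> 0" "n1 * n4 - n2 * n3 \<noteq> 0"
      "\<And>w. f (mob n1 n2 n3 n4 w) = mob m1 m2 m3 m4 (map_option (\<lambda>z. z\<^sup>2) w)"
      "mob n1 n2 n3 n4 None = c" "critical_point f (mob n1 n2 n3 n4 (Some 0))"
    show ?thesis by (rule that[OF mn])
  qed
  define K where "K = mob m1 m2 m3 m4"
  define L where "L = mob n1 n2 n3 n4"
  have f_L: "f (L w) = K (map_option (\<lambda>z. z\<^sup>2) w)" for w by (simp add: K_def L_def mn(3))
  have L_surj: "\<exists>u. w = L u" and K_inj: "K u = K u' \<longleftrightarrow> u = u'" for w u u'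
    using bij_mob[OF mn(1)] bij_mob[OF mn(2)] by (auto simp: K_def L_def bij_def inj_eq surj_def)
  define a where "a k = (f ^^ k) c" for k
  have a_Suc: "f (a k) = a (Suc k)" for k by (simp add: a_def)
  have a4: "a 4 = c" and a0: "a 0 = c" using per4 by (simp_all add: a_def)
  have a_ne_c: "a k \<noteq> c" if "k \<in> {1, 2, 3}" for k using exact that by (auto simp: a_def)
  have a_ne: "a i \<noteq> a j" if "i < j" "j < 4" for i j
  proof
    assume "a i = a j"
    \<comment> \<open>The remaining steps bring \<open>a j\<close> back to \<open>c\<close>, so a
      coincidence would return to \<open>c\<close> after fewer than four steps.\<close>
    then have "(f ^^ (4 - j)) (a i) = (f ^^ (4 - j)) (a j)" by simp
    then have "a (4 - j + i) = a (4 - j + j)" by (simp add: a_def funpow_add)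
    then have "a (4 - j + i) = c" using that a4 by simp
    moreover have "4 - j + i \<in> {1, 2, 3}" using that by auto
    ultimately show False using a_ne_c by blast
  qed
  have coord: "\<exists>s. a k = L (Some s) \<and> s \<noteq> 0" if k: "k \<in> {1, 2, 3}" for k
  proof -
    obtain u where u: "a k = L u" using L_surj by blast
    have "u \<noteq> None"
    proof
      assume "u = None"
      then show False using u a_ne_c[OF k] mn(4) by (simp add: L_def)
    qed
    \<comment> \<open>The origin is the other critical point, which \<open>onecrit\<close> keeps off
      the cycle.\<close>
    moreover have "u \<noteq> Some 0"
    proof
      assume "u = Some 0"
      then have "critical_point f ((f ^^ k) c)" using mn(5) u by (simp add: L_def a_def)
      moreover have "k < 4" using k by auto
      ultimately show False using onecrit a_ne_c[OF k] unfolding a_def by blast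
    qed
    ultimately show ?thesis using u by (cases u) auto
  qed
  obtain s1 s2 s3 where s: "a 1 = L (Some s1)" "a 2 = L (Some s2)" "a 3 = L (Some s3)" and nz: "s1 \<noteq> 0" "s2 \<noteq> 0" "s3 \<noteq> 0"
    using coord[of 1] coord[of 2] coord[of 3] by auto
  have step: "a 2 = K (Some (s1\<^sup>2))" "a 3 = K (Some (s2\<^sup>2))" "a 4 = K (Some (s3\<^sup>2))" "a 1 = K None"
  proof -
    have "a 2 = f (a 1)" "a 3 = f (a 2)" "a 4 = f (a 3)" "a 1 = f (a 0)"
      unfolding a_Suc by (simp_all add: eval_nat_numeral)
    moreover have "a 0 = L None" using a0 mn(4) by (simp add: L_def)
    ultimately have "a 2 = f (L (Some s1))" "a 3 = f (L (Some s2))" "a 4 = f (L (Some s3))" "a 1 = f (L None)"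
      using s by metis+
    then show "a 2 = K (Some (s1\<^sup>2))" "a 3 = K (Some (s2\<^sup>2))" "a 4 = K (Some (s3\<^sup>2))" "a 1 = K None"
      by (simp_all add: f_L)
  qed
  interpret normal_form m1 m2 m3 m4 n1 n2 n3 n4 s1 s2 s3 f
  proof
    have "a 2 \<noteq> a 3" "a 2 \<noteq> a 4" "a 3 \<noteq> a 4" using a_ne[of 2 3] a_ne_c[of 2] a_ne_c[of 3] a4 by auto
    then show "s1\<^sup>2 \<noteq> s2\<^sup>2" "s1\<^sup>2 \<noteq> s3\<^sup>2" "s2\<^sup>2 \<noteq> s3\<^sup>2" unfolding step K_inj by auto
    show "mob m1 m2 m3 m4 None = mob n1 n2 n3 n4 (Some s1)" "mob m1 m2 m3 m4 (Some (s1\<^sup>2)) = mob n1 n2 n3 n4 (Some s2)"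
      "mob m1 m2 m3 m4 (Some (s2\<^sup>2)) = mob n1 n2 n3 n4 (Some s3)" "mob m1 m2 m3 m4 (Some (s3\<^sup>2)) = mob n1 n2 n3 n4 None"
      using step s a4 mn(4) by (simp_all add: K_def L_def)
  qed (use mn nz in auto)
  note defs = a0_def a1_def a2_def a3_def v_def M_def N_def
  have "A = a ` {..<4}" unfolding A_def a_def by auto
  also have "{..<4::nat} = {0, 1, 2, 3}" by auto
  finally have A: "A = {a0, a1, a2, a3}"
    using s mn(4) a0 by (simp add: defs L_def)
  have "v \<in> critical_values f"
  proof -
    have "v = f (mob n1 n2 n3 n4 (Some 0))" by (simp add: defs mn(3))
    then show ?thesis using mn(5) by (auto simp: critical_values_def)
  qed
  then have B: "insert v A \<subseteq> B" unfolding B_def by auto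
  have "rational_map f" using quad unfolding rational_map_def by (intro exI[of _ 2]) auto
  then show ?thesis using A B by (rule infinitely_many_components)
qed

end
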